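(* Let $\Omega$ be fixed and let $a_i,b_i,c_i$ $(i=1,2)$, $\gamma,\delta$ be positive constants. For $d>0$ consider the limiting system for the pair $(w,\tau)$: $$ \begin{cases} d\Delta w+f(u,v)-\gamma g(u,v)=0 \ \text{ in }\Omega,\qquad \tau>0,\\ \partial_\nu w=0\ \text{ on }\partial\Omega,\\ \displaystyle\int_\Omega f(u,v)=0, \end{cases} \qquad\text{where } u=u(w,\tau),\ v=v(w,\tau). $$ There exists a positive constant $C^*=C^*(a_i,b_i,c_i,\gamma,\delta)$ (independent of $d$) such that any solution $(w,\tau)$ of this system satisfies $$ \|w\|_\infty\le C^*\quad\text{and}\quad \tau\le\min\Bigl\{\frac{a_1^2}{4b_1c_1},\frac{a_2^2}{4b_2c_2}\Bigr\}. $$ Furthermore, there exists $\overline d=\overline d(a_i,b_i,c_i,\gamma,\delta)>0$ such that the system does not admit any nonconstant solution if $d>\overline d$.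
   Context: $\Omega\subset\mathbb{R}^N$ is a bounded domain with smooth boundary $\partial\Omega$ if $N\ge 2$, and a bounded open interval if $N=1$. The domain $\Omega$ is fixed throughout, and constants may also depend on $\Omega$. $\nu$ is the outward unit normal and $\partial_\nu w=\nu\cdot\nabla w$. $f(u,v):=u(a_1-b_1u-c_1v)$, $g(u,v):=v(a_2-b_2u-c_2v)$, and $$u(w,\tau):=\frac{\sqrt{w^2+4\gamma\delta\tau}+w}{2\delta},\qquad v(w,\tau):=\frac{\tau}{u(w,\tau)}=\frac{\sqrt{w^2+4\gamma\delta\tau}-w}{2\gamma}$$ (so that $w=\delta u-\gamma v$ and $\tau=uv$). A solution is a pair $(w,\tau)$ with $w\in C^2(\overline\Omega)$ and $\tau>0$ satisfying the system; it is called nonconstant when $w$ is a nonconstant function. $\|w\|_\infty=\max_{\overline\Omega}|w|$. *)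

theory Defs
  imports "HOL-Analysis.Analysis"
begin

section \<open>Function spaces and differential operators\<close>

definition partial_deriv :: "'a::euclidean_space \<Rightarrow> ('a \<Rightarrow> real) \<Rightarrow> 'a \<Rightarrow> real"
  where "partial_deriv b f x = frechet_derivative f (at x) b"

definition laplacian :: "('a::euclidean_space \<Rightarrow> real) \<Rightarrow> 'a \<Rightarrow> real"
  where "laplacian f x = (\<Sum>b\<in>Basis. partial_deriv b (partial_deriv b f) x)"

text \<open>For open \<open>\<Omega>\<close>: \<open>f\<close> is \<open>k\<close> times continuously differentiable in \<open>\<Omega>\<close> and all its partial
  derivatives of order at most \<open>k\<close> extend continuously to the closure.  The values of \<open>f\<close>
  outside \<open>\<Omega>\<close> are irrelevant here.\<close>

primrec Ck_extendable :: "nat \<Rightarrow> 'a::euclidean_space set \<Rightarrow> ('a \<Rightarrow> real) \<Rightarrow> bool"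
  where
    "Ck_extendable 0 \<Omega> f \<longleftrightarrow>
       (\<exists>F. continuous_on (closure \<Omega>) F \<and> (\<forall>x\<in>\<Omega>. F x = f x))"
  | "Ck_extendable (Suc k) \<Omega> f \<longleftrightarrow>
       (\<exists>F. continuous_on (closure \<Omega>) F \<and> (\<forall>x\<in>\<Omega>. F x = f x)) \<and>
       (\<forall>x\<in>\<Omega>. f differentiable (at x)) \<and>
       (\<forall>b\<in>Basis. Ck_extendable k \<Omega> (partial_deriv b f))"

text \<open>The space of \<open>C\<^sup>k\<close> functions on the closure of the open set \<open>\<Omega>\<close>; here the boundary values
  of \<open>f\<close> itself have to be those of the continuous extension.\<close>

definition Ck_closure :: "nat \<Rightarrow> 'a::euclidean_space set \<Rightarrow> ('a \<Rightarrow> real) \<Rightarrow> bool"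
  where "Ck_closure k \<Omega> f \<longleftrightarrow> continuous_on (closure \<Omega>) f \<and> Ck_extendable k \<Omega> f"

definition smooth :: "('a::euclidean_space \<Rightarrow> real) \<Rightarrow> bool"
  where "smooth h \<longleftrightarrow> (\<forall>k. Ck_closure k UNIV h)"


section \<open>Bounded domains with smooth boundary\<close>

text \<open>Near each boundary point the domain lies strictly below the graph of a smooth function, the
  height being measured in the direction of a unit vector \<open>e\<close>.  Only the restriction of \<open>h\<close> to
  the hyperplane orthogonal to \<open>e\<close> matters.  In dimension one that hyperplane is trivial, and the
  bounded domains with smooth boundary are exactly the bounded open intervals; see
  \<open>smooth_bounded_domain_real_iff\<close>.\<close>

definition local_graph :: "'a::euclidean_space set \<Rightarrow> 'a \<Rightarrow> real \<Rightarrow> 'a \<Rightarrow> ('a \<Rightarrow> real) \<Rightarrow> bool"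
  where "local_graph \<Omega> x r e h \<longleftrightarrow> r > 0 \<and> norm e = 1 \<and> smooth h \<and>
    \<Omega> \<inter> ball x r = {y \<in> ball x r. y \<bullet> e < h (y - (y \<bullet> e) *\<^sub>R e)}"

definition smooth_bounded_domain :: "'a::euclidean_space set \<Rightarrow> bool"
  where "smooth_bounded_domain \<Omega> \<longleftrightarrow>
    \<Omega> \<noteq> {} \<and> open \<Omega> \<and> connected \<Omega> \<and> bounded \<Omega> \<and>
    (\<forall>x\<in>frontier \<Omega>. \<exists>r e h. local_graph \<Omega> x r e h)"

definition boundary_tangent :: "'a::euclidean_space set \<Rightarrow> 'a \<Rightarrow> 'a \<Rightarrow> bool"
  where "boundary_tangent \<Omega> x v \<longleftrightarrow>
    (\<exists>c :: real \<Rightarrow> 'a. c 0 = x \<and> (\<forall>\<^sub>F t in at 0. c t \<in> frontier \<Omega>) \<and>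
      (c has_vector_derivative v) (at 0))"

definition is_outward_unit_normal :: "'a::euclidean_space set \<Rightarrow> 'a \<Rightarrow> 'a \<Rightarrow> bool"
  where "is_outward_unit_normal \<Omega> x n \<longleftrightarrow>
    norm n = 1 \<and> (\<forall>v. boundary_tangent \<Omega> x v \<longrightarrow> v \<bullet> n = 0) \<and>
    (\<forall>\<^sub>F t in at_right 0. x - t *\<^sub>R n \<in> \<Omega> \<and> x + t *\<^sub>R n \<notin> closure \<Omega>)"

definition outward_unit_normal :: "'a::euclidean_space set \<Rightarrow> 'a \<Rightarrow> 'a"
  where "outward_unit_normal \<Omega> x = (THE n. is_outward_unit_normal \<Omega> x n)"

text \<open>At a boundary point the partial derivatives of \<open>w\<close> are the limits of those taken in \<open>\<Omega>\<close>,
  i.e. the values of their continuous extensions; \<open>w\<close> need not be differentiable there as a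
  function on the whole space.\<close>

definition normal_deriv :: "'a::euclidean_space set \<Rightarrow> ('a \<Rightarrow> real) \<Rightarrow> 'a \<Rightarrow> real"
  where "normal_deriv \<Omega> w x =
    (\<Sum>b\<in>Basis. (outward_unit_normal \<Omega> x \<bullet> b) * Lim (at x within \<Omega>) (partial_deriv b w))"


section \<open>The limiting system\<close>

definition f_reaction :: "real \<Rightarrow> real \<Rightarrow> real \<Rightarrow> real \<Rightarrow> real \<Rightarrow> real"
  where "f_reaction a1 b1 c1 u v = u * (a1 - b1 * u - c1 * v)"

definition g_reaction :: "real \<Rightarrow> real \<Rightarrow> real \<Rightarrow> real \<Rightarrow> real \<Rightarrow> real"
  where "g_reaction a2 b2 c2 u v = v * (a2 - b2 * u - c2 * v)"

definition u_of :: "real \<Rightarrow> real \<Rightarrow> real \<Rightarrow> real \<Rightarrow> real"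
  where "u_of \<gamma> \<delta> w \<tau> = (sqrt (w\<^sup>2 + 4 * \<gamma> * \<delta> * \<tau>) + w) / (2 * \<delta>)"

definition v_of :: "real \<Rightarrow> real \<Rightarrow> real \<Rightarrow> real \<Rightarrow> real"
  where "v_of \<gamma> \<delta> w \<tau> = \<tau> / u_of \<gamma> \<delta> w \<tau>"

definition is_solution ::
  "'a::euclidean_space set \<Rightarrow> real \<Rightarrow> real \<Rightarrow> real \<Rightarrow> real \<Rightarrow> real \<Rightarrow> real \<Rightarrow> real \<Rightarrow> real \<Rightarrow> real \<Rightarrow>
    ('a \<Rightarrow> real) \<Rightarrow> real \<Rightarrow> bool"
  where "is_solution \<Omega> a1 b1 c1 a2 b2 c2 \<gamma> \<delta> d w \<tau> \<longleftrightarrow>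
    Ck_closure 2 \<Omega> w \<and> \<tau> > 0 \<and>
    (\<forall>x\<in>\<Omega>. d * laplacian w x
        + f_reaction a1 b1 c1 (u_of \<gamma> \<delta> (w x) \<tau>) (v_of \<gamma> \<delta> (w x) \<tau>)
        - \<gamma> * g_reaction a2 b2 c2 (u_of \<gamma> \<delta> (w x) \<tau>) (v_of \<gamma> \<delta> (w x) \<tau>) = 0) \<and>
    (\<forall>x\<in>frontier \<Omega>. normal_deriv \<Omega> w x = 0) \<and>
    ((\<lambda>x. f_reaction a1 b1 c1 (u_of \<gamma> \<delta> (w x) \<tau>) (v_of \<gamma> \<delta> (w x) \<tau>)) has_integral 0) \<Omega>"

definition sup_norm :: "'a::euclidean_space set \<Rightarrow> ('a \<Rightarrow> real) \<Rightarrow> real"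
  where "sup_norm \<Omega> w = (SUP x\<in>closure \<Omega>. \<bar>w x\<bar>)"


section \<open>Well-definedness of the geometric notions\<close>

lemma v_of_alt:
  assumes "\<gamma> > 0" "\<delta> > 0" "\<tau> > 0"
  shows "v_of \<gamma> \<delta> w \<tau> = (sqrt (w\<^sup>2 + 4 * \<gamma> * \<delta> * \<tau>) - w) / (2 * \<gamma>)"
proof -
  define s where "s = sqrt (w\<^sup>2 + 4 * \<gamma> * \<delta> * \<tau>)"
  have p: "4 * \<gamma> * \<delta> * \<tau> > 0" using assms by simp
  have s2: "s\<^sup>2 = w\<^sup>2 + 4 * \<gamma> * \<delta> * \<tau>"
    unfolding s_def using p by (intro real_sqrt_pow2) (smt (verit) zero_le_power2)
  have "\<bar>w\<bar> < s" unfolding s_def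
    by (rule real_less_rsqrt) (use p in simp)
  hence pos: "s + w > 0" by linarith
  have "(s - w) * (s + w) = 4 * \<gamma> * \<delta> * \<tau>"
    using s2 by (simp add: algebra_simps power2_eq_square)
  thus ?thesis
    using pos assms unfolding v_of_def u_of_def s_def[symmetric] by (simp add: field_simps)
qed

lemma Ck_extendable_const: "Ck_extendable k UNIV (\<lambda>x::'a::euclidean_space. c)"
proof (induction k arbitrary: c)
  case 0
  show ?case by (auto intro: exI[of _ "\<lambda>x. c"])
next
  case (Suc k)
  have "partial_deriv b (\<lambda>x::'a. c) = (\<lambda>x. 0)" for b :: 'a
    by (simp add: partial_deriv_def fun_eq_iff frechet_derivative_const)
  thus ?case using Suc by (auto intro: exI[of _ "\<lambda>x. c"])
qed

lemma smooth_const: "smooth (\<lambda>x::'a::euclidean_space. c)"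
  by (simp add: smooth_def Ck_closure_def Ck_extendable_const)

lemma smooth_imp_differentiable:
  assumes "smooth h"
  shows "h differentiable (at x)"
proof -
  have "Ck_extendable (Suc 0) UNIV h"
    using assms unfolding smooth_def Ck_closure_def by blast
  thus ?thesis by simp
qed

lemma smooth_bounded_domain_real_iff:
  "smooth_bounded_domain (\<Omega> :: real set) \<longleftrightarrow> (\<exists>a b. a < b \<and> \<Omega> = {a<..<b})"
proof
  assume "smooth_bounded_domain \<Omega>"
  hence ne: "\<Omega> \<noteq> {}" and op: "open \<Omega>" and conn: "connected \<Omega>" and bd: "bounded \<Omega>"
    by (auto simp: smooth_bounded_domain_def)
  have ba: "bdd_above \<Omega>" and bb: "bdd_below \<Omega>"
    using bd by (auto simp: bounded_imp_bdd_above bounded_imp_bdd_below)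
  have "\<Omega> = {Inf \<Omega><..<Sup \<Omega>}"
  proof (intro equalityI subsetI)
    fix x assume x: "x \<in> \<Omega>"
    then obtain e where e: "e > 0" "ball x e \<subseteq> \<Omega>" using op openE by blast
    have "x - e/2 \<in> \<Omega>" "x + e/2 \<in> \<Omega>" using e by (auto simp: subset_iff dist_real_def)
    hence "Inf \<Omega> \<le> x - e/2" "x + e/2 \<le> Sup \<Omega>"
      using ba bb by (auto intro: cInf_lower cSup_upper)
    thus "x \<in> {Inf \<Omega><..<Sup \<Omega>}" using e by auto
  next
    fix x assume "x \<in> {Inf \<Omega><..<Sup \<Omega>}"
    then obtain y z where "y \<in> \<Omega>" "y < x" "z \<in> \<Omega>" "x < z"
      using ne ba bb by (auto simp: cInf_less_iff less_cSup_iff)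
    thus "x \<in> \<Omega>" using conn by (meson connectedD_interval less_imp_le)
  qed
  moreover from this ne have "Inf \<Omega> < Sup \<Omega>"
    by (metis greaterThanLessThan_empty_iff not_le)
  ultimately show "\<exists>a b. a < b \<and> \<Omega> = {a<..<b}" by blast
next
  assume "\<exists>a b. a < b \<and> \<Omega> = {a<..<b}"
  then obtain a b where ab: "a < b" and \<Omega>: "\<Omega> = {a<..<b}" by blast
  have "local_graph \<Omega> b (b - a) 1 (\<lambda>x. b)"
    using ab by (auto simp: local_graph_def smooth_const \<Omega> dist_real_def)
  moreover have "local_graph \<Omega> a (b - a) (-1) (\<lambda>x. -a)"
    using ab by (auto simp: local_graph_def smooth_const \<Omega> dist_real_def)
  moreover have "frontier \<Omega> = {a, b}"
    using ab by (auto simp: \<Omega> frontier_def)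
  ultimately have "\<forall>x\<in>frontier \<Omega>. \<exists>r e h. local_graph \<Omega> x r e h"
    by (metis insertE empty_iff)
  thus "smooth_bounded_domain \<Omega>"
    using ab by (auto simp: smooth_bounded_domain_def \<Omega>)
qed

lemma outward_unit_normal_ex1:
  assumes "open \<Omega>" and x: "x \<in> frontier \<Omega>" and lg: "local_graph \<Omega> x r e h"
  shows "\<exists>!n. is_outward_unit_normal \<Omega> x n"
proof -
  define F where "F = (\<lambda>y. y \<bullet> e - h (y - (y \<bullet> e) *\<^sub>R e))"
  have r: "r > 0" and e1: "norm e = 1" and sm: "smooth h"
    and \<Omega>: "\<Omega> \<inter> ball x r = {y \<in> ball x r. F y < 0}"
    using lg by (auto simp: local_graph_def F_def)
  have ee: "e \<bullet> e = 1" using e1 by (simp add: dot_square_norm)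
  have hdiff: "h differentiable (at y)" for y
    using sm by (rule smooth_imp_differentiable)
  have Fdiff: "F differentiable (at y)" for y
  proof -
    have "(\<lambda>y. h (y - (y \<bullet> e) *\<^sub>R e)) differentiable (at y)"
    proof -
      have "(h \<circ> (\<lambda>y. y - (y \<bullet> e) *\<^sub>R e)) differentiable (at y)"
      proof (rule differentiable_chain_at)
        show "(\<lambda>y. y - (y \<bullet> e) *\<^sub>R e) differentiable (at y)"
          by (auto intro!: derivative_eq_intros simp: differentiable_def)
        show "h differentiable (at (y - (y \<bullet> e) *\<^sub>R e))" by (rule hdiff)
      qed
      thus ?thesis by (simp add: o_def)
    qed
    moreover have "(\<lambda>y. y \<bullet> e) differentiable (at y)"
      by (auto intro!: derivative_eq_intros simp: differentiable_def)
    ultimately show ?thesis unfolding F_def by (intro differentiable_diff)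
  qed
  have Fcont: "continuous_on UNIV F"
    using Fdiff by (simp add: continuous_on_eq_continuous_at differentiable_imp_continuous_within)
  have Fshift: "F (y + s *\<^sub>R e) = F y + s" for y s
  proof -
    have "y + s *\<^sub>R e - ((y + s *\<^sub>R e) \<bullet> e) *\<^sub>R e = y - (y \<bullet> e) *\<^sub>R e"
      by (simp add: inner_add_left ee scaleR_left_distrib)
    moreover have "(y + s *\<^sub>R e) \<bullet> e = y \<bullet> e + s" by (simp add: inner_add_left ee)
    ultimately have "F (y + s *\<^sub>R e) = (y \<bullet> e + s) - h (y - (y \<bullet> e) *\<^sub>R e)"
      unfolding F_def by metis
    thus ?thesis by (simp add: F_def)
  qed
  have pos: "y \<notin> closure \<Omega>" if "y \<in> ball x r" "F y > 0" for y
  proof -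
    have "open ({z. F z > 0} \<inter> ball x r)"
      using Fcont by (intro open_Int open_Collect_less) auto
    moreover have "({z. F z > 0} \<inter> ball x r) \<inter> \<Omega> = {}" using \<Omega> by force
    ultimately have "({z. F z > 0} \<inter> ball x r) \<inter> closure \<Omega> = {}"
      using open_Int_closure_eq_empty by blast
    thus ?thesis using that by blast
  qed
  have neg: "y \<in> \<Omega>" if "y \<in> ball x r" "F y < 0" for y
    using that \<Omega> by blast
  have notin: "y \<notin> \<Omega>" if "y \<in> ball x r" "F y = 0" for y
    using that \<Omega> by force
  have near: "\<forall>\<^sub>F t in at 0. c t \<in> ball x r"
    if "c 0 = x" "isCont c 0" for c :: "real \<Rightarrow> 'a"
  proof -
    have "(c \<longlongrightarrow> x) (at 0)" using that by (simp add: isCont_def)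
    thus ?thesis using r by (intro topological_tendstoD) auto
  qed
  have fr: "y \<in> frontier \<Omega> \<longleftrightarrow> F y = 0" if y: "y \<in> ball x r" for y
  proof
    assume "y \<in> frontier \<Omega>"
    hence "y \<in> closure \<Omega>" "y \<notin> \<Omega>"
      using \<open>open \<Omega>\<close> by (auto simp: frontier_def interior_open)
    thus "F y = 0" using pos[OF y] neg[OF y] by (meson linorder_neqE_linordered_idom)
  next
    assume F0: "F y = 0"
    have "((\<lambda>t. y + (-t) *\<^sub>R e) \<longlongrightarrow> y + (-0) *\<^sub>R e) (at_right 0)"
      by (intro tendsto_intros)
    hence lim: "((\<lambda>t. y + (-t) *\<^sub>R e) \<longlongrightarrow> y) (at_right 0)" by simp
    hence "\<forall>\<^sub>F t in at_right 0. y + (-t) *\<^sub>R e \<in> ball x r"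
      using y by (intro topological_tendstoD) auto
    moreover have "\<forall>\<^sub>F t in at_right (0::real). t > 0"
      by (simp add: eventually_at_right_less)
    ultimately have "\<forall>\<^sub>F t in at_right 0. y + (-t) *\<^sub>R e \<in> closure \<Omega>"
    proof eventually_elim
      case (elim t)
      have "F (y + (-t) *\<^sub>R e) < 0" unfolding Fshift using F0 elim by simp
      thus ?case using elim neg closure_subset by blast
    qed
    hence "y \<in> closure \<Omega>"
      using lim by (intro Lim_in_closed_set[of "closure \<Omega>" _ "at_right (0::real)"]) auto
    thus "y \<in> frontier \<Omega>"
      using notin[OF y F0] \<open>open \<Omega>\<close> by (simp add: frontier_def interior_open)
  qed
  have xb: "x \<in> ball x r" using r by simp
  have Fx: "F x = 0" using fr[OF xb] x by simp
  obtain F' where F': "(F has_derivative F') (at x)"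
    using Fdiff differentiable_def by blast
  then interpret F': bounded_linear F' by (rule has_derivative_bounded_linear)
  define G where "G = (\<Sum>b\<in>Basis. F' b *\<^sub>R b)"
  have G: "F' v = v \<bullet> G" for v
  proof -
    have "F' v = F' (\<Sum>b\<in>Basis. (v \<bullet> b) *\<^sub>R b)" by (simp add: euclidean_representation)
    also have "\<dots> = v \<bullet> G"
      by (simp add: F'.sum F'.scaleR G_def inner_sum_right mult.commute)
    finally show ?thesis .
  qed
  have chain: "((\<lambda>t. F (c t)) has_real_derivative v \<bullet> G) (at 0)"
    if "c 0 = x" "(c has_vector_derivative v) (at 0)" for c :: "real \<Rightarrow> 'a" and v
  proof -
    have "(c has_derivative (\<lambda>t. t *\<^sub>R v)) (at 0)"
      using that by (simp add: has_vector_derivative_def)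
    hence "((\<lambda>t. F (c t)) has_derivative (\<lambda>t. F' (t *\<^sub>R v))) (at 0)"
      using has_derivative_compose[of c "\<lambda>t. t *\<^sub>R v" 0 UNIV F F'] F' that by simp
    thus ?thesis
      by (simp add: has_field_derivative_def F'.scaleR G mult.commute[of _ "v \<bullet> G"])
  qed
  have line: "((\<lambda>t. x + t *\<^sub>R v) has_vector_derivative v) (at 0)" for v
    by (auto intro!: derivative_eq_intros)
  have Ge: "e \<bullet> G = 1"
  proof -
    have "((\<lambda>t. F (x + t *\<^sub>R e)) has_real_derivative e \<bullet> G) (at 0)"
      using chain[of "\<lambda>t. x + t *\<^sub>R e" e] line by simp
    moreover have "((\<lambda>t. F (x + t *\<^sub>R e)) has_real_derivative 1) (at 0)"
      unfolding Fshift by (auto intro!: derivative_eq_intros)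
    ultimately show ?thesis by (rule DERIV_unique)
  qed
  hence G0: "G \<noteq> 0" by auto
  have tangent: "boundary_tangent \<Omega> x v \<longleftrightarrow> v \<bullet> G = 0" for v
  proof
    assume "boundary_tangent \<Omega> x v"
    then obtain c where c: "c 0 = x" "\<forall>\<^sub>F t in at 0. c t \<in> frontier \<Omega>"
      "(c has_vector_derivative v) (at (0::real))"
      by (auto simp: boundary_tangent_def)
    have "\<forall>\<^sub>F t in at 0. c t \<in> ball x r"
      using near c has_vector_derivative_continuous by blast
    with c(2) have "\<forall>\<^sub>F t in at 0. F (c t) = 0"
      by eventually_elim (use fr in blast)
    hence ev: "\<forall>\<^sub>F t in nhds 0. F (c t) = 0"
      unfolding eventually_nhds_conv_at using Fx c(1) by simp
    have "((\<lambda>t. F (c t)) has_real_derivative 0) (at 0)"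
      using DERIV_cong_ev[OF refl ev refl, of 0] by simp
    thus "v \<bullet> G = 0" using chain[OF c(1,3)] DERIV_unique by blast
  next
    assume v: "v \<bullet> G = 0"
    define c where "c = (\<lambda>t. (x + t *\<^sub>R v) + (- F (x + t *\<^sub>R v)) *\<^sub>R e)"
    have c0: "c 0 = x" by (simp add: c_def Fx)
    have "((\<lambda>t. F (x + t *\<^sub>R v)) has_real_derivative 0) (at 0)"
      using chain[of "\<lambda>t. x + t *\<^sub>R v" v] line v by simp
    hence "((\<lambda>t. F (x + t *\<^sub>R v)) has_vector_derivative 0) (at 0)"
      by (simp add: has_real_derivative_iff_has_vector_derivative)
    hence cd: "(c has_vector_derivative v) (at 0)"
      unfolding c_def using line[of v]
      by (auto intro!: derivative_eq_intros simp: has_real_derivative_iff_has_vector_derivative)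
    have "\<forall>\<^sub>F t in at 0. c t \<in> ball x r"
      using near[of c] c0 cd has_vector_derivative_continuous by blast
    moreover have "F (c t) = 0" for t unfolding c_def Fshift by simp
    ultimately have "\<forall>\<^sub>F t in at 0. c t \<in> frontier \<Omega>"
      by (auto elim!: eventually_mono simp: fr)
    thus "boundary_tangent \<Omega> x v" using c0 cd by (auto simp: boundary_tangent_def)
  qed
  have evpos: "\<forall>\<^sub>F t in at_right 0. x - t *\<^sub>R v \<in> \<Omega> \<and> x + t *\<^sub>R v \<notin> closure \<Omega>"
    if v: "v \<bullet> G > 0" for v
  proof -
    have d1: "((\<lambda>t. F (x + t *\<^sub>R v)) has_real_derivative v \<bullet> G) (at 0)"
      using chain[of "\<lambda>t. x + t *\<^sub>R v" v] line by simp
    have d2: "((\<lambda>t. F (x + t *\<^sub>R (-v))) has_real_derivative -(v \<bullet> G)) (at 0)"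
      using chain[of "\<lambda>t. x + t *\<^sub>R (-v)" "-v"] line[of "-v"] by simp
    obtain k1 where k1: "k1 > 0" "\<And>t. 0 < t \<Longrightarrow> t < k1 \<Longrightarrow> F (x + t *\<^sub>R v) > 0"
      using DERIV_pos_inc_right[OF d1 v] Fx by auto
    obtain k2 where k2: "k2 > 0" "\<And>t. 0 < t \<Longrightarrow> t < k2 \<Longrightarrow> F (x + t *\<^sub>R (-v)) < 0"
      using DERIV_neg_dec_right[OF d2] v Fx by auto
    have "\<forall>\<^sub>F t in at 0. x + t *\<^sub>R w \<in> ball x r" for w
      using near[of "\<lambda>t. x + t *\<^sub>R w"] by (simp add: continuous_intros)
    hence nb: "\<forall>\<^sub>F t in at_right 0. x + t *\<^sub>R w \<in> ball x r" for w
      by (simp add: eventually_at_split)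
    have "\<forall>\<^sub>F t in at_right 0. t < min k1 k2"
      using k1 k2 by (intro order_tendstoD(2)[OF tendsto_ident_at]) auto
    moreover have "\<forall>\<^sub>F t in at_right (0::real). t > 0"
      by (simp add: eventually_at_right_less)
    ultimately show ?thesis using nb[of v] nb[of "-v"]
    proof eventually_elim
      case (elim t)
      thus ?case using pos[of "x + t *\<^sub>R v"] neg[of "x + t *\<^sub>R (-v)"] k1(2)[of t] k2(2)[of t]
        by auto
    qed
  qed
  define n where "n = (1 / norm G) *\<^sub>R G"
  have n: "is_outward_unit_normal \<Omega> x n"
    unfolding is_outward_unit_normal_def
  proof (intro conjI allI impI)
    show "norm n = 1" using G0 by (simp add: n_def)
    show "v \<bullet> n = 0" if "boundary_tangent \<Omega> x v" for v using that tangent by (simp add: n_def)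
    have "n \<bullet> G > 0" using G0 by (simp add: n_def)
    thus "\<forall>\<^sub>F t in at_right 0. x - t *\<^sub>R n \<in> \<Omega> \<and> x + t *\<^sub>R n \<notin> closure \<Omega>" by (rule evpos)
  qed
  moreover have "m = n" if m: "is_outward_unit_normal \<Omega> x m" for m
  proof -
    define k where "k = (m \<bullet> G) / (G \<bullet> G)"
    define v where "v = m - k *\<^sub>R G"
    have vG: "v \<bullet> G = 0" using G0 by (simp add: v_def k_def inner_diff_left)
    hence "v \<bullet> m = 0" using m tangent by (simp add: is_outward_unit_normal_def)
    hence "v \<bullet> v = 0" using vG by (simp add: v_def inner_diff_right inner_diff_left inner_commute)
    hence mk: "m = k *\<^sub>R G" by (simp add: v_def)
    have "norm m = 1" using m by (simp add: is_outward_unit_normal_def)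
    hence k: "\<bar>k\<bar> * norm G = 1" by (simp add: mk)
    have "k > 0"
    proof (rule ccontr)
      assume "\<not> k > 0"
      moreover have "k \<noteq> 0" using k by auto
      ultimately have "(-m) \<bullet> G > 0" using G0 by (simp add: mk mult_neg_pos)
      note evpos[OF this]
      moreover have "\<forall>\<^sub>F t in at_right 0. x + t *\<^sub>R m \<notin> closure \<Omega>"
        using m unfolding is_outward_unit_normal_def by (auto elim: eventually_mono)
      ultimately have "\<forall>\<^sub>F t in at_right (0::real). False"
        by eventually_elim (use closure_subset in auto)
      thus False by simp
    qed
    thus "m = n" using k G0 by (simp add: mk n_def field_simps)
  qed
  ultimately show ?thesis by blast
qed

end

theory Submission
  imports Defs
begin

text \<open>Write \<open>R \<tau> w = f(u,v) - \<gamma> g(u,v)\<close> with \<open>u = u(w,\<tau>)\<close> and \<open>v = v(w,\<tau>)\<close>, so that a solution satisfies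
  \<open>d \<Delta>w = - R \<tau> w\<close> with a Neumann condition.  Everything follows from testing this equation with
  functions of \<open>w\<close>: for every \<open>C\<^sup>1\<close> function \<open>\<Phi>\<close> of one variable
  \<open>\<integral> \<Phi>'(w) |\<nabla>w|\<^sup>2 = (1/d) \<integral> \<Phi>(w) R \<tau> w\<close>.
  This is lemma \<open>solution_energy_identity\<close>.

  A constant \<open>\<Phi>\<close> gives \<open>\<integral> R = 0\<close>, hence \<open>\<integral> g = 0\<close> in addition to \<open>\<integral> f = 0\<close>.  If \<open>\<tau> > a1\<^sup>2 / (4 b1 c1)\<close> then
  \<open>a1 - b1 u - c1 v\<close> is negative whatever \<open>w\<close> is, because \<open>b1 u + c1 v \<ge> 2 sqrt (b1 c1 \<tau>)\<close>; then \<open>\<integral> f < 0\<close>.  The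
  same argument for \<open>g\<close> gives the other bound on \<open>\<tau>\<close> (\<open>solution_tau_bounds\<close>).

  For \<open>\<tau>\<close> in this bounded range there is \<open>M\<close> such that \<open>R \<tau> w\<close> has the sign of \<open>- w\<close> once \<open>\<bar>w\<bar> > M\<close>,
  since the logistic damping of the dominant species wins (\<open>net_reaction_signs\<close>).  Testing with
  \<open>\<Phi> = ((w - M)\<^sup>+)\<^sup>2\<close> makes the left side nonnegative and the right side nonpositive, so \<open>w \<le> M\<close>; the
  lower bound is symmetric (\<open>solution_bounded\<close>).  This replaces the maximum principle and Hopf's
  lemma, and \<open>M\<close> depends neither on \<open>d\<close> nor on the domain.

  On \<open>[-M, M]\<close> the function \<open>R \<tau>\<close> is Lipschitz with a constant \<open>L\<close> uniform in \<open>\<tau>\<close>.  Testing with \<open>w - c\<close>, \<open>c\<close>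
  the mean of \<open>w\<close>, and using the Poincare inequality with constant \<open>C\<close> gives
  \<open>d \<integral>|\<nabla>w|\<^sup>2 \<le> L \<integral>(w - c)\<^sup>2 \<le> L C \<integral>|\<nabla>w|\<^sup>2\<close>, so \<open>w\<close> is constant as soon as \<open>d > L C\<close>
  (\<open>solution_constant\<close>).

  The two analytic tools are proved directly for domains that are locally subgraphs.  The divergence
  theorem for fields tangent to the boundary (\<open>integral_divergence_zero_flux\<close>) needs no surface
  measure: the field is cut off near the boundary, and the error is the flux density, which tends
  to zero, times \<open>1/\<epsilon>\<close>, integrated over a strip of volume \<open>O(\<epsilon>)\<close>.  The Poincare inequality
  (\<open>Poincare_inequality\<close>) bounds the double integral of \<open>(w x - w y)\<^sup>2\<close>; such bounds hold on
  balls, pass through chains of balls, and reach the boundary by a shift into the interior.\<close>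

section \<open>Calculus and integration preliminaries\<close>

text \<open>The squared positive part is the simplest \<open>C\<^sup>1\<close> function that vanishes on a half-line; cutoffs,
  bump functions and truncations are all built from it.\<close>

lemma has_derivative_pos_part_square:
  "((\<lambda>s. (max 0 s)\<^sup>2) has_real_derivative 2 * max 0 t) (at (t::real))"
proof -
  have "((\<lambda>s. (max 0 s)\<^sup>2) has_real_derivative 2 * max 0 t) (at t)" if "t \<noteq> 0"
  proof (cases "t > 0")
    case True
    have "((\<lambda>s. s\<^sup>2) has_real_derivative 2 * max 0 t) (at t)"
      using True by (auto intro!: derivative_eq_intros)
    then show ?thesis
      by (rule has_field_derivative_transform_within_open[where S = "{0<..}"]) (use True in auto)
  next
    case False
    have "((\<lambda>s. 0) has_real_derivative 2 * max 0 t) (at t)"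
      using False by (auto intro!: derivative_eq_intros)
    then show ?thesis
      by (rule has_field_derivative_transform_within_open[where S = "{..<0}"])
        (use False that in auto)
  qed
  moreover have "((\<lambda>s::real. (max 0 s)\<^sup>2) has_real_derivative 0) (at 0)"
    unfolding has_field_derivative_iff
  proof (rule tendsto_0_le[where K = 1])
    show "((\<lambda>y::real. y) \<longlongrightarrow> 0) (at 0)" by (rule tendsto_ident_at)
    show "\<forall>\<^sub>F y in at (0::real). norm (((max 0 y)\<^sup>2 - (max 0 0)\<^sup>2) / (y - 0)) \<le> norm y * 1"
      by (intro always_eventually) (auto simp: max_def power2_eq_square)
  qed
  ultimately show ?thesis by (cases "t = 0") auto
qed

lemma has_derivative_pos_part_square_comp:
  assumes "(g has_real_derivative g') (at (t::real))"
  shows "((\<lambda>s. (max 0 (g s))\<^sup>2) has_real_derivative 2 * max 0 (g t) * g') (at t)"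
  using DERIV_chain2[where f = "\<lambda>s. (max 0 s)\<^sup>2" and g = g, OF has_derivative_pos_part_square assms] .

lemma set_integrable_bounded_continuous:
  fixes f :: "'a::euclidean_space \<Rightarrow> real"
  assumes "open \<Omega>" "bounded \<Omega>" "continuous_on \<Omega> f" "\<And>x. x \<in> \<Omega> \<Longrightarrow> \<bar>f x\<bar> \<le> B"
  shows "set_integrable lborel \<Omega> f"
  unfolding set_integrable_def
proof (rule Bochner_Integration.integrable_bound)
  show "integrable lborel (\<lambda>x. B * indicator \<Omega> x)"
    using assms(1,2) emeasure_bounded_finite[of \<Omega>] by (auto intro!: integrable_real_indicator)
  show "(\<lambda>x. indicator \<Omega> x *\<^sub>R f x) \<in> borel_measurable lborel"
    using borel_measurable_continuous_on_indicator[OF _ assms(3)] assms(1) by simp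
  show "AE x in lborel. norm (indicator \<Omega> x *\<^sub>R f x) \<le> norm (B * indicator \<Omega> x)"
    using assms(4) by (intro AE_I2) (auto simp: indicator_def intro: order_trans[OF _ abs_ge_self])
qed

lemma continuous_on_compact_norm_bound:
  fixes f :: "'a::topological_space \<Rightarrow> 'b::real_normed_vector"
  assumes "compact S" "continuous_on S f"
  obtains B where "\<And>x. x \<in> S \<Longrightarrow> norm (f x) \<le> B"
  using compact_imp_bounded[OF compact_continuous_image[OF assms(2,1)]] that
  by (auto simp: bounded_iff)

lemma set_integrable_continuous_closure:
  fixes f :: "'a::euclidean_space \<Rightarrow> real"
  assumes "open \<Omega>" "bounded \<Omega>" "continuous_on (closure \<Omega>) f"
  shows "set_integrable lborel \<Omega> f"
proof -
  have "compact (closure \<Omega>)" using assms(2) by simp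
  from continuous_on_compact_norm_bound[OF this assms(3)]
  obtain M where M: "\<And>x. x \<in> closure \<Omega> \<Longrightarrow> norm (f x) \<le> M" by blast
  show ?thesis
    by (rule set_integrable_bounded_continuous[OF assms(1,2), of _ M])
      (use M closure_subset in \<open>auto intro: continuous_on_subset[OF assms(3)]\<close>)
qed

lemma emeasure_lborel_open_nonzero:
  fixes S :: "'a::euclidean_space set"
  assumes "open S" "S \<noteq> {}"
  shows "emeasure lborel S \<noteq> 0"
  using assms open_not_negligible[of S] by (auto simp: negligible_iff_null_sets null_sets_def)

lemma continuous_nonneg_integral_0:
  fixes f :: "'a::euclidean_space \<Rightarrow> real"
  assumes op: "open \<Omega>" and cont: "continuous_on \<Omega> f" and int: "set_integrable lborel \<Omega> f"
    and nn: "\<And>x. x \<in> \<Omega> \<Longrightarrow> f x \<ge> 0" and zero: "(LINT x:\<Omega>|lborel. f x) = 0" and x: "x \<in> \<Omega>"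
  shows "f x = 0"
proof (rule ccontr)
  assume nz: "f x \<noteq> 0"
  define U where "U = {y \<in> \<Omega>. f y > 0}"
  have U: "open U"
    using continuous_open_preimage[OF cont op open_greaterThan[of 0]]
    by (simp add: U_def vimage_def Int_def)
  have "AE y in lborel. indicator \<Omega> y *\<^sub>R f y = 0"
    using int zero nn unfolding set_integrable_def set_lebesgue_integral_def
    by (subst (asm) integral_nonneg_eq_0_iff_AE) (auto simp: indicator_def)
  then have "AE y in lborel. y \<notin> U"
    by eventually_elim (auto simp: U_def)
  then have "U \<in> null_sets lborel"
    using U by (subst AE_iff_null_sets) auto
  then have "negligible U"
    by (simp add: negligible_iff_null_sets null_sets_completionI)
  moreover have "x \<in> U" using x nz nn[OF x] by (simp add: U_def)
  ultimately show False using U open_not_negligible by blast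
qed

text \<open>Passage from a local property to finitely many balls.  It localizes the divergence theorem and
  the Poincare inequality alike.\<close>

lemma compact_finite_ball_cover:
  fixes K :: "'a::metric_space set"
  assumes K: "compact K" and Q: "\<And>x. x \<in> K \<Longrightarrow> \<exists>r>0. Q x r"
  shows "\<exists>C \<rho>. finite C \<and> K \<subseteq> (\<Union>x\<in>C. ball x (\<rho> x)) \<and> (\<forall>x\<in>C. \<rho> x > 0 \<and> Q x (\<rho> x))"
proof -
  have "\<forall>x\<in>K. \<exists>r. r > 0 \<and> Q x r" using Q by blast
  from bchoice[OF this] obtain \<rho> where \<rho>: "\<And>x. x \<in> K \<Longrightarrow> \<rho> x > 0 \<and> Q x (\<rho> x)" by blast
  obtain C where C: "C \<subseteq> K" "finite C" "K \<subseteq> (\<Union>x\<in>C. ball x (\<rho> x))"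
  proof (rule compactE_image[OF K, of K "\<lambda>x. ball x (\<rho> x)"])
    show "K \<subseteq> (\<Union>x\<in>K. ball x (\<rho> x))" using \<rho> by (intro subsetI UN_I) auto
  qed (use that in auto)
  have "\<forall>x\<in>C. \<rho> x > 0 \<and> Q x (\<rho> x)" using \<rho> C(1) by blast
  then show ?thesis using C(2,3) by (intro exI conjI)
qed

lemma GDERIV_partial_derivs:
  fixes f :: "'a::euclidean_space \<Rightarrow> real"
  assumes "f differentiable (at x)"
  shows "GDERIV f x :> (\<Sum>b\<in>Basis. partial_deriv b f x *\<^sub>R b)"
proof -
  have d: "(f has_derivative frechet_derivative f (at x)) (at x)"
    using assms frechet_derivative_works by blast
  have "frechet_derivative f (at x) v = v \<bullet> (\<Sum>b\<in>Basis. partial_deriv b f x *\<^sub>R b)" for v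
  proof -
    have "frechet_derivative f (at x) v = frechet_derivative f (at x) (\<Sum>b\<in>Basis. (v \<bullet> b) *\<^sub>R b)"
      by (simp add: euclidean_representation)
    also have "\<dots> = (\<Sum>b\<in>Basis. (v \<bullet> b) * frechet_derivative f (at x) b)"
      using has_derivative_linear[OF d] by (simp add: linear_sum linear_scale)
    also have "\<dots> = v \<bullet> (\<Sum>b\<in>Basis. partial_deriv b f x *\<^sub>R b)"
      by (simp add: partial_deriv_def inner_sum_right mult.commute)
    finally show ?thesis .
  qed
  then have "frechet_derivative f (at x) = (\<lambda>v. v \<bullet> (\<Sum>b\<in>Basis. partial_deriv b f x *\<^sub>R b))" by auto
  then show ?thesis unfolding gderiv_def using d by metis
qed

text \<open>The product rule \<open>div (\<zeta> X) = \<zeta> div X + X \<bullet> \<nabla>\<zeta>\<close> at a point: \<open>c\<close> and \<open>g\<close> are the value and the gradient of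
  \<open>\<zeta>\<close>, \<open>v\<close> is the value of \<open>X\<close>, and \<open>A\<close> is its derivative.\<close>

lemma divergence_scaleR:
  fixes v g :: "'a::euclidean_space"
  shows "(\<Sum>b\<in>Basis. (c *\<^sub>R A b + (b \<bullet> g) *\<^sub>R v) \<bullet> b) = c * (\<Sum>b\<in>Basis. A b \<bullet> b) + v \<bullet> g"
proof -
  have "v \<bullet> g = (\<Sum>b\<in>Basis. (b \<bullet> g) * (v \<bullet> b))"
    by (subst euclidean_inner) (simp add: inner_commute mult.commute)
  then show ?thesis by (simp add: inner_add_left sum.distrib sum_distrib_left)
qed

lemma abs_diagonal_scaleR_le:
  fixes v g :: "'a::euclidean_space"
  assumes b: "b \<in> Basis" and "\<bar>c\<bar> \<le> M" "\<bar>a \<bullet> b\<bar> \<le> B" "norm g \<le> G" "norm v \<le> V"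
  shows "\<bar>(c *\<^sub>R a + (b \<bullet> g) *\<^sub>R v) \<bullet> b\<bar> \<le> M * B + G * V"
proof -
  have "\<bar>b \<bullet> g\<bar> \<le> G" "\<bar>v \<bullet> b\<bar> \<le> V"
    using Basis_le_norm[OF b, of g] Basis_le_norm[OF b, of v] assms by (auto simp: inner_commute)
  then have "\<bar>(b \<bullet> g) * (v \<bullet> b)\<bar> \<le> G * V" "\<bar>c * (a \<bullet> b)\<bar> \<le> M * B"
    using assms by (auto simp: abs_mult intro!: mult_mono intro: order_trans[OF abs_ge_zero])
  then show ?thesis by (simp add: inner_add_left)
qed

section \<open>Divergences of compactly supported fields\<close>

lemma integral_lborel_translate:
  fixes f :: "'a::euclidean_space \<Rightarrow> real"
  assumes [measurable]: "f \<in> borel_measurable borel"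
  shows "(\<integral>x. f (x + c) \<partial>lborel) = (\<integral>x. f x \<partial>lborel)"
proof -
  have "(\<integral>x. f x \<partial>(distr lborel borel ((+) c))) = (\<integral>x. f (c + x) \<partial>lborel)"
    by (rule integral_distr) auto
  then show ?thesis by (simp add: lborel_distr_plus add.commute)
qed

text \<open>Translation invariance makes every difference quotient of \<open>Y\<close> integrate to zero.  The quotients
  are bounded by \<open>B\<close> through the mean value theorem and vanish off a fixed ball, so dominated
  convergence transfers this to the derivative.\<close>

lemma integral_directional_derivative_eq_0:
  fixes Y :: "'a::euclidean_space \<Rightarrow> real"
  assumes K: "bounded K" and supp: "\<And>x. x \<notin> K \<Longrightarrow> Y x = 0"
    and cont: "continuous_on UNIV Y"
    and der: "\<And>x. ((\<lambda>t. Y (x + t *\<^sub>R b)) has_real_derivative Z x) (at 0)"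
    and bd: "\<And>x. \<bar>Z x\<bar> \<le> B"
  shows "integrable lborel Z" "integral\<^sup>L lborel Z = 0"
proof -
  \<comment> \<open>difference quotients with step \<open>1/(n+1)\<close>\<close>
  define s where "s = (\<lambda>n x. (Y (x + (1 / real (Suc n)) *\<^sub>R b) - Y x) / (1 / real (Suc n)))"
  obtain R where R: "\<And>x. x \<in> K \<Longrightarrow> norm x \<le> R"
    using K by (auto simp: bounded_iff)
  have Ymeas[measurable]: "Y \<in> borel_measurable borel"
    using cont by (rule borel_measurable_continuous_onI)
  have smeas[measurable]: "s n \<in> borel_measurable borel" for n
    unfolding s_def by measurable
  have lim: "(\<lambda>n. s n x) \<longlonglongrightarrow> Z x" for x
  proof -
    have "((\<lambda>t. (Y (x + t *\<^sub>R b) - Y x) / t) \<longlongrightarrow> Z x) (at 0)"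
      using der[of x] by (simp add: has_field_derivative_iff)
    moreover have "filterlim (\<lambda>n. 1 / real (Suc n)) (at 0) sequentially"
      unfolding filterlim_at using LIMSEQ_Suc[OF lim_1_over_n] by simp
    ultimately show ?thesis unfolding s_def by (rule filterlim_compose)
  qed
  have Zmeas[measurable]: "Z \<in> borel_measurable borel"
    by (rule borel_measurable_LIMSEQ_real[where u = s]) (use lim in auto)
  have bnd: "norm (s n x) \<le> B * indicator (cball 0 (R + norm b)) x" for n x
  proof (cases "norm x \<le> R + norm b")
    case True
    have d: "((\<lambda>t. Y (x + t *\<^sub>R b)) has_real_derivative Z (x + t *\<^sub>R b)) (at t)" for t
    proof -
      have "((\<lambda>t'. Y (x + t *\<^sub>R b + t' *\<^sub>R b)) has_real_derivative Z (x + t *\<^sub>R b)) (at (t - t))"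
        using der by simp
      then have "((\<lambda>t'. Y (x + t *\<^sub>R b + (t' - t) *\<^sub>R b)) has_real_derivative Z (x + t *\<^sub>R b)) (at t)"
        using DERIV_shift[of "\<lambda>t'. Y (x + t *\<^sub>R b + t' *\<^sub>R b)" _ t "-t"] by simp
      then show ?thesis by (simp add: algebra_simps)
    qed
    obtain z where z: "Y (x + (1 / real (Suc n)) *\<^sub>R b) - Y (x + 0 *\<^sub>R b)
        = (1 / real (Suc n) - 0) * Z (x + z *\<^sub>R b)"
      using MVT2[of 0 "1 / real (Suc n)" "\<lambda>t. Y (x + t *\<^sub>R b)" "\<lambda>t. Z (x + t *\<^sub>R b)"] d by auto
    have "s n x = Z (x + z *\<^sub>R b)" using z by (simp add: s_def)
    then show ?thesis using bd True by (simp add: indicator_def)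
  next
    case False
    have t: "norm ((1 / real (Suc n)) *\<^sub>R b) \<le> norm b"
      by (simp add: divide_le_eq mult_le_cancel_left1)
    have "norm x \<le> norm (x + (1 / real (Suc n)) *\<^sub>R b) + norm ((1 / real (Suc n)) *\<^sub>R b)"
      by (metis add_diff_cancel_right' norm_triangle_ineq4)
    then have "x + (1 / real (Suc n)) *\<^sub>R b \<notin> K" using R t False by fastforce
    moreover have "x \<notin> K" using R False norm_ge_zero[of b] by fastforce
    ultimately show ?thesis using False supp by (simp add: s_def)
  qed
  have dom: "integrable lborel (\<lambda>x. B * indicator (cball 0 (R + norm b)) (x::'a))"
    by (auto intro!: integrable_real_indicator emeasure_bounded_finite)
  show "integrable lborel Z"
    by (rule integrable_dominated_convergence[where s = s, OF _ _ dom]) (use lim bnd in auto)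
  have "(\<lambda>n. integral\<^sup>L lborel (s n)) \<longlonglongrightarrow> integral\<^sup>L lborel Z"
    by (rule integral_dominated_convergence[where w = "\<lambda>x. B * indicator (cball 0 (R + norm b)) x"])
      (use lim bnd dom in auto)
  moreover have "integral\<^sup>L lborel (s n) = 0" for n
  proof -
    have "bounded (Y ` cball 0 R)"
      by (intro compact_imp_bounded compact_continuous_image continuous_on_subset[OF cont]) auto
    then obtain M where M: "\<And>x. x \<in> cball 0 R \<Longrightarrow> \<bar>Y x\<bar> \<le> M"
      by (fastforce simp: bounded_iff)
    have iY: "integrable lborel Y"
    proof (rule Bochner_Integration.integrable_bound)
      show "integrable lborel (\<lambda>x. M * indicator (cball 0 R) (x::'a))"
        by (auto intro!: integrable_real_indicator emeasure_bounded_finite)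
      show "AE x in lborel. norm (Y x) \<le> norm (M * indicator (cball 0 R) x)"
      proof (rule AE_I2)
        fix x show "norm (Y x) \<le> norm (M * indicator (cball 0 R) x)"
        proof (cases "x \<in> cball 0 R")
          case True
          then show ?thesis using M[of x] by simp
        next
          case False
          then have "x \<notin> K" using R by auto
          then show ?thesis using supp by simp
        qed
      qed
    qed simp
    have iY': "integrable lborel (\<lambda>x. Y (x + c))" for c
    proof -
      have "integrable (distr lborel borel ((+) c)) Y" using iY by (simp add: lborel_distr_plus)
      then show ?thesis by (subst (asm) integrable_distr_eq) (auto simp: add.commute)
    qed
    have "integral\<^sup>L lborel (\<lambda>x. Y (x + (1 / real (Suc n)) *\<^sub>R b) - Y x) = 0"
      using iY iY' by (simp add: integral_lborel_translate)
    then show ?thesis unfolding s_def by simp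
  qed
  ultimately show "integral\<^sup>L lborel Z = 0"
    using LIMSEQ_unique tendsto_const by (metis (no_types, lifting) LIMSEQ_unique ext tendsto_const)
qed

lemma integral_divergence_compact_support:
  fixes X :: "'a::euclidean_space \<Rightarrow> 'a"
  assumes op: "open \<Omega>" and K: "compact K" "K \<subseteq> \<Omega>" and supp: "\<And>x. x \<notin> K \<Longrightarrow> X x = 0"
    and der: "\<And>x. x \<in> \<Omega> \<Longrightarrow> (X has_derivative X' x) (at x)"
    and bd: "\<And>x b. x \<in> \<Omega> \<Longrightarrow> b \<in> Basis \<Longrightarrow> \<bar>X' x b \<bullet> b\<bar> \<le> B"
  shows "set_integrable lborel \<Omega> (\<lambda>x. \<Sum>b\<in>Basis. X' x b \<bullet> b)"
    "(LINT x:\<Omega>|lborel. (\<Sum>b\<in>Basis. X' x b \<bullet> b)) = 0"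
proof -
  \<comment> \<open>derivative of \<open>X\<close> on the whole space: outside \<open>\<Omega>\<close> the field vanishes in a neighbourhood\<close>
  define D where "D = (\<lambda>x. if x \<in> \<Omega> then X' x else (\<lambda>h. 0))"
  have D: "(X has_derivative D x) (at x)" for x
  proof (cases "x \<in> \<Omega>")
    case True
    then show ?thesis using der by (simp add: D_def)
  next
    case False
    have "((\<lambda>x. 0) has_derivative D x) (at x)" using False by (simp add: D_def)
    then show ?thesis
      by (rule has_derivative_transform_within_open[where s = "- K"])
        (use K False supp in \<open>auto simp: compact_imp_closed\<close>)
  qed
  have "integrable lborel (\<lambda>x. D x b \<bullet> b) \<and> integral\<^sup>L lborel (\<lambda>x. D x b \<bullet> b) = 0"
    if b: "b \<in> Basis" for b
  proof -
    have 1: "bounded K" using K by (simp add: compact_imp_bounded)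
    have 2: "x \<notin> K \<Longrightarrow> X x \<bullet> b = 0" for x using supp by simp
    have 3: "continuous_on UNIV (\<lambda>x. X x \<bullet> b)"
      using D by (intro continuous_intros)
        (meson continuous_at_imp_continuous_on has_derivative_continuous)
    have 4: "((\<lambda>t. X (x + t *\<^sub>R b) \<bullet> b) has_real_derivative D x b \<bullet> b) (at 0)" for x
    proof -
      have "((\<lambda>t. x + t *\<^sub>R b) has_derivative (\<lambda>t. t *\<^sub>R b)) (at 0)"
        by (auto intro!: derivative_eq_intros)
      from has_derivative_compose[OF this, of X "D x"] D[of x]
      have "((\<lambda>t. X (x + t *\<^sub>R b)) has_derivative (\<lambda>t. D x (t *\<^sub>R b))) (at 0)" by simp
      then have "((\<lambda>t. X (x + t *\<^sub>R b) \<bullet> b) has_derivative (\<lambda>t. D x (t *\<^sub>R b) \<bullet> b)) (at 0)"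
        by (rule has_derivative_inner_left)
      then show ?thesis
        using linear_scale[OF has_derivative_linear[OF D[of x]]]
        by (simp add: has_field_derivative_def mult.commute[of _ "D x b \<bullet> b"])
    qed
    have 5: "\<bar>D x b \<bullet> b\<bar> \<le> max 0 B" for x using bd[OF _ b, of x] by (auto simp: D_def)
    from integral_directional_derivative_eq_0[where Y = "\<lambda>x. X x \<bullet> b" and b = b, OF 1 2 3 4 5]
    show ?thesis by auto
  qed
  then have "integrable lborel (\<lambda>x. \<Sum>b\<in>Basis. D x b \<bullet> b)"
    "integral\<^sup>L lborel (\<lambda>x. \<Sum>b\<in>Basis. D x b \<bullet> b) = 0"
    by (simp_all add: Bochner_Integration.integral_sum)
  moreover have "(\<lambda>x. \<Sum>b\<in>Basis. D x b \<bullet> b) = (\<lambda>x. indicator \<Omega> x *\<^sub>R (\<Sum>b\<in>Basis. X' x b \<bullet> b))"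
    by (auto simp: D_def indicator_def)
  ultimately show "set_integrable lborel \<Omega> (\<lambda>x. \<Sum>b\<in>Basis. X' x b \<bullet> b)"
    "(LINT x:\<Omega>|lborel. (\<Sum>b\<in>Basis. X' x b \<bullet> b)) = 0"
    by (simp_all add: set_integrable_def set_lebesgue_integral_def)
qed

section \<open>The boundary as a local graph\<close>

text \<open>The height of \<open>y\<close> above the graph of \<open>h\<close> in direction \<open>e\<close>.  In a graph chart it is a defining function
  of the domain, and it replaces the distance to the boundary.\<close>

definition graph_defect :: "'a::euclidean_space \<Rightarrow> ('a \<Rightarrow> real) \<Rightarrow> 'a \<Rightarrow> real"
  where "graph_defect e h y = y \<bullet> e - h (y - (y \<bullet> e) *\<^sub>R e)"

lemma graph_defect_shift:
  assumes "norm e = 1"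
  shows "graph_defect e h (y + s *\<^sub>R e) = graph_defect e h y + s"
proof -
  have ee: "e \<bullet> e = 1" using assms by (simp add: dot_square_norm)
  have "y + s *\<^sub>R e - ((y + s *\<^sub>R e) \<bullet> e) *\<^sub>R e = y - (y \<bullet> e) *\<^sub>R e"
    by (simp add: inner_add_left ee scaleR_left_distrib)
  then show ?thesis
    unfolding graph_defect_def by (simp only:) (simp add: inner_add_left ee)
qed

lemma smooth_gradient:
  fixes h :: "'a::euclidean_space \<Rightarrow> real"
  assumes "smooth h"
  obtains H where "continuous_on UNIV H" "\<And>y. GDERIV h y :> H y"
proof
  define H where "H = (\<lambda>y. \<Sum>b\<in>Basis. partial_deriv b h y *\<^sub>R b)"
  have "Ck_extendable (Suc 0) UNIV h"
    using assms unfolding smooth_def Ck_closure_def by blast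
  then have diff: "h differentiable (at y)"
    and ext: "b \<in> Basis \<Longrightarrow> Ck_extendable 0 UNIV (partial_deriv b h)" for y b
    by auto
  have "continuous_on UNIV (partial_deriv b h)" if "b \<in> Basis" for b
    using ext[OF that] by (auto cong: continuous_on_cong)
  then show "continuous_on UNIV H" unfolding H_def by (intro continuous_intros) auto
  show "GDERIV h y :> H y" for y unfolding H_def by (rule GDERIV_partial_derivs[OF diff])
qed

lemma graph_defect_gradient:
  fixes h :: "'a::euclidean_space \<Rightarrow> real"
  assumes "smooth h"
  obtains D where "continuous_on UNIV D" "\<And>y. GDERIV (graph_defect e h) y :> D y"
proof -
  obtain H where H: "continuous_on UNIV H" "\<And>y. GDERIV h y :> H y"
    using smooth_gradient[OF assms] by blast
  define p where "p = (\<lambda>y. y - (y \<bullet> e) *\<^sub>R e)"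
  have p: "(p has_derivative p) (at y)" for y
    unfolding p_def by (auto intro!: derivative_eq_intros)
  have pc: "continuous_on UNIV p" unfolding p_def by (intro continuous_intros)
  show ?thesis
  proof
    show "continuous_on UNIV (\<lambda>y. e - (H (p y) - (H (p y) \<bullet> e) *\<^sub>R e))"
      by (intro continuous_intros continuous_on_compose2[OF H(1) pc]) auto
    show "GDERIV (graph_defect e h) y :> e - (H (p y) - (H (p y) \<bullet> e) *\<^sub>R e)" for y
    proof -
      have "((\<lambda>y. h (p y)) has_derivative (\<lambda>v. p v \<bullet> H (p y))) (at y)"
        using has_derivative_compose[OF p, of h "\<lambda>v. v \<bullet> H (p y)"] H(2)[of "p y"]
        by (simp add: gderiv_def)
      then have "((\<lambda>y. y \<bullet> e - h (p y)) has_derivative (\<lambda>v. v \<bullet> e - p v \<bullet> H (p y))) (at y)"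
        by (auto intro!: derivative_eq_intros)
      moreover have "v \<bullet> e - p v \<bullet> H (p y) = v \<bullet> (e - (H (p y) - (H (p y) \<bullet> e) *\<^sub>R e))" for v
        by (simp add: p_def inner_diff_left inner_diff_right inner_commute algebra_simps)
      moreover have "graph_defect e h = (\<lambda>y. y \<bullet> e - h (p y))"
        by (auto simp: graph_defect_def p_def)
      ultimately show ?thesis by (simp add: gderiv_def)
    qed
  qed
qed

lemma continuous_on_graph_defect:
  fixes h :: "'a::euclidean_space \<Rightarrow> real"
  assumes "smooth h"
  shows "continuous_on S (graph_defect e h)"
proof -
  obtain D where "\<And>y. GDERIV (graph_defect e h) y :> D y"
    using graph_defect_gradient[OF assms] by blast
  then show ?thesis
    unfolding gderiv_def
    by (meson continuous_at_imp_continuous_on has_derivative_continuous)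
qed

context
  fixes \<Omega> :: "'a::euclidean_space set" and x r e h
  assumes lg: "local_graph \<Omega> x r e h"
begin

lemma local_graph_unit: "norm e = 1" and local_graph_smooth: "smooth h" and local_graph_pos: "r > 0"
  using lg by (auto simp: local_graph_def)

lemma mem_local_graph: "y \<in> ball x r \<Longrightarrow> y \<in> \<Omega> \<longleftrightarrow> graph_defect e h y < 0"
  using lg unfolding local_graph_def graph_defect_def by force

lemma local_graph_closure:
  assumes y: "y \<in> ball x r" "y \<in> closure \<Omega>"
  shows "graph_defect e h y \<le> 0"
proof (rule ccontr)
  assume n: "\<not> ?thesis"
  define U where "U = {z. graph_defect e h z > 0} \<inter> ball x r"
  have "open U" unfolding U_def
    by (intro open_Int open_Collect_less continuous_on_graph_defect local_graph_smooth) auto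
  moreover have "U \<inter> \<Omega> = {}" using mem_local_graph by (force simp: U_def)
  ultimately have "U \<inter> closure \<Omega> = {}" using open_Int_closure_eq_empty by blast
  then have "y \<notin> U" using y(2) by blast
  then show False using n y(1) by (auto simp: U_def)
qed

lemma local_graph_frontier:
  assumes y: "y \<in> ball x r" and F: "graph_defect e h y = 0"
  shows "y \<in> frontier \<Omega>"
proof -
  have "((\<lambda>t. y + (-t) *\<^sub>R e) \<longlongrightarrow> y + (-0) *\<^sub>R e) (at_right 0)"
    by (intro tendsto_intros)
  then have lim: "((\<lambda>t. y + (-t) *\<^sub>R e) \<longlongrightarrow> y) (at_right 0)" by simp
  then have "\<forall>\<^sub>F t in at_right 0. y + (-t) *\<^sub>R e \<in> ball x r"
    using y by (intro topological_tendstoD) auto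
  moreover have "\<forall>\<^sub>F t in at_right (0::real). t > 0"
    by (simp add: eventually_at_right_less)
  ultimately have "\<forall>\<^sub>F t in at_right 0. y + (-t) *\<^sub>R e \<in> closure \<Omega>"
  proof eventually_elim
    case (elim t)
    have "graph_defect e h (y + (-t) *\<^sub>R e) < 0"
      using graph_defect_shift[OF local_graph_unit, of h y "-t"] F elim by simp
    then show ?case using elim mem_local_graph closure_subset by blast
  qed
  then have "y \<in> closure \<Omega>"
    using lim by (intro Lim_in_closed_set[of "closure \<Omega>" _ "at_right (0::real)"]) auto
  moreover have "y \<notin> \<Omega>" using mem_local_graph[OF y] F by simp
  ultimately show ?thesis using interior_subset by (auto simp: frontier_def)
qed

text \<open>To first order the line through \<open>y\<close> in direction \<open>v\<close> stays on the graph, so projecting it onto the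
  graph along \<open>e\<close> gives a curve in the boundary with the same velocity.\<close>

lemma boundary_tangent_local_graph:
  assumes y: "y \<in> ball x r" and F: "graph_defect e h y = 0"
    and D: "GDERIV (graph_defect e h) y :> D" and v: "v \<bullet> D = 0"
  shows "boundary_tangent \<Omega> y v"
proof -
  let ?F = "graph_defect e h"
  define c where "c = (\<lambda>t. (y + t *\<^sub>R v) + (- ?F (y + t *\<^sub>R v)) *\<^sub>R e)"
  have c0: "c 0 = y" by (simp add: c_def F)
  have "((\<lambda>t. y + t *\<^sub>R v) has_derivative (\<lambda>t. t *\<^sub>R v)) (at 0)"
    by (auto intro!: derivative_eq_intros)
  from has_derivative_compose[OF this, of ?F "\<lambda>h. h \<bullet> D"] D v
  have "((\<lambda>t. ?F (y + t *\<^sub>R v)) has_derivative (\<lambda>t. 0)) (at 0)"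
    by (simp add: gderiv_def)
  then have "((\<lambda>t. ?F (y + t *\<^sub>R v)) has_real_derivative 0) (at 0)"
    by (simp add: has_field_derivative_def lambda_zero)
  then have cd: "(c has_vector_derivative v) (at 0)"
    unfolding c_def
    by (auto intro!: derivative_eq_intros simp: has_real_derivative_iff_has_vector_derivative)
  have "(c \<longlongrightarrow> y) (at 0)"
    using has_vector_derivative_continuous[OF cd] c0 by (simp add: isCont_def)
  then have "\<forall>\<^sub>F t in at 0. c t \<in> ball x r"
    using y by (intro topological_tendstoD) auto
  moreover have "?F (c t) = 0" for t
    unfolding c_def graph_defect_shift[OF local_graph_unit] by simp
  ultimately have "\<forall>\<^sub>F t in at 0. c t \<in> frontier \<Omega>"
    by (auto elim!: eventually_mono intro: local_graph_frontier)
  then show ?thesis using c0 cd by (auto simp: boundary_tangent_def)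
qed

text \<open>The gradient \<open>D\<close> of the defining function is a multiple of the unit normal: the part of the normal
  orthogonal to \<open>D\<close> is a tangent vector, hence orthogonal to the normal itself, hence zero.\<close>

lemma orthogonal_normal_local_graph:
  assumes y: "y \<in> ball x r" and F: "graph_defect e h y = 0"
    and D: "GDERIV (graph_defect e h) y :> D"
    and n: "is_outward_unit_normal \<Omega> y n" and p: "p \<bullet> n = 0"
  shows "p \<bullet> D = 0"
proof -
  have n1: "norm n = 1" and nt: "\<And>v. boundary_tangent \<Omega> y v \<Longrightarrow> v \<bullet> n = 0"
    using n by (auto simp: is_outward_unit_normal_def)
  show ?thesis
  proof (cases "D = 0")
    case False
    define k where "k = (n \<bullet> D) / (D \<bullet> D)"
    define v where "v = n - k *\<^sub>R D"
    have vD: "v \<bullet> D = 0" using False by (simp add: v_def k_def inner_diff_left)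
    then have "v \<bullet> n = 0" using nt boundary_tangent_local_graph[OF y F D] by blast
    then have "v \<bullet> v = 0"
      using vD by (simp add: v_def inner_diff_right inner_diff_left inner_commute)
    then have nk: "n = k *\<^sub>R D" by (simp add: v_def)
    then have "k \<noteq> 0" using n1 by auto
    then show ?thesis using p nk by simp
  qed simp
qed

text \<open>The strip of thickness \<open>\<epsilon>\<close> below the graph has about \<open>1/\<epsilon>\<close> disjoint translates in direction \<open>-e\<close> that
  stay in the ball enlarged by 1.  Comparing volumes avoids rotating \<open>e\<close> to a coordinate axis and
  integrating over the graph.\<close>

lemma measure_strip_local_graph:
  fixes \<epsilon> \<rho> :: real
  assumes "0 < \<epsilon>" "\<epsilon> \<le> 1"
  shows "measure lborel {y \<in> cball x \<rho>. -\<epsilon> < graph_defect e h y \<and> graph_defect e h y < 0}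
    \<le> 2 * \<epsilon> * measure lborel (cball x (\<rho> + 1))"
proof -
  let ?F = "graph_defect e h"
  define S where "S = {y \<in> cball x \<rho>. -\<epsilon> < ?F y \<and> ?F y < 0}"
  define T where "T = (\<lambda>k. (\<lambda>y. - ((real k * \<epsilon>) *\<^sub>R e) + y) ` S)"
  \<comment> \<open>the largest number of shifts by \<open>\<epsilon>\<close> with total length at most 1\<close>
  define n where "n = nat \<lfloor>1 / \<epsilon>\<rfloor>"
  have n1: "real n \<le> 1 / \<epsilon>" "1 / \<epsilon> < real n + 1" "real n \<ge> 1"
    using assms by (auto simp: n_def le_nat_floor)
  have n2: "1 / \<epsilon> \<le> 2 * real n" using n1 by linarith
  have Fm[measurable]: "?F \<in> borel_measurable borel"
    by (intro borel_measurable_continuous_onI continuous_on_graph_defect local_graph_smooth)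
  have Sb[measurable]: "S \<in> sets borel" unfolding S_def by measurable
  have Tk: "T k = {y. y + (real k * \<epsilon>) *\<^sub>R e \<in> S}" for k
  proof (intro equalityI subsetI)
    fix y assume "y \<in> {y. y + (real k * \<epsilon>) *\<^sub>R e \<in> S}"
    then show "y \<in> T k" unfolding T_def by (intro image_eqI[of _ _ "y + (real k * \<epsilon>) *\<^sub>R e"]) auto
  qed (auto simp: T_def)
  have Tb[measurable]: "T k \<in> sets borel" for k
    unfolding Tk by measurable
  have mT: "measure lborel (T k) = measure lborel S" for k
    unfolding T_def using measure_translation[of "- ((real k * \<epsilon>) *\<^sub>R e)" S] Sb Tb[of k, unfolded T_def]
    by (simp add: measure_completion)
  have sub: "T k \<subseteq> cball x (\<rho> + 1)" if "k < n" for k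
  proof
    fix y assume "y \<in> T k"
    then have "dist x (y + (real k * \<epsilon>) *\<^sub>R e) \<le> \<rho>" by (simp add: Tk S_def)
    moreover have "dist (y + (real k * \<epsilon>) *\<^sub>R e) y \<le> 1"
    proof -
      have "real k * \<epsilon> \<le> 1 / \<epsilon> * \<epsilon>"
        using that n1 assms by (intro mult_right_mono) linarith+
      then show ?thesis using assms local_graph_unit by (simp add: dist_norm)
    qed
    ultimately show "y \<in> cball x (\<rho> + 1)"
      using dist_triangle[of x y "y + (real k * \<epsilon>) *\<^sub>R e"] by simp
  qed
  have FT: "- (real k + 1) * \<epsilon> < ?F y \<and> ?F y < - real k * \<epsilon>" if "y \<in> T k" for y k
    using that graph_defect_shift[OF local_graph_unit, of h y "real k * \<epsilon>"]
    by (auto simp: Tk S_def algebra_simps)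
  have disj: "disjoint_family_on T {..<n}"
  proof -
    have False if "y \<in> T j" "y \<in> T k" "j < k" for y j k
    proof -
      have "real j + 1 \<le> real k" using that by linarith
      then have "(real j + 1) * \<epsilon> \<le> real k * \<epsilon>" using assms by (intro mult_right_mono) auto
      then show False using FT[OF that(1)] FT[OF that(2)] by linarith
    qed
    then show ?thesis unfolding disjoint_family_on_def by (metis disjoint_iff linorder_neqE_nat)
  qed
  have fin: "emeasure lborel (cball x (\<rho> + 1)) < \<infinity>" by (intro emeasure_bounded_finite) auto
  have "real n * measure lborel S = (\<Sum>k<n. measure lborel (T k))" by (simp add: mT)
  also have "\<dots> = measure lborel (\<Union>k<n. T k)"
    by (rule measure_finite_Union[symmetric])
      (use disj order.strict_trans1[OF emeasure_mono[OF sub] fin[simplified]] in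
        \<open>auto simp: top.not_eq_extremum\<close>)
  also have "\<dots> \<le> measure lborel (cball x (\<rho> + 1))"
    using fin sub by (intro measure_mono_fmeasurable) (auto simp: fmeasurable_def)
  finally have "real n * measure lborel S \<le> measure lborel (cball x (\<rho> + 1))" .
  moreover have "measure lborel S \<le> 2 * \<epsilon> * (real n * measure lborel S)"
  proof -
    have "1 \<le> 2 * \<epsilon> * real n" using n2 assms by (simp add: field_simps)
    from mult_right_mono[OF this, of "measure lborel S"] show ?thesis by (simp add: algebra_simps)
  qed
  ultimately show ?thesis unfolding S_def[symmetric]
    by (smt (verit) assms(1) mult_left_mono)
qed

end

section \<open>Divergence theorem for fields without boundary flux\<close>

text \<open>A \<open>C\<^sup>1\<close> transition from 0 on \<open>(-\<infinity>, 0]\<close> to 1 on \<open>[1, \<infinity>)\<close>: its derivative is the hat function of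
  height 2 on \<open>[0, 1]\<close>.\<close>

definition cutoff :: "real \<Rightarrow> real"
  where "cutoff t = 2 * ((max 0 t)\<^sup>2 - 2 * (max 0 (t - 1/2))\<^sup>2 + (max 0 (t - 1))\<^sup>2)"

definition cutoff' :: "real \<Rightarrow> real"
  where "cutoff' t = 4 * (max 0 t - 2 * max 0 (t - 1/2) + max 0 (t - 1))"

lemma cutoff_has_derivative: "(cutoff has_real_derivative cutoff' t) (at t)"
proof -
  have "((\<lambda>s. s - a) has_real_derivative 1) (at t)" for a
    by (auto intro!: derivative_eq_intros)
  note d = has_derivative_pos_part_square_comp[OF this]
  from DERIV_cmult[OF DERIV_add[OF DERIV_diff[OF d[of 0] DERIV_cmult[OF d[of "1/2"], of 2]] d[of 1]], of 2]
  show ?thesis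
    unfolding cutoff_def[abs_def] cutoff'_def by (simp add: algebra_simps)
qed

lemma cutoff_le_0: "t \<le> 0 \<Longrightarrow> cutoff t = 0" and cutoff_ge_1: "t \<ge> 1 \<Longrightarrow> cutoff t = 1"
  by (auto simp: cutoff_def max_def power2_eq_square algebra_simps)

lemma abs_cutoff_le_1: "\<bar>cutoff t\<bar> \<le> 1"
proof -
  consider "t \<le> 0" | "0 < t" "t \<le> 1/2" | "1/2 < t" "t < 1" | "t \<ge> 1" by linarith
  then show ?thesis
  proof cases
    case 2
    then have "cutoff t = 2 * t\<^sup>2" by (simp add: cutoff_def max_def)
    moreover have "t\<^sup>2 \<le> (1/2)\<^sup>2" using 2 by (intro power_mono) auto
    ultimately show ?thesis by (simp add: power2_eq_square)
  next
    case 3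
    then have "cutoff t = 1 - 2 * (1 - t)\<^sup>2"
      by (simp add: cutoff_def max_def power2_eq_square algebra_simps)
    moreover have "(1 - t)\<^sup>2 \<le> 1\<^sup>2" using 3 by (intro power_mono) auto
    moreover have "0 \<le> (1 - t)\<^sup>2" by simp
    ultimately show ?thesis by (simp add: abs_le_iff)
  qed (auto simp: cutoff_le_0 cutoff_ge_1)
qed

lemma abs_cutoff'_le_2: "\<bar>cutoff' t\<bar> \<le> 2"
  by (auto simp: cutoff'_def max_def)

lemma cutoff'_eq_0: "t \<le> 0 \<or> t \<ge> 1 \<Longrightarrow> cutoff' t = 0"
  by (auto simp: cutoff'_def max_def)

lemma set_integral_abs_bound:
  fixes f g :: "'a::euclidean_space \<Rightarrow> real"
  assumes "set_integrable lborel \<Omega> f" "integrable lborel g"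
    "\<And>x. x \<in> \<Omega> \<Longrightarrow> \<bar>f x\<bar> \<le> g x" "\<And>x. 0 \<le> g x"
  shows "\<bar>LINT x:\<Omega>|lborel. f x\<bar> \<le> integral\<^sup>L lborel g"
proof -
  have "\<bar>LINT x:\<Omega>|lborel. f x\<bar> \<le> (\<integral>x. \<bar>indicator \<Omega> x *\<^sub>R f x\<bar> \<partial>lborel)"
    unfolding set_lebesgue_integral_def by (rule integral_abs_bound)
  also have "\<dots> \<le> integral\<^sup>L lborel g"
    using assms unfolding set_integrable_def
    by (intro integral_mono integrable_abs) (auto simp: indicator_def)
  finally show ?thesis .
qed

text \<open>On a compact set where \<open>p \<le> 0\<close>, a function that vanishes at the zeros of \<open>p\<close> is uniformly small where \<open>p\<close>
  is close to 0.  With \<open>p\<close> the defining function and \<open>q\<close> the normal component of a field this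
  turns the boundary condition into smallness in a thin strip.\<close>

lemma compact_less_gap:
  fixes p q :: "'a::euclidean_space \<Rightarrow> real"
  assumes S: "compact S" and p: "continuous_on S p" and q: "continuous_on S q"
    and z: "\<And>y. y \<in> S \<Longrightarrow> p y \<le> 0" "\<And>y. y \<in> S \<Longrightarrow> p y = 0 \<Longrightarrow> q y = 0" and \<eta>: "\<eta> > 0"
  shows "\<exists>\<epsilon>>0. \<forall>y\<in>S. p y > -\<epsilon> \<longrightarrow> \<bar>q y\<bar> \<le> \<eta>"
proof -
  define T where "T = {y \<in> S. \<bar>q y\<bar> \<ge> \<eta>}"
  have "closedin (top_of_set S) T"
    using continuous_closedin_preimage[OF continuous_on_rabs[OF q] closed_atLeast[of \<eta>]]
    by (simp add: T_def vimage_def Int_def)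
  then have T: "compact T" using S closedin_compact by blast
  show ?thesis
  proof (cases "T = {}")
    case True
    then show ?thesis by (intro exI[of _ 1]) (auto simp: T_def not_le intro: less_imp_le)
  next
    case False
    have "continuous_on T p" using p by (rule continuous_on_subset) (auto simp: T_def)
    then obtain m where m: "m \<in> T" "\<And>y. y \<in> T \<Longrightarrow> p y \<le> p m"
      using continuous_attains_sup[OF T False] by blast
    have "p m < 0" using m(1) z(1)[of m] z(2)[of m] \<eta> by (force simp: T_def)
    then show ?thesis using m(2)
      by (intro exI[of _ "- p m"]) (force simp: T_def not_le intro: less_imp_le)
  qed
qed

text \<open>For a field supported in a graph chart.  Multiplying by the cutoff \<open>c \<epsilon>\<close>, which vanishes where the
  defining function exceeds \<open>- \<epsilon>\<close> and equals 1 where it is below \<open>- 2 \<epsilon>\<close>, gives compact support in \<open>\<Omega>\<close>.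
  The extra term of the product rule lives in the strip between these levels.  There it is at
  most \<open>(2/\<epsilon>) \<eta>\<close>, where \<open>\<eta>\<close> bounds the flux density, and the strip has volume \<open>O(\<epsilon>)\<close>; so the
  error is \<open>O(\<eta>)\<close>, and \<open>\<eta>\<close> is arbitrary.\<close>

lemma integral_divergence_local_graph:
  fixes X :: "'a::euclidean_space \<Rightarrow> 'a" and \<Omega> :: "'a set"
  assumes lg: "local_graph \<Omega> x0 r e h" and op: "open \<Omega>" and bd: "bounded \<Omega>" and \<rho>: "\<rho> < r"
    and X: "\<And>x. x \<in> \<Omega> \<Longrightarrow> (X has_derivative X' x) (at x)"
    and supp: "\<And>x. x \<in> \<Omega> \<Longrightarrow> x \<notin> cball x0 \<rho> \<Longrightarrow> X x = 0"
    and supp': "\<And>x b. x \<in> \<Omega> \<Longrightarrow> x \<notin> cball x0 \<rho> \<Longrightarrow> X' x b = 0"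
    and X'bd: "\<And>x b. x \<in> \<Omega> \<Longrightarrow> b \<in> Basis \<Longrightarrow> \<bar>X' x b \<bullet> b\<bar> \<le> B"
    and Xbd: "\<And>x. x \<in> \<Omega> \<Longrightarrow> norm (X x) \<le> B'"
    and X'cont: "continuous_on \<Omega> (\<lambda>x. \<Sum>b\<in>Basis. X' x b \<bullet> b)"
    and Dcont: "continuous_on UNIV D" and D: "\<And>y. GDERIV (graph_defect e h) y :> D y"
    and flux: "\<And>\<eta>. \<eta> > 0 \<Longrightarrow> \<exists>\<epsilon>>0. \<forall>y\<in>\<Omega> \<inter> cball x0 \<rho>. graph_defect e h y > -\<epsilon> \<longrightarrow> \<bar>X y \<bullet> D y\<bar> \<le> \<eta>"
  shows "(LINT x:\<Omega>|lborel. (\<Sum>b\<in>Basis. X' x b \<bullet> b)) = 0"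
proof -
  let ?F = "graph_defect e h"
  define dv where "dv = (\<lambda>x. \<Sum>b\<in>Basis. X' x b \<bullet> b)"
  define c where "c = (\<lambda>\<epsilon> y. cutoff ((- ?F y - \<epsilon>) / \<epsilon>))"
  define Dc where "Dc = (\<lambda>\<epsilon> y. (- cutoff' ((- ?F y - \<epsilon>) / \<epsilon>) / \<epsilon>) *\<^sub>R D y)"
  define V where "V = measure lborel (cball x0 (\<rho> + 1))"
  have Fc: "continuous_on A ?F" for A
    by (rule continuous_on_graph_defect[OF local_graph_smooth[OF lg]])
  have Fm[measurable]: "?F \<in> borel_measurable borel"
    by (intro borel_measurable_continuous_onI Fc)
  have Dc: "GDERIV (c \<epsilon>) y :> Dc \<epsilon> y" for \<epsilon> y
  proof -
    have "((\<lambda>s. cutoff ((- s - \<epsilon>) / \<epsilon>)) has_real_derivative - cutoff' ((- ?F y - \<epsilon>) / \<epsilon>) / \<epsilon>) (at (?F y))"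
    proof -
      have "((\<lambda>s. (- s - \<epsilon>) / \<epsilon>) has_real_derivative - 1 / \<epsilon>) (at (?F y))"
        by (cases "\<epsilon> = 0") (auto intro!: derivative_eq_intros)
      from DERIV_chain2[OF cutoff_has_derivative this] show ?thesis by simp
    qed
    from GDERIV_DERIV_compose[OF D this] show ?thesis by (simp add: c_def[abs_def] Dc_def)
  qed
  have cc: "continuous_on A (c \<epsilon>)" for A \<epsilon>
    using Dc unfolding gderiv_def by (meson continuous_at_imp_continuous_on has_derivative_continuous)
  obtain Dm where Dm: "\<And>y. y \<in> \<Omega> \<Longrightarrow> norm (D y) \<le> Dm"
  proof -
    have "bounded (D ` closure \<Omega>)"
      using bd by (intro compact_imp_bounded compact_continuous_image continuous_on_subset[OF Dcont]) auto
    then obtain Dm where "\<And>y. y \<in> closure \<Omega> \<Longrightarrow> norm (D y) \<le> Dm" by (auto simp: bounded_iff)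
    then show ?thesis using that closure_subset by blast
  qed
  have dvbd: "\<bar>dv x\<bar> \<le> real DIM('a) * B" if "x \<in> \<Omega>" for x
  proof -
    have "\<bar>dv x\<bar> \<le> (\<Sum>b\<in>(Basis::'a set). B)"
      unfolding dv_def using X'bd[OF that] by (intro order_trans[OF sum_abs] sum_mono) auto
    then show ?thesis by simp
  qed
  have dvc: "continuous_on \<Omega> dv" unfolding dv_def by (rule X'cont)
  have dvint: "set_integrable lborel \<Omega> dv"
    by (rule set_integrable_bounded_continuous[OF op bd _ dvbd]) (use X'cont dv_def in simp_all)
  have key: "\<bar>LINT x:\<Omega>|lborel. c \<epsilon> x * dv x\<bar> \<le> 8 * \<eta> * V"
    if \<epsilon>: "\<epsilon> > 0" "2 * \<epsilon> \<le> 1" and \<eta>: "\<eta> \<ge> 0"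
      and fl: "\<forall>y\<in>\<Omega> \<inter> cball x0 \<rho>. ?F y > -(2 * \<epsilon>) \<longrightarrow> \<bar>X y \<bullet> D y\<bar> \<le> \<eta>" for \<epsilon> \<eta>
  proof -
    define Y where "Y = (\<lambda>y. if y \<in> \<Omega> then c \<epsilon> y *\<^sub>R X y else 0)"
    define Y' where "Y' = (\<lambda>y v. c \<epsilon> y *\<^sub>R X' y v + (v \<bullet> Dc \<epsilon> y) *\<^sub>R X y)"
    define K where "K = cball x0 \<rho> \<inter> {y. ?F y \<le> -\<epsilon>}"
    define S where "S = {y \<in> cball x0 \<rho>. -(2 * \<epsilon>) < ?F y \<and> ?F y < 0}"
    have K: "compact K" unfolding K_def
      by (intro compact_Int_closed closed_Collect_le Fc) auto
    have K\<Omega>: "K \<subseteq> \<Omega>" using mem_local_graph[OF lg] \<rho> \<epsilon> by (force simp: K_def)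
    have 1: "Y y = 0" if "y \<notin> K" for y
    proof (cases "y \<in> \<Omega> \<and> y \<in> cball x0 \<rho>")
      case True
      then have "(- ?F y - \<epsilon>) / \<epsilon> \<le> 0" using that \<epsilon> by (auto simp: K_def divide_le_0_iff)
      then show ?thesis by (simp add: Y_def c_def cutoff_le_0)
    qed (use supp in \<open>auto simp: Y_def\<close>)
    have 2: "(Y has_derivative Y' y) (at y)" if "y \<in> \<Omega>" for y
    proof -
      have "((\<lambda>y. c \<epsilon> y *\<^sub>R X y) has_derivative Y' y) (at y)"
        using Dc[of \<epsilon> y] X[OF that] unfolding Y'_def gderiv_def by (rule has_derivative_scaleR)
      then show ?thesis
        by (rule has_derivative_transform_within_open[OF _ op that]) (simp add: Y_def)
    qed
    have Dcb: "norm (Dc \<epsilon> y) \<le> 2 / \<epsilon> * Dm" if "y \<in> \<Omega>" for y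
      using abs_cutoff'_le_2[of "(- ?F y - \<epsilon>) / \<epsilon>"] Dm[OF that] \<epsilon>
      unfolding Dc_def by (auto intro!: mult_mono divide_right_mono)
    have 3: "\<bar>Y' y b \<bullet> b\<bar> \<le> 1 * B + (2 / \<epsilon> * Dm) * B'" if y: "y \<in> \<Omega>" and b: "b \<in> Basis" for y b
      unfolding Y'_def c_def
      by (rule abs_diagonal_scaleR_le[OF b abs_cutoff_le_1 X'bd[OF y b] Dcb[OF y] Xbd[OF y]])
    have div: "(\<Sum>b\<in>Basis. Y' y b \<bullet> b) = c \<epsilon> y * dv y + X y \<bullet> Dc \<epsilon> y" for y
        unfolding Y'_def dv_def by (rule divergence_scaleR)
    note A = integral_divergence_compact_support[OF op K K\<Omega> 1 2 3, unfolded div]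
    have ci: "set_integrable lborel \<Omega> (\<lambda>y. c \<epsilon> y * dv y)"
    proof (rule set_integrable_bounded_continuous[OF op bd])
      show "continuous_on \<Omega> (\<lambda>y. c \<epsilon> y * dv y)"
        by (intro continuous_intros cc dvc)
      show "\<bar>c \<epsilon> y * dv y\<bar> \<le> 1 * (real DIM('a) * B)" if "y \<in> \<Omega>" for y
        unfolding abs_mult c_def using abs_cutoff_le_1 dvbd[OF that] by (intro mult_mono) auto
    qed
    have xi: "set_integrable lborel \<Omega> (\<lambda>y. X y \<bullet> Dc \<epsilon> y)"
      using set_integral_diff(1)[OF A(1) ci] by simp
    have "(LINT x:\<Omega>|lborel. c \<epsilon> x * dv x) = - (LINT x:\<Omega>|lborel. X x \<bullet> Dc \<epsilon> x)"
      using A(2) set_integral_add(2)[OF ci xi] by simp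
    then have "\<bar>LINT x:\<Omega>|lborel. c \<epsilon> x * dv x\<bar> = \<bar>LINT x:\<Omega>|lborel. X x \<bullet> Dc \<epsilon> x\<bar>" by simp
    also have "\<dots> \<le> (\<integral>x. (2 / \<epsilon> * \<eta>) * indicator S x \<partial>lborel)"
    proof (rule set_integral_abs_bound[OF xi])
      have "S \<in> sets borel" unfolding S_def by measurable
      moreover have "bounded S" by (rule bounded_subset[OF bounded_cball[of x0 \<rho>]]) (auto simp: S_def)
      ultimately show "integrable lborel (\<lambda>x. (2 / \<epsilon> * \<eta>) * indicator S x)"
        by (intro integrable_mult_right integrable_real_indicator) (use emeasure_bounded_finite[of S] in auto)
      show "0 \<le> (2 / \<epsilon> * \<eta>) * indicator S x" for x using \<epsilon> \<eta> by (auto simp: indicator_def)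
      show "\<bar>X y \<bullet> Dc \<epsilon> y\<bar> \<le> (2 / \<epsilon> * \<eta>) * indicator S y" if y: "y \<in> \<Omega>" for y
      proof (cases "y \<in> S")
        case True
        then have "\<bar>X y \<bullet> D y\<bar> \<le> \<eta>" using fl y by (auto simp: S_def)
        then show ?thesis
          using True abs_cutoff'_le_2[of "(- ?F y - \<epsilon>) / \<epsilon>"] \<epsilon>
          unfolding Dc_def by (auto simp: abs_mult intro!: mult_mono divide_right_mono)
      next
        case False
        have "X y = 0 \<or> Dc \<epsilon> y = 0"
        proof (cases "y \<in> cball x0 \<rho>")
          case True
          then have "?F y < 0" using mem_local_graph[OF lg, of y] y \<rho> by simp
          then have "?F y \<le> - (2 * \<epsilon>)" using False True by (auto simp: S_def)
          then have "(- ?F y - \<epsilon>) / \<epsilon> \<ge> 1" using \<epsilon> by (simp add: le_divide_eq)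
          then show ?thesis by (simp add: Dc_def cutoff'_eq_0)
        qed (use supp y in auto)
        then show ?thesis using False by auto
      qed
    qed
    also have "\<dots> = (2 / \<epsilon> * \<eta>) * measure lborel S"
      by simp
    also have "\<dots> \<le> (2 / \<epsilon> * \<eta>) * (2 * (2 * \<epsilon>) * V)"
      unfolding S_def V_def using \<epsilon> \<eta> measure_strip_local_graph[OF lg, of "2 * \<epsilon>" \<rho>]
      by (intro mult_left_mono) auto
    also have "\<dots> = 8 * \<eta> * V" using \<epsilon> by simp
    finally show ?thesis .
  qed
  \<comment> \<open>let the cutoff scale tend to zero along a sequence\<close>
  define \<epsilon> where "\<epsilon> = (\<lambda>n::nat. 1 / real (Suc n))"
  have \<epsilon>: "\<epsilon> \<longlonglongrightarrow> 0" "\<epsilon> n > 0" for n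
    unfolding \<epsilon>_def using LIMSEQ_Suc[OF lim_1_over_n] by simp_all
  have V0: "V \<ge> 0" by (simp add: V_def)
  have lim0: "(\<lambda>n. LINT x:\<Omega>|lborel. c (\<epsilon> n) x * dv x) \<longlonglongrightarrow> 0"
  proof (rule tendstoI)
    fix \<sigma> :: real assume \<sigma>: "\<sigma> > 0"
    \<comment> \<open>chosen so that the bound \<open>8 \<eta> V\<close> stays below \<open>\<sigma>\<close>, also when \<open>V = 0\<close>\<close>
    define \<eta> where "\<eta> = \<sigma> / (8 * V + 1)"
    have \<eta>: "\<eta> > 0" "8 * \<eta> * V < \<sigma>" using \<sigma> V0 by (auto simp: \<eta>_def field_simps)
    obtain \<epsilon>0 where \<epsilon>0: "\<epsilon>0 > 0" "\<forall>y\<in>\<Omega> \<inter> cball x0 \<rho>. ?F y > -\<epsilon>0 \<longrightarrow> \<bar>X y \<bullet> D y\<bar> \<le> \<eta>"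
      using flux[OF \<eta>(1)] by blast
    have "\<forall>\<^sub>F n in sequentially. \<epsilon> n < min \<epsilon>0 1 / 2"
      using \<epsilon>(1) \<epsilon>0(1) by (intro order_tendstoD) auto
    then show "\<forall>\<^sub>F n in sequentially. dist (LINT x:\<Omega>|lborel. c (\<epsilon> n) x * dv x) 0 < \<sigma>"
    proof eventually_elim
      case (elim n)
      have "\<bar>LINT x:\<Omega>|lborel. c (\<epsilon> n) x * dv x\<bar> \<le> 8 * \<eta> * V"
        by (rule key) (use elim \<epsilon>(2) \<eta> \<epsilon>0(2) in auto)
      then show ?case using \<eta>(2) by simp
    qed
  qed
  have "(\<lambda>n. LINT x:\<Omega>|lborel. c (\<epsilon> n) x * dv x) \<longlonglongrightarrow> (LINT x:\<Omega>|lborel. dv x)"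
    unfolding set_lebesgue_integral_def
  proof (rule integral_dominated_convergence[where w = "\<lambda>x. \<bar>indicator \<Omega> x *\<^sub>R dv x\<bar>"])
    show "integrable lborel (\<lambda>x. \<bar>indicator \<Omega> x *\<^sub>R dv x\<bar>)"
      using dvint unfolding set_integrable_def by (rule integrable_abs)
    show m: "(\<lambda>x. indicator \<Omega> x *\<^sub>R dv x) \<in> borel_measurable lborel"
      using dvint unfolding set_integrable_def by (rule borel_measurable_integrable)
    show "(\<lambda>x. indicator \<Omega> x *\<^sub>R (c (\<epsilon> n) x * dv x)) \<in> borel_measurable lborel" for n
    proof -
      have "c (\<epsilon> n) \<in> borel_measurable lborel"
        using borel_measurable_continuous_onI[OF cc] by simp
      from borel_measurable_times[OF this m] show ?thesis by (simp add: mult.left_commute)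
    qed
    show "AE x in lborel. norm (indicator \<Omega> x *\<^sub>R (c (\<epsilon> n) x * dv x)) \<le> \<bar>indicator \<Omega> x *\<^sub>R dv x\<bar>" for n
      using abs_cutoff_le_1 by (intro AE_I2) (auto simp: indicator_def abs_mult c_def intro!: mult_left_le_one_le)
    show "AE x in lborel. (\<lambda>n. indicator \<Omega> x *\<^sub>R (c (\<epsilon> n) x * dv x)) \<longlonglongrightarrow> indicator \<Omega> x *\<^sub>R dv x"
    proof (rule AE_I2)
      fix x
      show "(\<lambda>n. indicator \<Omega> x *\<^sub>R (c (\<epsilon> n) x * dv x)) \<longlonglongrightarrow> indicator \<Omega> x *\<^sub>R dv x"
      proof (cases "x \<in> \<Omega> \<and> x \<in> cball x0 \<rho>")
        case True
        then have F0: "?F x < 0" using mem_local_graph[OF lg, of x] \<rho> by simp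
        have "\<forall>\<^sub>F n in sequentially. \<epsilon> n < - ?F x / 2"
          using \<epsilon>(1) F0 by (intro order_tendstoD) auto
        then have "\<forall>\<^sub>F n in sequentially. indicator \<Omega> x *\<^sub>R (c (\<epsilon> n) x * dv x) = indicator \<Omega> x *\<^sub>R dv x"
        proof eventually_elim
          case (elim n)
          then have "(- ?F x - \<epsilon> n) / \<epsilon> n \<ge> 1" using \<epsilon>(2)[of n] by (simp add: le_divide_eq)
          then show ?case by (simp add: c_def cutoff_ge_1)
        qed
        then show ?thesis by (rule tendsto_eventually)
      next
        case False
        then have "x \<in> \<Omega> \<Longrightarrow> dv x = 0" unfolding dv_def using supp' by auto
        then show ?thesis by (auto simp: indicator_def)
      qed
    qed
  qed
  then show ?thesis using lim0 LIMSEQ_unique unfolding dv_def by blast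
qed

lemma smooth_bounded_domain_local_graph:
  assumes "smooth_bounded_domain \<Omega>" "x \<in> frontier \<Omega>"
  obtains r e h where "local_graph \<Omega> x r e h"
  using assms unfolding smooth_bounded_domain_def by blast

lemma is_outward_unit_normal_outward_unit_normal:
  assumes "smooth_bounded_domain \<Omega>" "x \<in> frontier \<Omega>"
  shows "is_outward_unit_normal \<Omega> x (outward_unit_normal \<Omega> x)"
proof -
  have "open \<Omega>" using assms(1) by (simp add: smooth_bounded_domain_def)
  moreover obtain r e h where "local_graph \<Omega> x r e h"
    using smooth_bounded_domain_local_graph[OF assms] .
  ultimately have "\<exists>!n. is_outward_unit_normal \<Omega> x n"
    using outward_unit_normal_ex1 assms(2) by blast
  then show ?thesis unfolding outward_unit_normal_def by (rule theI')
qed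

text \<open>Around every point of the closure the divergence theorem holds for \<open>\<zeta> X\<close> when the scalar weight \<open>\<zeta>\<close>
  lives in a small ball.  Inside the domain the support is compact; at the boundary a graph chart
  applies, and \<open>X \<bullet> \<nabla>F\<close> vanishes on the boundary because \<open>\<nabla>F\<close> is parallel to the normal.\<close>

lemma integral_divergence_localized:
  fixes X :: "'a::euclidean_space \<Rightarrow> 'a" and \<Omega> :: "'a set"
  assumes sbd: "smooth_bounded_domain \<Omega>"
    and Xcont: "continuous_on (closure \<Omega>) X"
    and X: "\<And>x. x \<in> \<Omega> \<Longrightarrow> (X has_derivative X' x) (at x)"
    and X'bd: "\<And>x b. x \<in> \<Omega> \<Longrightarrow> b \<in> Basis \<Longrightarrow> \<bar>X' x b \<bullet> b\<bar> \<le> B"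
    and X'cont: "continuous_on \<Omega> (\<lambda>x. \<Sum>b\<in>Basis. X' x b \<bullet> b)"
    and flux: "\<And>x. x \<in> frontier \<Omega> \<Longrightarrow> X x \<bullet> outward_unit_normal \<Omega> x = 0"
    and x: "x \<in> closure \<Omega>"
  shows "\<exists>\<rho>>0. \<forall>\<zeta> D\<zeta> M. (\<forall>y\<in>\<Omega>. GDERIV \<zeta> y :> D\<zeta> y \<and> \<bar>\<zeta> y\<bar> \<le> M \<and> norm (D\<zeta> y) \<le> M) \<longrightarrow>
      continuous_on \<Omega> D\<zeta> \<longrightarrow> (\<forall>y\<in>\<Omega> - cball x \<rho>. \<zeta> y = 0 \<and> D\<zeta> y = 0) \<longrightarrow>
      (LINT y:\<Omega>|lborel. \<zeta> y * (\<Sum>b\<in>Basis. X' y b \<bullet> b) + X y \<bullet> D\<zeta> y) = 0"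
proof -
  have op: "open \<Omega>" and bd: "bounded \<Omega>" using sbd by (auto simp: smooth_bounded_domain_def)
  have "compact (closure \<Omega>)" using bd by simp
  from continuous_on_compact_norm_bound[OF this Xcont] obtain B'
    where B': "\<And>y. y \<in> closure \<Omega> \<Longrightarrow> norm (X y) \<le> B'" by blast
  let ?P = "\<lambda>\<rho> \<zeta> D\<zeta> M. (\<forall>y\<in>\<Omega>. GDERIV \<zeta> y :> D\<zeta> y \<and> \<bar>\<zeta> y\<bar> \<le> M \<and> norm (D\<zeta> y) \<le> M) \<and>
      continuous_on \<Omega> D\<zeta> \<and> (\<forall>y\<in>\<Omega> - cball x \<rho>. \<zeta> y = 0 \<and> D\<zeta> y = 0)"
  define Y' where "Y' = (\<lambda>(\<zeta>::'a \<Rightarrow> real) D\<zeta> y v. \<zeta> y *\<^sub>R X' y v + (v \<bullet> D\<zeta> y) *\<^sub>R X y)"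
  have div: "(\<Sum>b\<in>Basis. Y' \<zeta> D\<zeta> y b \<bullet> b) = \<zeta> y * (\<Sum>b\<in>Basis. X' y b \<bullet> b) + X y \<bullet> D\<zeta> y" for \<zeta> D\<zeta> y
    unfolding Y'_def by (rule divergence_scaleR)
  have der: "((\<lambda>y. \<zeta> y *\<^sub>R X y) has_derivative Y' \<zeta> D\<zeta> y) (at y)"
    if "?P \<rho> \<zeta> D\<zeta> M" "y \<in> \<Omega>" for \<rho> \<zeta> D\<zeta> M y
    using that X[OF that(2)] unfolding Y'_def gderiv_def by (intro has_derivative_scaleR) auto
  have bnd: "\<bar>Y' \<zeta> D\<zeta> y b \<bullet> b\<bar> \<le> M * B + M * B'"
    if P: "?P \<rho> \<zeta> D\<zeta> M" and y: "y \<in> \<Omega>" and b: "b \<in> Basis" for \<rho> \<zeta> D\<zeta> M y b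
  proof -
    have "\<bar>\<zeta> y\<bar> \<le> M" "norm (D\<zeta> y) \<le> M" "norm (X y) \<le> B'"
      using P y B'[of y] closure_subset by blast+
    then show ?thesis unfolding Y'_def by (intro abs_diagonal_scaleR_le[OF b] X'bd[OF y b])
  qed
  show ?thesis
  proof (cases "x \<in> \<Omega>")
    case True
    then obtain \<rho> where \<rho>: "\<rho> > 0" "cball x \<rho> \<subseteq> \<Omega>" using op open_contains_cball by blast
    have "(LINT y:\<Omega>|lborel. \<zeta> y * (\<Sum>b\<in>Basis. X' y b \<bullet> b) + X y \<bullet> D\<zeta> y) = 0"
      if P: "?P \<rho> \<zeta> D\<zeta> M" for \<zeta> D\<zeta> M
    proof -
      define Y where "Y = (\<lambda>y. if y \<in> \<Omega> then \<zeta> y *\<^sub>R X y else 0)"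
      have "(LINT y:\<Omega>|lborel. (\<Sum>b\<in>Basis. Y' \<zeta> D\<zeta> y b \<bullet> b)) = 0"
      proof (rule integral_divergence_compact_support[OF op compact_cball \<rho>(2)])
        show "Y y = 0" if "y \<notin> cball x \<rho>" for y using P that by (auto simp: Y_def)
        show "(Y has_derivative Y' \<zeta> D\<zeta> y) (at y)" if "y \<in> \<Omega>" for y
          by (rule has_derivative_transform_within_open[OF der[OF P that] op that]) (simp add: Y_def)
        show "\<bar>Y' \<zeta> D\<zeta> y b \<bullet> b\<bar> \<le> M * B + M * B'" if "y \<in> \<Omega>" "b \<in> Basis" for y b
          using bnd[OF P that] .
      qed
      then show ?thesis unfolding div .
    qed
    then show ?thesis using \<rho>(1) by blast
  next
    case False
    then have "x \<in> frontier \<Omega>" using x op by (simp add: frontier_def interior_open)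
    then obtain r e h where lg: "local_graph \<Omega> x r e h"
      using smooth_bounded_domain_local_graph[OF sbd] by blast
    note r = local_graph_pos[OF lg]
    \<comment> \<open>half the chart radius, so that the closed ball stays inside the chart\<close>
    define \<rho> where "\<rho> = r / 2"
    have \<rho>: "\<rho> > 0" "\<rho> < r" using r by (auto simp: \<rho>_def)
    obtain D where D: "continuous_on UNIV D" "\<And>y. GDERIV (graph_defect e h) y :> D y"
      using graph_defect_gradient[OF local_graph_smooth[OF lg]] by blast
    let ?S = "closure \<Omega> \<inter> cball x \<rho>"
    have gap: "\<exists>\<epsilon>>0. \<forall>y\<in>?S. graph_defect e h y > -\<epsilon> \<longrightarrow> \<bar>X y \<bullet> D y\<bar> \<le> \<eta>" if "\<eta> > 0" for \<eta>
    proof (rule compact_less_gap[OF _ _ _ _ _ that])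
      show "compact ?S" using bd by (intro closed_Int_compact) auto
      show "continuous_on ?S (graph_defect e h)"
        by (rule continuous_on_graph_defect[OF local_graph_smooth[OF lg]])
      show "continuous_on ?S (\<lambda>y. X y \<bullet> D y)"
        by (intro continuous_intros continuous_on_subset[OF Xcont] continuous_on_subset[OF D(1)]) auto
      show "graph_defect e h y \<le> 0" if "y \<in> ?S" for y
        using that local_graph_closure[OF lg, of y] \<rho> by auto
      show "X y \<bullet> D y = 0" if y: "y \<in> ?S" and F: "graph_defect e h y = 0" for y
      proof -
        have yb: "y \<in> ball x r" using y \<rho> by auto
        have fr: "y \<in> frontier \<Omega>" by (rule local_graph_frontier[OF lg yb F])
        show ?thesis
          by (rule orthogonal_normal_local_graph[OF lg yb F D(2)
                is_outward_unit_normal_outward_unit_normal[OF sbd fr] flux[OF fr]])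
      qed
    qed
    have "(LINT y:\<Omega>|lborel. \<zeta> y * (\<Sum>b\<in>Basis. X' y b \<bullet> b) + X y \<bullet> D\<zeta> y) = 0"
      if P: "?P \<rho> \<zeta> D\<zeta> M" for \<zeta> D\<zeta> M
    proof -
      have \<zeta>c: "continuous_on \<Omega> \<zeta>"
        using P unfolding gderiv_def
        by (meson continuous_at_imp_continuous_on has_derivative_continuous)
      have "(LINT y:\<Omega>|lborel. (\<Sum>b\<in>Basis. Y' \<zeta> D\<zeta> y b \<bullet> b)) = 0"
      proof (rule integral_divergence_local_graph[OF lg op bd \<rho>(2) der[OF P] _ _ bnd[OF P] _ _ D])
        show "\<zeta> y *\<^sub>R X y = 0" if "y \<in> \<Omega>" "y \<notin> cball x \<rho>" for y using P that by auto
        show "Y' \<zeta> D\<zeta> y b = 0" if "y \<in> \<Omega>" "y \<notin> cball x \<rho>" for y b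
          using P that by (auto simp: Y'_def)
        show "norm (\<zeta> y *\<^sub>R X y) \<le> M * B'" if "y \<in> \<Omega>" for y
        proof -
          have "\<bar>\<zeta> y\<bar> \<le> M" "norm (X y) \<le> B'" using P that B'[of y] closure_subset by auto
          then show ?thesis by (auto intro!: mult_mono intro: order_trans[OF abs_ge_zero])
        qed
        show "continuous_on \<Omega> (\<lambda>y. \<Sum>b\<in>Basis. Y' \<zeta> D\<zeta> y b \<bullet> b)"
          unfolding div using P
          by (intro continuous_intros \<zeta>c X'cont continuous_on_subset[OF Xcont closure_subset]) auto
        show "\<exists>\<epsilon>>0. \<forall>y\<in>\<Omega> \<inter> cball x \<rho>. graph_defect e h y > -\<epsilon> \<longrightarrow> \<bar>(\<zeta> y *\<^sub>R X y) \<bullet> D y\<bar> \<le> \<eta>"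
          if \<eta>: "\<eta> > 0" for \<eta>
        proof -
          have "\<eta> / (\<bar>M\<bar> + 1) > 0" using \<eta> by (intro divide_pos_pos) auto
          from gap[OF this] obtain \<epsilon> where \<epsilon>: "\<epsilon> > 0"
            "\<And>y. y \<in> ?S \<Longrightarrow> graph_defect e h y > -\<epsilon> \<Longrightarrow> \<bar>X y \<bullet> D y\<bar> \<le> \<eta> / (\<bar>M\<bar> + 1)" by blast
          have "\<bar>(\<zeta> y *\<^sub>R X y) \<bullet> D y\<bar> \<le> \<eta>"
            if y: "y \<in> \<Omega> \<inter> cball x \<rho>" "graph_defect e h y > -\<epsilon>" for y
          proof -
            have "y \<in> ?S" using y closure_subset by auto
            then have "\<bar>X y \<bullet> D y\<bar> \<le> \<eta> / (\<bar>M\<bar> + 1)" using \<epsilon>(2) y by blast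
            moreover have "\<bar>\<zeta> y\<bar> \<le> \<bar>M\<bar> + 1" using P y by fastforce
            ultimately have "\<bar>\<zeta> y\<bar> * \<bar>X y \<bullet> D y\<bar> \<le> (\<bar>M\<bar> + 1) * (\<eta> / (\<bar>M\<bar> + 1))"
              by (intro mult_mono) auto
            also have "\<dots> = \<eta>" by (simp add: add_pos_nonneg)
            finally show ?thesis by (simp add: abs_mult)
          qed
          then show ?thesis using \<epsilon>(1) by blast
        qed
      qed
      then show ?thesis unfolding div .
    qed
    then show ?thesis using \<rho>(1) by blast
  qed
qed

lemma GDERIV_sum:
  assumes "\<And>i. i \<in> I \<Longrightarrow> GDERIV (f i) x :> D i"
  shows "GDERIV (\<lambda>y. \<Sum>i\<in>I. f i y) x :> (\<Sum>i\<in>I. D i)"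
  using assms unfolding gderiv_def inner_sum_right by (rule has_derivative_sum)

lemma GDERIV_bump:
  "GDERIV (\<lambda>y. (max 0 (a - (norm (y - x))\<^sup>2))\<^sup>2) y :>
     (2 * max 0 (a - (norm (y - x))\<^sup>2)) *\<^sub>R (- 2 *\<^sub>R (y - x))"
proof -
  have "GDERIV (\<lambda>y. a - (norm (y - x))\<^sup>2) y :> - 2 *\<^sub>R (y - x)"
    unfolding gderiv_def power2_norm_eq_inner
    by (auto intro!: derivative_eq_intros simp: inner_commute inner_diff_left algebra_simps)
  from GDERIV_DERIV_compose[OF this has_derivative_pos_part_square] show ?thesis .
qed

text \<open>The local statements are glued with a \<open>C\<^sup>1\<close> partition of unity \<open>\<zeta> x = \<beta> x / S\<close> built from the bumps
  \<open>\<beta> x y = ((\<rho>\<^sup>2 - |y - x|\<^sup>2)\<^sup>+)\<^sup>2\<close>: the weights sum to 1 and their gradients to 0.\<close>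

theorem integral_divergence_zero_flux:
  fixes X :: "'a::euclidean_space \<Rightarrow> 'a" and \<Omega> :: "'a set"
  assumes sbd: "smooth_bounded_domain \<Omega>"
    and Xcont: "continuous_on (closure \<Omega>) X"
    and X: "\<And>x. x \<in> \<Omega> \<Longrightarrow> (X has_derivative X' x) (at x)"
    and X'bd: "\<And>x b. x \<in> \<Omega> \<Longrightarrow> b \<in> Basis \<Longrightarrow> \<bar>X' x b \<bullet> b\<bar> \<le> B"
    and X'cont: "continuous_on \<Omega> (\<lambda>x. \<Sum>b\<in>Basis. X' x b \<bullet> b)"
    and flux: "\<And>x. x \<in> frontier \<Omega> \<Longrightarrow> X x \<bullet> outward_unit_normal \<Omega> x = 0"
  shows "(LINT x:\<Omega>|lborel. (\<Sum>b\<in>Basis. X' x b \<bullet> b)) = 0"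
proof -
  have op: "open \<Omega>" and bd: "bounded \<Omega>" using sbd by (auto simp: smooth_bounded_domain_def)
  have comp: "compact (closure \<Omega>)" using bd by simp
  define dv where "dv = (\<lambda>x. \<Sum>b\<in>Basis. X' x b \<bullet> b)"
  have dvc: "continuous_on \<Omega> dv" unfolding dv_def by (rule X'cont)
  define Loc where "Loc = (\<lambda>x \<rho>. \<forall>\<zeta> D\<zeta> M.
      (\<forall>y\<in>\<Omega>. GDERIV \<zeta> y :> D\<zeta> y \<and> \<bar>\<zeta> y\<bar> \<le> M \<and> norm (D\<zeta> y) \<le> M) \<longrightarrow>
      continuous_on \<Omega> D\<zeta> \<longrightarrow> (\<forall>y\<in>\<Omega> - cball x \<rho>. \<zeta> y = 0 \<and> D\<zeta> y = 0) \<longrightarrow>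
      (LINT y:\<Omega>|lborel. \<zeta> y * dv y + X y \<bullet> D\<zeta> y) = 0)"
  have "\<exists>\<rho>>0. Loc x \<rho>" if "x \<in> closure \<Omega>" for x
    unfolding Loc_def dv_def
    by (rule integral_divergence_localized[OF sbd Xcont X X'bd X'cont flux that])
  from compact_finite_ball_cover[where Q = Loc, OF comp this]
  obtain C \<rho> where C: "finite C" "closure \<Omega> \<subseteq> (\<Union>x\<in>C. ball x (\<rho> x))"
    and \<rho>: "\<forall>x\<in>C. \<rho> x > 0 \<and> Loc x (\<rho> x)" by blast
  define \<beta> where "\<beta> = (\<lambda>x y. (max 0 ((\<rho> x)\<^sup>2 - (norm (y - x))\<^sup>2))\<^sup>2)"
  define D\<beta> where "D\<beta> = (\<lambda>x y. (2 * max 0 ((\<rho> x)\<^sup>2 - (norm (y - x))\<^sup>2)) *\<^sub>R (- 2 *\<^sub>R (y - x)))"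
  define S where "S = (\<lambda>y. \<Sum>x\<in>C. \<beta> x y)"
  define DS where "DS = (\<lambda>y. \<Sum>x\<in>C. D\<beta> x y)"
  define \<zeta> where "\<zeta> = (\<lambda>x y. \<beta> x y * inverse (S y))"
  define D\<zeta> where "D\<zeta> = (\<lambda>x y. \<beta> x y *\<^sub>R (- (inverse (S y))\<^sup>2 *\<^sub>R DS y) + inverse (S y) *\<^sub>R D\<beta> x y)"
  have D\<beta>: "GDERIV (\<beta> x) y :> D\<beta> x y" for x y
    unfolding \<beta>_def D\<beta>_def by (rule GDERIV_bump)
  have DS: "GDERIV S y :> DS y" for y
    unfolding S_def[abs_def] DS_def by (rule GDERIV_sum) (rule D\<beta>)
  have cont: "continuous_on A (\<beta> x)" "continuous_on A (D\<beta> x)"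
    "continuous_on A S" "continuous_on A DS" for A x
    unfolding S_def DS_def \<beta>_def D\<beta>_def by (intro continuous_intros)+
  have Spos: "S y > 0" if y: "y \<in> closure \<Omega>" for y
  proof -
    obtain x where x: "x \<in> C" "y \<in> ball x (\<rho> x)" using C(2) y by blast
    have "norm (y - x) < \<rho> x" using x(2) by (simp add: dist_norm norm_minus_commute)
    then have "(norm (y - x))\<^sup>2 < (\<rho> x)\<^sup>2" by (intro power_strict_mono) auto
    then have "\<beta> x y > 0" by (simp add: \<beta>_def)
    then show ?thesis unfolding S_def
      by (intro sum_pos2[OF C(1) x(1)]) (auto simp: \<beta>_def)
  qed
  have \<zeta>c: "continuous_on (closure \<Omega>) (\<zeta> x)" "continuous_on (closure \<Omega>) (D\<zeta> x)" for x
    unfolding \<zeta>_def D\<zeta>_def using Spos by (intro continuous_intros cont; force)+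
  have D\<zeta>: "GDERIV (\<zeta> x) y :> D\<zeta> x y" if "y \<in> \<Omega>" for x y
  proof -
    have "S y \<noteq> 0" using Spos[of y] that closure_subset by force
    from GDERIV_mult[OF D\<beta> GDERIV_inverse[OF DS this]] show ?thesis
      unfolding \<zeta>_def[abs_def] D\<zeta>_def by simp
  qed
  have z: "(LINT y:\<Omega>|lborel. \<zeta> x y * dv y + X y \<bullet> D\<zeta> x y) = 0" if x: "x \<in> C" for x
  proof -
    obtain M1 where M1: "\<And>y. y \<in> closure \<Omega> \<Longrightarrow> norm (\<zeta> x y) \<le> M1"
      using continuous_on_compact_norm_bound[OF comp \<zeta>c(1)] by blast
    obtain M2 where M2: "\<And>y. y \<in> closure \<Omega> \<Longrightarrow> norm (D\<zeta> x y) \<le> M2"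
      using continuous_on_compact_norm_bound[OF comp \<zeta>c(2)] by blast
    have "Loc x (\<rho> x)" using x \<rho> by blast
    note loc = this[unfolded Loc_def, THEN spec[of _ "\<zeta> x"], THEN spec[of _ "D\<zeta> x"],
        THEN spec[of _ "max M1 M2"], THEN mp, THEN mp, THEN mp]
    show ?thesis
    proof (rule loc)
      show "\<forall>y\<in>\<Omega>. GDERIV (\<zeta> x) y :> D\<zeta> x y \<and> \<bar>\<zeta> x y\<bar> \<le> max M1 M2 \<and> norm (D\<zeta> x y) \<le> max M1 M2"
        using D\<zeta> M1 M2 closure_subset[of \<Omega>] by (fastforce simp: le_max_iff_disj)
      show "continuous_on \<Omega> (D\<zeta> x)" using \<zeta>c(2) closure_subset by (rule continuous_on_subset)
      have "\<beta> x y = 0 \<and> D\<beta> x y = 0" if "y \<notin> cball x (\<rho> x)" for y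
      proof -
        have "\<rho> x < norm (y - x)" using that by (simp add: dist_norm norm_minus_commute)
        then have "(\<rho> x)\<^sup>2 \<le> (norm (y - x))\<^sup>2"
          using bspec[OF \<rho> x] by (intro power_mono) (auto intro: less_imp_le)
        then show ?thesis by (simp add: \<beta>_def D\<beta>_def)
      qed
      then show "\<forall>y\<in>\<Omega> - cball x (\<rho> x). \<zeta> x y = 0 \<and> D\<zeta> x y = 0"
        by (auto simp: \<zeta>_def D\<zeta>_def)
    qed
  qed
  have int: "set_integrable lborel \<Omega> (\<lambda>y. \<zeta> x y * dv y + X y \<bullet> D\<zeta> x y)" for x
  proof -
    obtain M1 where M1: "\<And>y. y \<in> closure \<Omega> \<Longrightarrow> norm (\<zeta> x y) \<le> M1"
      using continuous_on_compact_norm_bound[OF comp \<zeta>c(1)] by blast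
    have "continuous_on (closure \<Omega>) (\<lambda>y. X y \<bullet> D\<zeta> x y)" by (intro continuous_intros Xcont \<zeta>c)
    from continuous_on_compact_norm_bound[OF comp this]
    obtain M2 where M2: "\<And>y. y \<in> closure \<Omega> \<Longrightarrow> norm (X y \<bullet> D\<zeta> x y) \<le> M2" by blast
    show ?thesis
    proof (rule set_integrable_bounded_continuous[OF op bd])
      show "continuous_on \<Omega> (\<lambda>y. \<zeta> x y * dv y + X y \<bullet> D\<zeta> x y)"
        by (intro continuous_intros dvc continuous_on_subset[OF _ closure_subset[of \<Omega>]] Xcont \<zeta>c)
      show "\<bar>\<zeta> x y * dv y + X y \<bullet> D\<zeta> x y\<bar> \<le> M1 * (real DIM('a) * B) + M2" if y: "y \<in> \<Omega>" for y
      proof -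
        have "\<bar>dv y\<bar> \<le> (\<Sum>b\<in>(Basis::'a set). B)"
          unfolding dv_def using X'bd[OF y] by (intro order_trans[OF sum_abs] sum_mono) auto
        moreover have "norm (\<zeta> x y) \<le> M1" "norm (X y \<bullet> D\<zeta> x y) \<le> M2"
          using M1 M2 y closure_subset by auto
        ultimately have "\<bar>\<zeta> x y * dv y\<bar> \<le> M1 * (real DIM('a) * B)"
          unfolding abs_mult by (intro mult_mono) auto
        then show ?thesis using \<open>norm (X y \<bullet> D\<zeta> x y) \<le> M2\<close> by simp
      qed
    qed
  qed
  have sum1: "(\<Sum>x\<in>C. \<zeta> x y * dv y + X y \<bullet> D\<zeta> x y) = dv y" if y: "y \<in> \<Omega>" for y
  proof -
    have S0: "S y \<noteq> 0" using Spos[of y] y closure_subset by force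
    have sums: "(\<Sum>x\<in>C. \<beta> x y) = S y" "(\<Sum>x\<in>C. D\<beta> x y) = DS y" by (simp_all add: S_def DS_def)
    have "(\<Sum>x\<in>C. \<zeta> x y) = (\<Sum>x\<in>C. \<beta> x y) * inverse (S y)"
      by (simp add: \<zeta>_def sum_distrib_right)
    then have "(\<Sum>x\<in>C. \<zeta> x y) = 1" using S0 sums by simp
    moreover have "(\<Sum>x\<in>C. D\<zeta> x y) =
        (\<Sum>x\<in>C. \<beta> x y) *\<^sub>R (- (inverse (S y))\<^sup>2 *\<^sub>R DS y) + inverse (S y) *\<^sub>R (\<Sum>x\<in>C. D\<beta> x y)"
      by (simp only: D\<zeta>_def sum.distrib scaleR_sum_left scaleR_sum_right)
    then have "(\<Sum>x\<in>C. D\<zeta> x y) = 0" using S0 sums by (simp add: power2_eq_square)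
    ultimately show ?thesis
      by (simp add: sum.distrib sum_distrib_right[symmetric] inner_sum_right[symmetric])
  qed
  have "0 = (\<Sum>x\<in>C. LINT y:\<Omega>|lborel. \<zeta> x y * dv y + X y \<bullet> D\<zeta> x y)" using z by simp
  also have "\<dots> = (\<integral>y. (\<Sum>x\<in>C. indicator \<Omega> y *\<^sub>R (\<zeta> x y * dv y + X y \<bullet> D\<zeta> x y)) \<partial>lborel)"
    unfolding set_lebesgue_integral_def using int unfolding set_integrable_def
    by (intro Bochner_Integration.integral_sum[symmetric]) auto
  also have "\<dots> = (LINT y:\<Omega>|lborel. dv y)"
    unfolding set_lebesgue_integral_def scaleR_sum_right[symmetric]
    by (intro Bochner_Integration.integral_cong refl) (auto simp: indicator_def sum1)
  finally show ?thesis by (simp add: dv_def)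
qed

section \<open>Green's identity under the Neumann condition\<close>

text \<open>The extended partial derivatives of \<open>w\<close> form a continuous field \<open>P\<close> on the closure which is the gradient
  inside; its divergence is the Laplacian and its normal component on the boundary is the normal
  derivative.\<close>

lemma Ck_closure_2_gradient:
  fixes w :: "'a::euclidean_space \<Rightarrow> real"
  assumes op: "open \<Omega>" and bd: "bounded \<Omega>" and w: "Ck_closure 2 \<Omega> w"
  obtains P P' where "continuous_on (closure \<Omega>) P"
    and "\<And>x. x \<in> \<Omega> \<Longrightarrow> GDERIV w x :> P x"
    and "\<And>x. x \<in> \<Omega> \<Longrightarrow> (P has_derivative P' x) (at x)"
    and "\<And>x. x \<in> \<Omega> \<Longrightarrow> (\<Sum>b\<in>Basis. P' x b \<bullet> b) = laplacian w x"
    and "continuous_on \<Omega> (laplacian w)"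
    and "\<exists>B. \<forall>x\<in>\<Omega>. \<forall>b\<in>Basis. \<bar>P' x b \<bullet> b\<bar> \<le> B"
    and "\<And>x. x \<in> frontier \<Omega> \<Longrightarrow> normal_deriv \<Omega> w x = P x \<bullet> outward_unit_normal \<Omega> x"
proof -
  have ext: "Ck_extendable (Suc (Suc 0)) \<Omega> w"
    using w by (simp add: Ck_closure_def numeral_2_eq_2)
  have wd: "w differentiable (at x)" if "x \<in> \<Omega>" for x using ext that by simp
  have ext1: "Ck_extendable (Suc 0) \<Omega> (partial_deriv b w)" if "b \<in> Basis" for b
    using ext that by simp
  have "\<forall>b\<in>Basis. \<exists>F. continuous_on (closure \<Omega>) F \<and> (\<forall>x\<in>\<Omega>. F x = partial_deriv b w x)"
    using ext1 by simp
  from bchoice[OF this] obtain p where p: "\<And>b. b \<in> Basis \<Longrightarrow> continuous_on (closure \<Omega>) (p b)"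
    "\<And>b x. b \<in> Basis \<Longrightarrow> x \<in> \<Omega> \<Longrightarrow> p b x = partial_deriv b w x" by blast
  have pd: "partial_deriv b w differentiable (at x)" if "b \<in> Basis" "x \<in> \<Omega>" for b x
    using ext1[OF that(1)] that(2) by simp
  have ext0: "Ck_extendable 0 \<Omega> (partial_deriv b' (partial_deriv b w))"
    if "b \<in> Basis" "b' \<in> Basis" for b b' using ext1[OF that(1)] that(2) by (metis Ck_extendable.simps(2))
  have "\<forall>b\<in>Basis. \<exists>F. continuous_on (closure \<Omega>) F \<and> (\<forall>x\<in>\<Omega>. F x = partial_deriv b (partial_deriv b w) x)"
    using ext0 by simp
  from bchoice[OF this] obtain q where q: "\<And>b. b \<in> Basis \<Longrightarrow> continuous_on (closure \<Omega>) (q b)"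
    "\<And>b x. b \<in> Basis \<Longrightarrow> x \<in> \<Omega> \<Longrightarrow> q b x = partial_deriv b (partial_deriv b w) x" by blast
  define P where "P = (\<lambda>x. \<Sum>b\<in>Basis. p b x *\<^sub>R b)"
  define P' where "P' = (\<lambda>x v. \<Sum>b\<in>Basis. frechet_derivative (partial_deriv b w) (at x) v *\<^sub>R b)"
  have P'b: "P' x b \<bullet> b = partial_deriv b (partial_deriv b w) x" if "b \<in> Basis" for x b
    using that by (simp add: P'_def partial_deriv_def inner_sum_left inner_Basis if_distrib cong: if_cong)
  show ?thesis
  proof
    show "continuous_on (closure \<Omega>) P" unfolding P_def by (intro continuous_intros p)
    show "GDERIV w x :> P x" if x: "x \<in> \<Omega>" for x
      using GDERIV_partial_derivs[OF wd[OF x]] p(2)[OF _ x] by (simp add: P_def)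
    show "(P has_derivative P' x) (at x)" if x: "x \<in> \<Omega>" for x
    proof -
      have "((\<lambda>x. \<Sum>b\<in>Basis. partial_deriv b w x *\<^sub>R b) has_derivative P' x) (at x)"
        unfolding P'_def
        by (intro has_derivative_sum has_derivative_scaleR_left)
          (use pd[OF _ x] frechet_derivative_works in blast)
      then show ?thesis
        by (rule has_derivative_transform_within_open[OF _ op x]) (simp add: P_def p(2))
    qed
    show "(\<Sum>b\<in>Basis. P' x b \<bullet> b) = laplacian w x" if "x \<in> \<Omega>" for x
      by (simp add: P'b laplacian_def)
    have "continuous_on \<Omega> (\<lambda>x. \<Sum>b\<in>Basis. q b x)"
      by (intro continuous_intros continuous_on_subset[OF q(1) closure_subset])
    then show "continuous_on \<Omega> (laplacian w)"
      by (rule continuous_on_eq) (simp add: laplacian_def q(2))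
    have "\<exists>B. \<forall>x\<in>closure \<Omega>. \<bar>q b x\<bar> \<le> B" if "b \<in> Basis" for b
    proof -
      have "compact (closure \<Omega>)" using bd by simp
      from continuous_on_compact_norm_bound[OF this q(1)[OF that]] show ?thesis
        by (metis real_norm_def)
    qed
    then have "\<forall>b\<in>Basis. \<exists>B. \<forall>x\<in>closure \<Omega>. \<bar>q b x\<bar> \<le> B" by blast
    from bchoice[OF this] obtain B where B: "\<And>b x. b \<in> Basis \<Longrightarrow> x \<in> closure \<Omega> \<Longrightarrow> \<bar>q b x\<bar> \<le> B b"
      by blast
    show "\<exists>B. \<forall>x\<in>\<Omega>. \<forall>b\<in>Basis. \<bar>P' x b \<bullet> b\<bar> \<le> B"
    proof (intro exI ballI)
      fix x and b :: 'a assume x: "x \<in> \<Omega>" and b: "b \<in> Basis"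
      have "\<bar>P' x b \<bullet> b\<bar> \<le> B b" using B[OF b, of x] x closure_subset by (auto simp: P'b b q(2))
      also have "B b \<le> (\<Sum>b\<in>Basis. \<bar>B b\<bar>)"
        using member_le_sum[OF b, of "\<lambda>b. \<bar>B b\<bar>"] by simp
      finally show "\<bar>P' x b \<bullet> b\<bar> \<le> (\<Sum>b\<in>Basis. \<bar>B b\<bar>)" .
    qed
    show "normal_deriv \<Omega> w x = P x \<bullet> outward_unit_normal \<Omega> x" if x: "x \<in> frontier \<Omega>" for x
    proof -
      have xc: "x \<in> closure \<Omega>" "x \<notin> \<Omega>" using x op by (auto simp: frontier_def interior_open)
      then have nt: "at x within \<Omega> \<noteq> bot"
        by (simp add: trivial_limit_within closure_def)
      have "Lim (at x within \<Omega>) (partial_deriv b w) = p b x" if b: "b \<in> Basis" for b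
      proof (rule tendsto_Lim[OF nt])
        have "(p b \<longlongrightarrow> p b x) (at x within \<Omega>)"
          using p(1)[OF b] xc closure_subset unfolding continuous_on_def by (blast intro: tendsto_within_subset)
        then show "(partial_deriv b w \<longlongrightarrow> p b x) (at x within \<Omega>)"
          by (rule Lim_transform_eventually) (use p(2)[OF b] in \<open>auto simp: eventually_at_filter\<close>)
      qed
      then show ?thesis
        by (simp add: normal_deriv_def P_def inner_sum_right inner_commute[of _ "outward_unit_normal \<Omega> x"]
            mult.commute)
    qed
  qed
qed

text \<open>The divergence theorem for \<open>\<Phi>(w) \<nabla>w\<close>, which has no boundary flux because \<open>\<nabla>w\<close> has none.\<close>

lemma Neumann_Green_identity:
  fixes w :: "'a::euclidean_space \<Rightarrow> real"
  assumes sbd: "smooth_bounded_domain \<Omega>" and w: "Ck_closure 2 \<Omega> w"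
    and neumann: "\<And>x. x \<in> frontier \<Omega> \<Longrightarrow> normal_deriv \<Omega> w x = 0"
  obtains P where "continuous_on (closure \<Omega>) P" "\<And>x. x \<in> \<Omega> \<Longrightarrow> GDERIV w x :> P x"
    "\<And>\<Phi> \<Phi>'. (\<And>s. (\<Phi> has_real_derivative \<Phi>' s) (at s)) \<Longrightarrow> continuous_on UNIV \<Phi>' \<Longrightarrow>
      (LINT x:\<Omega>|lborel. \<Phi>' (w x) * (P x \<bullet> P x) + \<Phi> (w x) * laplacian w x) = 0"
proof -
  have op: "open \<Omega>" and bd: "bounded \<Omega>" using sbd by (auto simp: smooth_bounded_domain_def)
  have comp: "compact (closure \<Omega>)" using bd by simp
  have wc: "continuous_on (closure \<Omega>) w" using w by (simp add: Ck_closure_def)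
  obtain P P' where Pc: "continuous_on (closure \<Omega>) P"
    and wP: "\<And>x. x \<in> \<Omega> \<Longrightarrow> GDERIV w x :> P x"
    and P': "\<And>x. x \<in> \<Omega> \<Longrightarrow> (P has_derivative P' x) (at x)"
    and lap: "\<And>x. x \<in> \<Omega> \<Longrightarrow> (\<Sum>b\<in>Basis. P' x b \<bullet> b) = laplacian w x"
    and lapc: "continuous_on \<Omega> (laplacian w)"
    and P'bd: "\<exists>B. \<forall>x\<in>\<Omega>. \<forall>b\<in>Basis. \<bar>P' x b \<bullet> b\<bar> \<le> B"
    and nd: "\<And>x. x \<in> frontier \<Omega> \<Longrightarrow> normal_deriv \<Omega> w x = P x \<bullet> outward_unit_normal \<Omega> x"
    using Ck_closure_2_gradient[OF op bd w] by blast
  obtain B where B: "\<And>x b. x \<in> \<Omega> \<Longrightarrow> b \<in> Basis \<Longrightarrow> \<bar>P' x b \<bullet> b\<bar> \<le> B" using P'bd by blast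
  show ?thesis
  proof (rule that[OF Pc wP])
    fix \<Phi> \<Phi>' :: "real \<Rightarrow> real"
    assume \<Phi>: "\<And>s. (\<Phi> has_real_derivative \<Phi>' s) (at s)" and \<Phi>'c: "continuous_on UNIV \<Phi>'"
    define X' where "X' = (\<lambda>x v. \<Phi> (w x) *\<^sub>R P' x v + (v \<bullet> (\<Phi>' (w x) *\<^sub>R P x)) *\<^sub>R P x)"
    have \<Phi>c: "continuous_on UNIV \<Phi>" using \<Phi> DERIV_isCont by (blast intro: continuous_at_imp_continuous_on)
    have c1: "continuous_on (closure \<Omega>) (\<lambda>x. \<Phi> (w x))" "continuous_on (closure \<Omega>) (\<lambda>x. \<Phi>' (w x))"
      by (rule continuous_on_compose2[OF \<Phi>c wc] continuous_on_compose2[OF \<Phi>'c wc]; simp)+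
    have div: "(\<Sum>b\<in>Basis. X' x b \<bullet> b) = \<Phi>' (w x) * (P x \<bullet> P x) + \<Phi> (w x) * laplacian w x"
      if x: "x \<in> \<Omega>" for x
    proof -
      have "P x \<bullet> P x = (\<Sum>b\<in>Basis. (b \<bullet> P x) * (P x \<bullet> b))"
        by (subst euclidean_inner) (simp add: inner_commute mult.commute)
      then show ?thesis using lap[OF x, symmetric]
        by (simp add: X'_def inner_add_left sum.distrib sum_distrib_left mult.assoc)
    qed
    obtain M1 where M1: "\<And>x. x \<in> closure \<Omega> \<Longrightarrow> norm (\<Phi> (w x)) \<le> M1"
      using continuous_on_compact_norm_bound[OF comp c1(1)] by blast
    have "continuous_on (closure \<Omega>) (\<lambda>x. \<Phi>' (w x) * (norm (P x))\<^sup>2)"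
      by (intro continuous_intros c1 Pc)
    from continuous_on_compact_norm_bound[OF comp this]
    obtain M2 where M2: "\<And>x. x \<in> closure \<Omega> \<Longrightarrow> norm (\<Phi>' (w x) * (norm (P x))\<^sup>2) \<le> M2" by blast
    have "(LINT x:\<Omega>|lborel. (\<Sum>b\<in>Basis. X' x b \<bullet> b)) = 0"
    proof (rule integral_divergence_zero_flux[OF sbd])
      show "continuous_on (closure \<Omega>) (\<lambda>x. \<Phi> (w x) *\<^sub>R P x)" by (intro continuous_intros c1 Pc)
      show "((\<lambda>x. \<Phi> (w x) *\<^sub>R P x) has_derivative X' x) (at x)" if x: "x \<in> \<Omega>" for x
        using GDERIV_DERIV_compose[OF wP[OF x] \<Phi>] P'[OF x] unfolding X'_def gderiv_def
        by (rule has_derivative_scaleR)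
      show "\<bar>X' x b \<bullet> b\<bar> \<le> M1 * B + M2" if x: "x \<in> \<Omega>" and b: "b \<in> Basis" for x b
      proof -
        have xc: "x \<in> closure \<Omega>" using x closure_subset by blast
        have "\<bar>\<Phi> (w x) * (P' x b \<bullet> b)\<bar> \<le> M1 * B"
          unfolding abs_mult using M1[OF xc] B[OF x b] by (intro mult_mono) auto
        moreover have "\<bar>\<Phi>' (w x) * ((b \<bullet> P x) * (P x \<bullet> b))\<bar> \<le> M2"
        proof -
          have "\<bar>b \<bullet> P x\<bar> * \<bar>P x \<bullet> b\<bar> \<le> norm (P x) * norm (P x)"
            using Basis_le_norm[OF b, of "P x"] by (intro mult_mono) (auto simp: inner_commute)
          then have "\<bar>\<Phi>' (w x)\<bar> * (\<bar>b \<bullet> P x\<bar> * \<bar>P x \<bullet> b\<bar>) \<le> \<bar>\<Phi>' (w x)\<bar> * (norm (P x))\<^sup>2"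
            by (intro mult_left_mono) (auto simp: power2_eq_square)
          then show ?thesis using M2[OF xc] by (simp add: abs_mult)
        qed
        ultimately show ?thesis by (simp add: X'_def inner_add_left mult.assoc)
      qed
      have "continuous_on \<Omega> (\<lambda>x. \<Phi>' (w x) * (P x \<bullet> P x) + \<Phi> (w x) * laplacian w x)"
        by (intro continuous_intros lapc continuous_on_subset[OF _ closure_subset[of \<Omega>]] c1 Pc)
      then show "continuous_on \<Omega> (\<lambda>x. \<Sum>b\<in>Basis. X' x b \<bullet> b)"
        by (rule continuous_on_eq) (simp add: div)
      show "(\<Phi> (w x) *\<^sub>R P x) \<bullet> outward_unit_normal \<Omega> x = 0" if "x \<in> frontier \<Omega>" for x
        using neumann[OF that] nd[OF that] by simp
    qed
    also have "(LINT x:\<Omega>|lborel. (\<Sum>b\<in>Basis. X' x b \<bullet> b)) =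
        (LINT x:\<Omega>|lborel. \<Phi>' (w x) * (P x \<bullet> P x) + \<Phi> (w x) * laplacian w x)"
      unfolding set_lebesgue_integral_def
      by (intro Bochner_Integration.integral_cong refl) (auto simp: indicator_def div)
    finally show "(LINT x:\<Omega>|lborel. \<Phi>' (w x) * (P x \<bullet> P x) + \<Phi> (w x) * laplacian w x) = 0" .
  qed
qed

section \<open>The Poincare inequality\<close>

definition sq_oscillation :: "('a::euclidean_space \<Rightarrow> real) \<Rightarrow> 'a set \<Rightarrow> 'a set \<Rightarrow> ennreal"
  where "sq_oscillation w A B =
    (\<integral>\<^sup>+x. (\<integral>\<^sup>+y. indicator A x * indicator B y * ennreal ((w x - w y)\<^sup>2) \<partial>lborel) \<partial>lborel)"

definition dirichlet_energy :: "'a::euclidean_space set \<Rightarrow> ('a \<Rightarrow> 'a) \<Rightarrow> ennreal"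
  where "dirichlet_energy \<Omega> P = (\<integral>\<^sup>+x. indicator \<Omega> x * ennreal ((norm (P x))\<^sup>2) \<partial>lborel)"

text \<open>Global Borel measurability is a normalization: only values on \<open>\<Omega>\<close> matter, and extending by zero
  achieves it while making all the integrands below measurable on the whole space.\<close>

definition C1_with_gradient :: "'a::euclidean_space set \<Rightarrow> ('a \<Rightarrow> real) \<Rightarrow> ('a \<Rightarrow> 'a) \<Rightarrow> bool"
  where "C1_with_gradient \<Omega> w P \<longleftrightarrow> w \<in> borel_measurable borel \<and> P \<in> borel_measurable borel \<and>
    continuous_on \<Omega> P \<and> (\<forall>x\<in>\<Omega>. GDERIV w x :> P x)"

text \<open>A Poincare inequality between two sets, with a constant that does not depend on the function.
  The energy is always that of all of \<open>\<Omega>\<close>, so that bounds for different pairs of sets can be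
  added.\<close>

definition oscillation_controlled :: "'a::euclidean_space set \<Rightarrow> 'a set \<Rightarrow> 'a set \<Rightarrow> bool"
  where "oscillation_controlled \<Omega> A B \<longleftrightarrow> (\<exists>C\<ge>0. \<forall>w P. C1_with_gradient \<Omega> w P \<longrightarrow>
    sq_oscillation w A B \<le> ennreal C * dirichlet_energy \<Omega> P)"

lemma controlledE:
  assumes "oscillation_controlled \<Omega> A B"
  obtains C where "C \<ge> 0"
    "\<And>w P. C1_with_gradient \<Omega> w P \<Longrightarrow> sq_oscillation w A B \<le> ennreal C * dirichlet_energy \<Omega> P"
  using assms unfolding oscillation_controlled_def by blast

lemma nn_integral_lborel_translate:
  fixes f :: "'a::euclidean_space \<Rightarrow> ennreal"
  assumes [measurable]: "f \<in> borel_measurable borel"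
  shows "(\<integral>\<^sup>+x. f (x + c) \<partial>lborel) = (\<integral>\<^sup>+x. f x \<partial>lborel)"
proof -
  have "(\<integral>\<^sup>+x. f x \<partial>(distr lborel borel ((+) c))) = (\<integral>\<^sup>+x. f (c + x) \<partial>lborel)"
    by (rule nn_integral_distr) auto
  then show ?thesis by (simp add: lborel_distr_plus add.commute)
qed

lemma square_diff_le: "((a::real) - c)\<^sup>2 \<le> 2 * (a - b)\<^sup>2 + 2 * (b - c)\<^sup>2"
proof -
  have "2 * (a - b)\<^sup>2 + 2 * (b - c)\<^sup>2 - (a - c)\<^sup>2 = (a - 2 * b + c)\<^sup>2"
    by (simp add: power2_eq_square algebra_simps)
  then show ?thesis using zero_le_power2[of "a - 2 * b + c"] by linarith
qed

text \<open>With \<open>m\<close> the increment and \<open>g\<close> the derivative along the segment, \<open>m\<^sup>2 = \<integral> (2 m g - m\<^sup>2) \<le> \<integral> g\<^sup>2\<close>; this form of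
  the Cauchy-Schwarz inequality uses only the fundamental theorem of calculus and \<open>(g - m)\<^sup>2 \<ge> 0\<close>.\<close>

lemma increment_square_le:
  assumes w: "C1_with_gradient \<Omega> w P" and seg: "\<And>t. 0 \<le> t \<Longrightarrow> t \<le> 1 \<Longrightarrow> x + t *\<^sub>R z \<in> \<Omega>"
  shows "ennreal ((w (x + z) - w x)\<^sup>2) \<le>
    ennreal ((norm z)\<^sup>2) * (\<integral>\<^sup>+t. indicator {0..1} t * ennreal ((norm (P (x + t *\<^sub>R z)))\<^sup>2) \<partial>lborel)"
proof -
  have Pc: "continuous_on \<Omega> P" and wP: "\<And>y. y \<in> \<Omega> \<Longrightarrow> GDERIV w y :> P y"
    using w by (auto simp: C1_with_gradient_def)
  define m where "m = w (x + z) - w x"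
  define g where "g = (\<lambda>t. z \<bullet> P (x + t *\<^sub>R z))"
  define q where "q = (\<lambda>t. (norm (P (x + t *\<^sub>R z)))\<^sup>2)"
  have Pxc: "continuous_on {0..1} (\<lambda>t. P (x + t *\<^sub>R z))"
    by (rule continuous_on_compose2[OF Pc]) (use seg in \<open>auto intro!: continuous_intros\<close>)
  have qc: "continuous_on {0..1} q" unfolding q_def by (intro continuous_intros Pxc)
  have "((\<lambda>t. 2 * m * g t - m\<^sup>2) has_integral
      (2 * m * w (x + 1 *\<^sub>R z) - m\<^sup>2 * 1) - (2 * m * w (x + 0 *\<^sub>R z) - m\<^sup>2 * 0)) {0..1}"
  proof (rule fundamental_theorem_of_calculus)
    fix t :: real assume t: "t \<in> {0..1}"
    have d: "((\<lambda>t. x + t *\<^sub>R z) has_derivative (\<lambda>s. s *\<^sub>R z)) (at t)"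
      by (auto intro!: derivative_eq_intros)
    have "(w has_derivative (\<lambda>v. v \<bullet> P (x + t *\<^sub>R z))) (at (x + t *\<^sub>R z))"
      using wP seg t by (simp add: gderiv_def)
    from has_derivative_compose[OF d this]
    have "((\<lambda>t. w (x + t *\<^sub>R z)) has_real_derivative g t) (at t)"
      by (simp add: has_field_derivative_def g_def mult.commute[of _ "z \<bullet> _"] mult_commute_abs)
    then have "((\<lambda>t. 2 * m * w (x + t *\<^sub>R z) - m\<^sup>2 * t) has_real_derivative 2 * m * g t - m\<^sup>2) (at t)"
      by (auto intro!: derivative_eq_intros)
    then show "((\<lambda>t. 2 * m * w (x + t *\<^sub>R z) - m\<^sup>2 * t) has_vector_derivative 2 * m * g t - m\<^sup>2)
        (at t within {0..1})"
      by (simp add: has_real_derivative_iff_has_vector_derivative has_vector_derivative_at_within)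
  qed simp
  moreover have "(2 * m * w (x + 1 *\<^sub>R z) - m\<^sup>2 * 1) - (2 * m * w (x + 0 *\<^sub>R z) - m\<^sup>2 * 0) = m\<^sup>2"
    by (simp add: m_def power2_eq_square algebra_simps)
  ultimately have I: "((\<lambda>t. 2 * m * g t - m\<^sup>2) has_integral m\<^sup>2) {0..1}" by (simp only:)
  have qi: "q integrable_on {0..1}" using integrable_continuous_interval[OF qc] .
  have qI: "((\<lambda>t. (norm z)\<^sup>2 * q t) has_integral (norm z)\<^sup>2 * integral {0..1} q) {0..1}"
    by (intro has_integral_mult_right integrable_integral qi)
  have "m\<^sup>2 \<le> (norm z)\<^sup>2 * integral {0..1} q"
  proof (rule has_integral_le[OF I qI])
    fix t :: real
    have "2 * m * g t - m\<^sup>2 \<le> (g t)\<^sup>2"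
      using zero_le_power2[of "g t - m"] by (simp add: power2_eq_square algebra_simps)
    also have "(g t)\<^sup>2 \<le> (norm z * norm (P (x + t *\<^sub>R z)))\<^sup>2"
      unfolding g_def by (rule power2_le_iff_abs_le[THEN iffD2]) (auto simp: Cauchy_Schwarz_ineq2)
    finally show "2 * m * g t - m\<^sup>2 \<le> (norm z)\<^sup>2 * q t" by (simp add: q_def power_mult_distrib)
  qed
  moreover have "(\<integral>\<^sup>+t. indicator {0..1} t * ennreal (q t) \<partial>lborel) = ennreal (integral {0..1} q)"
    using nn_integral_has_integral_lebesgue'[OF _ integrable_integral[OF qi]]
    by (simp add: q_def mult.commute)
  ultimately show ?thesis
    by (simp add: m_def q_def ennreal_mult'[symmetric] ennreal_leI)
qed

text \<open>Integrate the bound along the segments \<open>x + t z\<close> over \<open>x\<close> first: for each \<open>t\<close> translation invariance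
  leaves at most the total energy.\<close>

lemma translate_difference_le:
  assumes w: "C1_with_gradient \<Omega> w P" and op: "open \<Omega>" and A[measurable]: "A \<in> sets borel"
    and seg: "\<And>x t. x \<in> A \<Longrightarrow> 0 \<le> t \<Longrightarrow> t \<le> 1 \<Longrightarrow> x + t *\<^sub>R z \<in> \<Omega>"
  shows "(\<integral>\<^sup>+x. indicator A x * ennreal ((w (x + z) - w x)\<^sup>2) \<partial>lborel)
    \<le> ennreal ((norm z)\<^sup>2) * dirichlet_energy \<Omega> P"
proof -
  have [measurable]: "w \<in> borel_measurable borel" "P \<in> borel_measurable borel" "\<Omega> \<in> sets borel"
    using w op by (auto simp: C1_with_gradient_def)
  let ?g = "\<lambda>y. indicator \<Omega> y * ennreal ((norm (P y))\<^sup>2)"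
  have "(\<integral>\<^sup>+x. indicator A x * ennreal ((w (x + z) - w x)\<^sup>2) \<partial>lborel)
    \<le> (\<integral>\<^sup>+x. ennreal ((norm z)\<^sup>2) * (\<integral>\<^sup>+t. indicator {0..1::real} t * ?g (x + t *\<^sub>R z) \<partial>lborel) \<partial>lborel)"
  proof (rule nn_integral_mono)
    fix x :: 'a
    show "indicator A x * ennreal ((w (x + z) - w x)\<^sup>2)
      \<le> ennreal ((norm z)\<^sup>2) * (\<integral>\<^sup>+t. indicator {0..1::real} t * ?g (x + t *\<^sub>R z) \<partial>lborel)"
    proof (cases "x \<in> A")
      case True
      have "ennreal ((w (x + z) - w x)\<^sup>2) \<le> ennreal ((norm z)\<^sup>2) *
          (\<integral>\<^sup>+t. indicator {0..1} t * ennreal ((norm (P (x + t *\<^sub>R z)))\<^sup>2) \<partial>lborel)"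
        by (rule increment_square_le[OF w]) (use seg True in auto)
      also have "(\<integral>\<^sup>+t. indicator {0..1} t * ennreal ((norm (P (x + t *\<^sub>R z)))\<^sup>2) \<partial>lborel)
          = (\<integral>\<^sup>+t. indicator {0..1::real} t * ?g (x + t *\<^sub>R z) \<partial>lborel)"
        by (intro nn_integral_cong) (use seg True in \<open>auto simp: indicator_def\<close>)
      finally show ?thesis using True by simp
    qed simp
  qed
  also have "\<dots> = ennreal ((norm z)\<^sup>2) *
      (\<integral>\<^sup>+x. (\<integral>\<^sup>+t. indicator {0..1::real} t * ?g (x + t *\<^sub>R z) \<partial>lborel) \<partial>lborel)"
    by (intro nn_integral_cmult) measurable
  also have "(\<integral>\<^sup>+x. (\<integral>\<^sup>+t. indicator {0..1::real} t * ?g (x + t *\<^sub>R z) \<partial>lborel) \<partial>lborel)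
      = (\<integral>\<^sup>+t. (\<integral>\<^sup>+x. indicator {0..1::real} t * ?g (x + t *\<^sub>R z) \<partial>lborel) \<partial>lborel)"
    by (rule lborel_pair.Fubini'[symmetric]) measurable
  also have "\<dots> = (\<integral>\<^sup>+t. indicator {0..1::real} t * dirichlet_energy \<Omega> P \<partial>lborel)"
  proof (rule nn_integral_cong)
    fix t :: real
    have "(\<integral>\<^sup>+x. indicator {0..1::real} t * ?g (x + t *\<^sub>R z) \<partial>lborel)
        = indicator {0..1::real} t * (\<integral>\<^sup>+x. ?g (x + t *\<^sub>R z) \<partial>lborel)"
      by (intro nn_integral_cmult) measurable
    also have "(\<integral>\<^sup>+x. ?g (x + t *\<^sub>R z) \<partial>lborel) = dirichlet_energy \<Omega> P"
      unfolding dirichlet_energy_def by (rule nn_integral_lborel_translate) measurable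
    finally show "(\<integral>\<^sup>+x. indicator {0..1::real} t * ?g (x + t *\<^sub>R z) \<partial>lborel)
        = indicator {0..1::real} t * dirichlet_energy \<Omega> P" .
  qed
  also have "\<dots> = dirichlet_energy \<Omega> P" by (simp add: nn_integral_multc)
  finally show ?thesis .
qed

lemma controlled_mono:
  assumes "oscillation_controlled \<Omega> A B" "A' \<subseteq> A" "B' \<subseteq> B"
  shows "oscillation_controlled \<Omega> A' B'"
proof -
  obtain C where C: "C \<ge> 0"
    "\<And>w P. C1_with_gradient \<Omega> w P \<Longrightarrow> sq_oscillation w A B \<le> ennreal C * dirichlet_energy \<Omega> P"
    using controlledE[OF assms(1)] by blast
  have "sq_oscillation w A' B' \<le> sq_oscillation w A B" for w
    unfolding sq_oscillation_def using assms(2,3)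
    by (intro nn_integral_mono mult_right_mono mult_mono) (auto simp: indicator_def)
  then show ?thesis using C unfolding oscillation_controlled_def by (meson order_trans)
qed

lemma controlled_sym:
  assumes [measurable]: "A \<in> sets borel" "B \<in> sets borel" and AB: "oscillation_controlled \<Omega> A B"
  shows "oscillation_controlled \<Omega> B A"
proof -
  have "sq_oscillation w B A = sq_oscillation w A B" if "C1_with_gradient \<Omega> w P" for w P
  proof -
    have [measurable]: "w \<in> borel_measurable borel" using that by (simp add: C1_with_gradient_def)
    have "sq_oscillation w B A =
      (\<integral>\<^sup>+y. (\<integral>\<^sup>+x. indicator B x * indicator A y * ennreal ((w x - w y)\<^sup>2) \<partial>lborel) \<partial>lborel)"
      unfolding sq_oscillation_def by (rule lborel_pair.Fubini'[symmetric]) measurable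
    then show ?thesis
      unfolding sq_oscillation_def by (simp add: power2_commute mult.commute)
  qed
  then show ?thesis using AB unfolding oscillation_controlled_def by metis
qed

lemma controlled_Un:
  assumes [measurable]: "A \<in> sets borel" "A' \<in> sets borel" "B \<in> sets borel"
    and "oscillation_controlled \<Omega> A B" "oscillation_controlled \<Omega> A' B"
  shows "oscillation_controlled \<Omega> (A \<union> A') B"
proof -
  obtain C where C: "C \<ge> 0"
    "\<And>w P. C1_with_gradient \<Omega> w P \<Longrightarrow> sq_oscillation w A B \<le> ennreal C * dirichlet_energy \<Omega> P"
    using controlledE[OF assms(4)] by blast
  obtain C' where C': "C' \<ge> 0"
    "\<And>w P. C1_with_gradient \<Omega> w P \<Longrightarrow> sq_oscillation w A' B \<le> ennreal C' * dirichlet_energy \<Omega> P"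
    using controlledE[OF assms(5)] by blast
  have "sq_oscillation w (A \<union> A') B \<le> ennreal (C + C') * dirichlet_energy \<Omega> P"
    if w: "C1_with_gradient \<Omega> w P" for w P
  proof -
    have [measurable]: "w \<in> borel_measurable borel" using w by (simp add: C1_with_gradient_def)
    have "sq_oscillation w (A \<union> A') B \<le>
      (\<integral>\<^sup>+x. (\<integral>\<^sup>+y. indicator A x * indicator B y * ennreal ((w x - w y)\<^sup>2) \<partial>lborel)
         + (\<integral>\<^sup>+y. indicator A' x * indicator B y * ennreal ((w x - w y)\<^sup>2) \<partial>lborel) \<partial>lborel)"
      unfolding sq_oscillation_def
      by (intro nn_integral_mono, subst nn_integral_add[symmetric])
        (auto intro!: nn_integral_mono simp: indicator_def)
    also have "\<dots> = sq_oscillation w A B + sq_oscillation w A' B"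
      unfolding sq_oscillation_def by (intro nn_integral_add) measurable
    also have "\<dots> \<le> ennreal C * dirichlet_energy \<Omega> P + ennreal C' * dirichlet_energy \<Omega> P"
      by (intro add_mono C C' w)
    also have "\<dots> = ennreal (C + C') * dirichlet_energy \<Omega> P"
      using C(1) C'(1) by (simp add: ennreal_plus distrib_right)
    finally show ?thesis .
  qed
  then show ?thesis unfolding oscillation_controlled_def using C(1) C'(1) by (intro exI[of _ "C + C'"]) auto
qed

lemma controlled_empty: "oscillation_controlled \<Omega> {} B"
  unfolding oscillation_controlled_def sq_oscillation_def by (intro exI[of _ 0]) auto

lemma controlled_UN:
  assumes "finite I" "\<And>i. i \<in> I \<Longrightarrow> A i \<in> sets borel" "B \<in> sets borel"
    "\<And>i. i \<in> I \<Longrightarrow> oscillation_controlled \<Omega> (A i) B"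
  shows "oscillation_controlled \<Omega> (\<Union>i\<in>I. A i) B"
  using assms
proof (induction I rule: finite_induct)
  case empty
  then show ?case by (simp add: controlled_empty)
next
  case (insert i I)
  have "oscillation_controlled \<Omega> (A i \<union> (\<Union>i\<in>I. A i)) B"
    by (rule controlled_Un) (use insert in \<open>auto intro!: sets.finite_UN\<close>)
  then show ?case by simp
qed

text \<open>Substituting \<open>y = x + z\<close> turns the double integral into one over shifts \<open>z\<close> of length at most the
  diameter, and convexity keeps the connecting segments inside.\<close>

lemma controlled_convex:
  assumes op: "open \<Omega>" and B: "open B" "convex B" "bounded B" "B \<subseteq> \<Omega>"
  shows "oscillation_controlled \<Omega> B B"
proof -
  obtain R where R: "\<And>x y. x \<in> B \<Longrightarrow> y \<in> B \<Longrightarrow> dist x y \<le> R"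
    using B(3) by (meson bounded_two_points)
  define V where "V = measure lborel (cball (0::'a) R)"
  have V: "emeasure lborel (cball (0::'a) R) = ennreal V"
    unfolding V_def by (rule emeasure_eq_ennreal_measure) (use emeasure_bounded_finite[of "cball (0::'a) R"] in auto)
  have [measurable]: "B \<in> sets borel" using B by auto
  have "sq_oscillation w B B \<le> ennreal (R\<^sup>2 * V) * dirichlet_energy \<Omega> P"
    if w: "C1_with_gradient \<Omega> w P" for w P
  proof -
    have [measurable]: "w \<in> borel_measurable borel" using w by (simp add: C1_with_gradient_def)
    let ?h = "\<lambda>x z. indicator B x * indicator B (x + z) * ennreal ((w x - w (x + z))\<^sup>2)"
    have "sq_oscillation w B B = (\<integral>\<^sup>+x. (\<integral>\<^sup>+z. ?h x z \<partial>lborel) \<partial>lborel)"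
      unfolding sq_oscillation_def
    proof (rule nn_integral_cong)
      fix x :: 'a
      have "(\<integral>\<^sup>+z. indicator B x * indicator B (z + x) * ennreal ((w x - w (z + x))\<^sup>2) \<partial>lborel)
          = (\<integral>\<^sup>+y. indicator B x * indicator B y * ennreal ((w x - w y)\<^sup>2) \<partial>lborel)"
        by (rule nn_integral_lborel_translate[where f = "\<lambda>y. indicator B x * indicator B y * ennreal ((w x - w y)\<^sup>2)"])
          measurable
      then show "(\<integral>\<^sup>+y. indicator B x * indicator B y * ennreal ((w x - w y)\<^sup>2) \<partial>lborel)
          = (\<integral>\<^sup>+z. ?h x z \<partial>lborel)" by (simp add: add.commute)
    qed
    also have "\<dots> = (\<integral>\<^sup>+z. (\<integral>\<^sup>+x. ?h x z \<partial>lborel) \<partial>lborel)"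
      by (rule lborel_pair.Fubini'[symmetric]) measurable
    also have "\<dots> \<le> (\<integral>\<^sup>+z. indicator (cball (0::'a) R) z * (ennreal (R\<^sup>2) * dirichlet_energy \<Omega> P) \<partial>lborel)"
    proof (rule nn_integral_mono)
      fix z :: 'a
      define A where "A = {x. x \<in> B \<and> x + z \<in> B}"
      have Am: "A \<in> sets borel" unfolding A_def by measurable
      have hA: "?h x z = indicator A x * ennreal ((w (x + z) - w x)\<^sup>2)" for x
        by (auto simp: A_def indicator_def power2_commute)
      show "(\<integral>\<^sup>+x. ?h x z \<partial>lborel) \<le> indicator (cball (0::'a) R) z * (ennreal (R\<^sup>2) * dirichlet_energy \<Omega> P)"
      proof (cases "A = {}")
        case False
        then obtain x where "x \<in> B" "x + z \<in> B" by (auto simp: A_def)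
        then have zR: "norm z \<le> R" using R[of x "x + z"] by (simp add: dist_norm)
        have "(\<integral>\<^sup>+x. indicator A x * ennreal ((w (x + z) - w x)\<^sup>2) \<partial>lborel)
            \<le> ennreal ((norm z)\<^sup>2) * dirichlet_energy \<Omega> P"
        proof (rule translate_difference_le[OF w op Am])
          fix x t assume x: "x \<in> A" and t: "(0::real) \<le> t" "t \<le> 1"
          have "(1 - t) *\<^sub>R x + t *\<^sub>R (x + z) \<in> B"
            using x t B(2) unfolding convex_alt A_def by blast
          then show "x + t *\<^sub>R z \<in> \<Omega>" using B(4) by (auto simp: algebra_simps)
        qed
        also have "\<dots> \<le> ennreal (R\<^sup>2) * dirichlet_energy \<Omega> P"
          using zR by (intro mult_right_mono ennreal_leI power_mono) auto
        finally show ?thesis using zR by (simp add: hA)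
      qed (simp add: hA)
    qed
    also have "\<dots> = ennreal V * (ennreal (R\<^sup>2) * dirichlet_energy \<Omega> P)"
      by (subst nn_integral_multc) (auto simp: V intro!: borel_measurable_indicator)
    also have "\<dots> = ennreal (R\<^sup>2 * V) * dirichlet_energy \<Omega> P"
      by (simp add: ennreal_mult V_def mult_ac)
    finally show ?thesis .
  qed
  then show ?thesis unfolding oscillation_controlled_def by (intro exI[of _ "R\<^sup>2 * V"]) (auto simp: V_def)
qed

text \<open>From \<open>(w x - w z)\<^sup>2 \<le> 2 (w x - w y)\<^sup>2 + 2 (w y - w z)\<^sup>2\<close>, averaged over \<open>y\<close> in the intermediate set \<open>B\<close>, which
  therefore must have positive measure.\<close>

lemma controlled_trans:
  assumes m[measurable]: "A \<in> sets borel" "B \<in> sets borel" "C \<in> sets borel"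
    and bd: "bounded A" "bounded B" "bounded C" and pos: "emeasure lborel B \<noteq> 0"
    and AB: "oscillation_controlled \<Omega> A B" and CB: "oscillation_controlled \<Omega> C B"
  shows "oscillation_controlled \<Omega> A C"
proof -
  obtain K1 where K1: "K1 \<ge> 0"
    "\<And>w P. C1_with_gradient \<Omega> w P \<Longrightarrow> sq_oscillation w A B \<le> ennreal K1 * dirichlet_energy \<Omega> P"
    using controlledE[OF AB] by blast
  obtain K2 where K2: "K2 \<ge> 0"
    "\<And>w P. C1_with_gradient \<Omega> w P \<Longrightarrow> sq_oscillation w C B \<le> ennreal K2 * dirichlet_energy \<Omega> P"
    using controlledE[OF CB] by blast
  define a where "a = measure lborel A"
  define b where "b = measure lborel B"
  define c where "c = measure lborel C"
  have em: "emeasure lborel A = ennreal a" "emeasure lborel B = ennreal b" "emeasure lborel C = ennreal c"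
    unfolding a_def b_def c_def using emeasure_bounded_finite[OF bd(1)]
      emeasure_bounded_finite[OF bd(2)] emeasure_bounded_finite[OF bd(3)]
    by (auto intro!: emeasure_eq_ennreal_measure)
  have abc: "a \<ge> 0" "c \<ge> 0" "b > 0" using pos em(2)
    by (auto simp: a_def b_def c_def zero_less_measure_iff emeasure_eq_ennreal_measure)
  have "sq_oscillation w A C \<le> ennreal ((2 * c * K1 + 2 * a * K2) / b) * dirichlet_energy \<Omega> P"
    if w: "C1_with_gradient \<Omega> w P" for w P
  proof -
    have [measurable]: "w \<in> borel_measurable borel" using w by (simp add: C1_with_gradient_def)
    let ?i = "\<lambda>x y z. indicator A x * indicator C z * indicator B y :: ennreal"
    let ?s = "\<lambda>x y. ennreal ((w x - w y)\<^sup>2)"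
    have "sq_oscillation w A C * ennreal b =
        (\<integral>\<^sup>+x. (\<integral>\<^sup>+z. (\<integral>\<^sup>+y. ?i x y z * ?s x z \<partial>lborel) \<partial>lborel) \<partial>lborel)"
    proof -
      have "(\<integral>\<^sup>+y. ?i x y z * ?s x z \<partial>lborel) = indicator A x * indicator C z * ?s x z * ennreal b" for x z
      proof -
        have "(\<integral>\<^sup>+y. ?i x y z * ?s x z \<partial>lborel)
          = (\<integral>\<^sup>+y. (indicator A x * indicator C z * ?s x z) * indicator B y \<partial>lborel)"
          by (intro nn_integral_cong) (simp add: mult_ac)
        then show ?thesis by (simp add: nn_integral_cmult em)
      qed
      then show ?thesis unfolding sq_oscillation_def by (simp add: nn_integral_multc)
    qed
    also have "\<dots> \<le> (\<integral>\<^sup>+x. (\<integral>\<^sup>+z. (\<integral>\<^sup>+y. ?i x y z * (2 * ?s x y) + ?i x y z * (2 * ?s z y) \<partial>lborel) \<partial>lborel) \<partial>lborel)"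
    proof (intro nn_integral_mono)
      fix x z y :: 'a
      have "?s x z \<le> ennreal (2 * (w x - w y)\<^sup>2 + 2 * (w z - w y)\<^sup>2)"
        using square_diff_le[of "w x" "w z" "w y"] by (intro ennreal_leI) (simp add: power2_commute)
      also have "\<dots> = 2 * ?s x y + 2 * ?s z y"
        by (simp add: ennreal_plus ennreal_mult)
      finally have "?i x y z * ?s x z \<le> ?i x y z * (2 * ?s x y + 2 * ?s z y)"
        by (rule mult_left_mono) simp
      then show "?i x y z * ?s x z \<le> ?i x y z * (2 * ?s x y) + ?i x y z * (2 * ?s z y)"
        by (simp only: distrib_left)
    qed
    also have "\<dots> = (\<integral>\<^sup>+x. (\<integral>\<^sup>+z. (\<integral>\<^sup>+y. ?i x y z * (2 * ?s x y) \<partial>lborel) \<partial>lborel) \<partial>lborel)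
        + (\<integral>\<^sup>+x. (\<integral>\<^sup>+z. (\<integral>\<^sup>+y. ?i x y z * (2 * ?s z y) \<partial>lborel) \<partial>lborel) \<partial>lborel)"
      by (simp add: nn_integral_add)
    also have "(\<integral>\<^sup>+x. (\<integral>\<^sup>+z. (\<integral>\<^sup>+y. ?i x y z * (2 * ?s x y) \<partial>lborel) \<partial>lborel) \<partial>lborel)
        = 2 * ennreal c * sq_oscillation w A B"
    proof -
      have "(\<integral>\<^sup>+z. (\<integral>\<^sup>+y. ?i x y z * (2 * ?s x y) \<partial>lborel) \<partial>lborel)
          = 2 * ennreal c * (\<integral>\<^sup>+y. indicator A x * indicator B y * ?s x y \<partial>lborel)" for x
      proof -
        have "(\<integral>\<^sup>+y. ?i x y z * (2 * ?s x y) \<partial>lborel)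
          = indicator C z * (2 * (\<integral>\<^sup>+y. indicator A x * indicator B y * ?s x y \<partial>lborel))" for z
          by (subst nn_integral_cmult[symmetric], simp, subst nn_integral_cmult[symmetric], simp)
            (auto intro!: nn_integral_cong simp: mult_ac)
        then show ?thesis by (simp add: nn_integral_multc em mult_ac)
      qed
      then show ?thesis unfolding sq_oscillation_def by (simp add: nn_integral_cmult)
    qed
    also have "(\<integral>\<^sup>+x. (\<integral>\<^sup>+z. (\<integral>\<^sup>+y. ?i x y z * (2 * ?s z y) \<partial>lborel) \<partial>lborel) \<partial>lborel)
        = 2 * ennreal a * sq_oscillation w C B"
    proof -
      have "(\<integral>\<^sup>+z. (\<integral>\<^sup>+y. ?i x y z * (2 * ?s z y) \<partial>lborel) \<partial>lborel)
          = indicator A x * (2 * sq_oscillation w C B)" for x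
        unfolding sq_oscillation_def
        by (subst nn_integral_cmult[symmetric], simp, subst nn_integral_cmult[symmetric], simp)
          (auto intro!: nn_integral_cong simp: mult_ac simp flip: nn_integral_cmult)
      then show ?thesis by (simp add: nn_integral_multc em mult_ac)
    qed
    also have "2 * ennreal c * sq_oscillation w A B + 2 * ennreal a * sq_oscillation w C B
      \<le> 2 * ennreal c * (ennreal K1 * dirichlet_energy \<Omega> P) + 2 * ennreal a * (ennreal K2 * dirichlet_energy \<Omega> P)"
      by (intro add_mono mult_left_mono K1 K2 w) auto
    also have "\<dots> = ennreal (2 * c * K1 + 2 * a * K2) * dirichlet_energy \<Omega> P"
      using abc K1(1) K2(1) by (simp add: ennreal_plus ennreal_mult distrib_right distrib_left mult_ac)
    finally have le: "sq_oscillation w A C * ennreal b \<le> ennreal (2 * c * K1 + 2 * a * K2) * dirichlet_energy \<Omega> P" .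
    have "sq_oscillation w A C = sq_oscillation w A C * ennreal b * ennreal (1 / b)"
      using abc by (simp add: mult.assoc ennreal_mult[symmetric])
    also have "\<dots> \<le> ennreal (2 * c * K1 + 2 * a * K2) * dirichlet_energy \<Omega> P * ennreal (1 / b)"
      by (intro mult_right_mono le) simp
    also have "\<dots> = ennreal (2 * c * K1 + 2 * a * K2) * ennreal (1 / b) * dirichlet_energy \<Omega> P"
      by (simp add: mult_ac)
    also have "ennreal (2 * c * K1 + 2 * a * K2) * ennreal (1 / b) = ennreal ((2 * c * K1 + 2 * a * K2) / b)"
      using abc K1(1) K2(1) by (simp add: ennreal_mult[symmetric] del: ennreal_plus)
    finally show ?thesis .
  qed
  then show ?thesis unfolding oscillation_controlled_def
    using abc K1(1) K2(1) by (intro exI[of _ "(2 * c * K1 + 2 * a * K2) / b"]) auto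
qed

text \<open>Control passes from \<open>V\<close> to a set \<open>U\<close> that can be pushed into \<open>V\<close> by a shift through \<open>\<Omega>\<close>.  This is what
  carries interior estimates up to the boundary.\<close>

lemma controlled_translate:
  assumes op: "open \<Omega>" and m[measurable]: "U \<in> sets borel" "V \<in> sets borel" "B \<in> sets borel"
    and bd: "bounded B"
    and seg: "\<And>x t. x \<in> U \<Longrightarrow> 0 \<le> t \<Longrightarrow> t \<le> 1 \<Longrightarrow> x + t *\<^sub>R z \<in> \<Omega>"
    and UV: "\<And>x. x \<in> U \<Longrightarrow> x + z \<in> V" and VB: "oscillation_controlled \<Omega> V B"
  shows "oscillation_controlled \<Omega> U B"
proof -
  obtain K where K: "K \<ge> 0"
    "\<And>w P. C1_with_gradient \<Omega> w P \<Longrightarrow> sq_oscillation w V B \<le> ennreal K * dirichlet_energy \<Omega> P"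
    using controlledE[OF VB] by blast
  define b where "b = measure lborel B"
  have em: "emeasure lborel B = ennreal b"
    unfolding b_def using emeasure_bounded_finite[OF bd] by (auto intro!: emeasure_eq_ennreal_measure)
  have b: "b \<ge> 0" by (simp add: b_def)
  have "sq_oscillation w U B \<le> ennreal (2 * b * (norm z)\<^sup>2 + 2 * K) * dirichlet_energy \<Omega> P"
    if w: "C1_with_gradient \<Omega> w P" for w P
  proof -
    have [measurable]: "w \<in> borel_measurable borel" using w by (simp add: C1_with_gradient_def)
    let ?s = "\<lambda>x y. ennreal ((w x - w y)\<^sup>2)"
    have "sq_oscillation w U B \<le>
      (\<integral>\<^sup>+x. (\<integral>\<^sup>+y. (2 * indicator U x * ennreal ((w (x + z) - w x)\<^sup>2)) * indicator B y
        + 2 * (indicator V (x + z) * indicator B y * ?s (x + z) y) \<partial>lborel) \<partial>lborel)"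
      unfolding sq_oscillation_def
    proof (intro nn_integral_mono)
      fix x y :: 'a
      have "?s x y \<le> ennreal (2 * (w (x + z) - w x)\<^sup>2 + 2 * (w (x + z) - w y)\<^sup>2)"
        using square_diff_le[of "w x" "w y" "w (x + z)"] by (intro ennreal_leI) (simp add: power2_commute)
      also have "\<dots> = 2 * ennreal ((w (x + z) - w x)\<^sup>2) + 2 * ?s (x + z) y"
        by (simp add: ennreal_plus ennreal_mult)
      finally show "indicator U x * indicator B y * ?s x y \<le>
        (2 * indicator U x * ennreal ((w (x + z) - w x)\<^sup>2)) * indicator B y
        + 2 * (indicator V (x + z) * indicator B y * ?s (x + z) y)"
        using UV by (auto simp: indicator_def)
    qed
    also have "\<dots> = (\<integral>\<^sup>+x. (\<integral>\<^sup>+y. (2 * indicator U x * ennreal ((w (x + z) - w x)\<^sup>2)) * indicator B y \<partial>lborel) \<partial>lborel)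
        + (\<integral>\<^sup>+x. (\<integral>\<^sup>+y. 2 * (indicator V (x + z) * indicator B y * ?s (x + z) y) \<partial>lborel) \<partial>lborel)"
      by (simp add: nn_integral_add)
    also have "(\<integral>\<^sup>+x. (\<integral>\<^sup>+y. (2 * indicator U x * ennreal ((w (x + z) - w x)\<^sup>2)) * indicator B y \<partial>lborel) \<partial>lborel)
      = 2 * ennreal b * (\<integral>\<^sup>+x. indicator U x * ennreal ((w (x + z) - w x)\<^sup>2) \<partial>lborel)"
    proof -
      have "(\<integral>\<^sup>+y. (2 * indicator U x * ennreal ((w (x + z) - w x)\<^sup>2)) * indicator B y \<partial>lborel)
          = 2 * ennreal b * (indicator U x * ennreal ((w (x + z) - w x)\<^sup>2))" for x
        by (subst nn_integral_cmult) (simp_all add: em mult_ac)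
      then show ?thesis by (simp add: nn_integral_cmult)
    qed
    also have "(\<integral>\<^sup>+x. (\<integral>\<^sup>+y. 2 * (indicator V (x + z) * indicator B y * ?s (x + z) y) \<partial>lborel) \<partial>lborel)
      = 2 * sq_oscillation w V B"
    proof -
      have "(\<integral>\<^sup>+x. (\<integral>\<^sup>+y. indicator V (x + z) * indicator B y * ?s (x + z) y \<partial>lborel) \<partial>lborel)
        = sq_oscillation w V B"
        unfolding sq_oscillation_def
        by (rule nn_integral_lborel_translate[where
              f = "\<lambda>x. \<integral>\<^sup>+y. indicator V x * indicator B y * ?s x y \<partial>lborel"]) measurable
      then show ?thesis by (simp add: nn_integral_cmult)
    qed
    also have "2 * ennreal b * (\<integral>\<^sup>+x. indicator U x * ennreal ((w (x + z) - w x)\<^sup>2) \<partial>lborel) + 2 * sq_oscillation w V B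
      \<le> 2 * ennreal b * (ennreal ((norm z)\<^sup>2) * dirichlet_energy \<Omega> P) + 2 * (ennreal K * dirichlet_energy \<Omega> P)"
      by (intro add_mono mult_left_mono K w translate_difference_le[OF w op m(1)] seg) auto
    also have "\<dots> = ennreal (2 * b * (norm z)\<^sup>2 + 2 * K) * dirichlet_energy \<Omega> P"
      using b K(1) by (simp add: ennreal_plus ennreal_mult distrib_right distrib_left mult_ac)
    finally show ?thesis .
  qed
  then show ?thesis unfolding oscillation_controlled_def
    using b K(1) by (intro exI[of _ "2 * b * (norm z)\<^sup>2 + 2 * K"]) auto
qed

text \<open>Being linked by small controlled balls is an equivalence relation on \<open>\<Omega>\<close>, and its classes are open
  because a ball controls itself; connectedness leaves one class.\<close>

lemma controlled_balls_of_connected: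
  assumes op: "open \<Omega>" and conn: "connected \<Omega>" and xy: "x \<in> \<Omega>" "y \<in> \<Omega>"
  shows "\<exists>r>0. ball x r \<subseteq> \<Omega> \<and> ball y r \<subseteq> \<Omega> \<and> oscillation_controlled \<Omega> (ball x r) (ball y r)"
proof -
  let ?R = "\<lambda>x y. \<exists>r>0. ball x r \<subseteq> \<Omega> \<and> ball y r \<subseteq> \<Omega> \<and> oscillation_controlled \<Omega> (ball x r) (ball y r)"
  show "?R x y"
  proof (rule connected_equivalence_relation[OF conn xy, of ?R])
    show "?R y x" if "?R x y" for x y
      using that controlled_sym[of "ball x _" "ball y _" \<Omega>] by auto
    show "?R x z" if R12: "?R x y" and R23: "?R y z" for x y z
    proof -
      obtain r where r: "r > 0" "ball x r \<subseteq> \<Omega>" "ball y r \<subseteq> \<Omega>" "oscillation_controlled \<Omega> (ball x r) (ball y r)"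
        using R12 by blast
      obtain s where s: "s > 0" "ball y s \<subseteq> \<Omega>" "ball z s \<subseteq> \<Omega>" "oscillation_controlled \<Omega> (ball y s) (ball z s)"
        using R23 by blast
      define m where "m = min r s"
      have m: "m > 0" "m \<le> r" "m \<le> s" using r s by (auto simp: m_def)
      have b: "ball u m \<subseteq> ball u r" "ball u m \<subseteq> ball u s" for u :: 'a using m by auto
      have 1: "oscillation_controlled \<Omega> (ball x m) (ball y m)" using controlled_mono[OF r(4) b(1) b(1)] .
      have "oscillation_controlled \<Omega> (ball y m) (ball z m)" using controlled_mono[OF s(4) b(2) b(2)] .
      then have 2: "oscillation_controlled \<Omega> (ball z m) (ball y m)" by (rule controlled_sym[rotated 2]) auto
      have "emeasure lborel (ball y m) \<noteq> 0"
        using m by (intro emeasure_lborel_open_nonzero) auto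
      then have "oscillation_controlled \<Omega> (ball x m) (ball z m)"
        using controlled_trans[OF _ _ _ _ _ _ _ 1 2] by simp
      moreover have "ball x m \<subseteq> \<Omega>" "ball z m \<subseteq> \<Omega>"
        using order_trans[OF b(1) r(2)] order_trans[OF b(2) s(3)] .
      ultimately show ?thesis using m(1) by metis
    qed
    fix a assume "a \<in> \<Omega>"
    then obtain r where r: "r > 0" "ball a r \<subseteq> \<Omega>" using op openE by blast
    have c: "oscillation_controlled \<Omega> (ball a r) (ball a r)"
      by (rule controlled_convex[OF op]) (use r in auto)
    have "?R a x" if "x \<in> ball a (r / 2)" for x
    proof -
      have s: "ball a (r / 2) \<subseteq> ball a r" "ball x (r / 2) \<subseteq> ball a r"
        using r that by (auto simp: subset_eq dist_commute intro: dist_triangle_half_l)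
      have "ball a (r / 2) \<subseteq> \<Omega>" "ball x (r / 2) \<subseteq> \<Omega>" using s r(2) by blast+
      then show ?thesis
        using controlled_mono[OF c s] r(1) half_gt_zero by metis
    qed
    then show "\<exists>T. openin (top_of_set \<Omega>) T \<and> a \<in> T \<and> (\<forall>x\<in>T. ?R a x)"
      using r by (intro exI[of _ "ball a (r / 2)"]) (auto intro!: open_subset)
  qed
qed

text \<open>In a graph chart the shift by \<open>-s e\<close> moves the part of \<open>\<Omega>\<close> near \<open>x\<close> into the compact set \<open>K\<close> at depth at
  least \<open>s\<close>, which is covered by finitely many interior balls.\<close>

lemma controlled_near_frontier:
  assumes sbd: "smooth_bounded_domain \<Omega>" and x: "x \<in> frontier \<Omega>"
    and B: "B \<in> sets borel" "bounded B"
    and loc: "\<And>y. y \<in> \<Omega> \<Longrightarrow> \<exists>r>0. oscillation_controlled \<Omega> (ball y r) B"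
  shows "\<exists>r>0. oscillation_controlled \<Omega> (\<Omega> \<inter> ball x r) B"
proof -
  have op: "open \<Omega>" using sbd by (simp add: smooth_bounded_domain_def)
  obtain r e h where lg: "local_graph \<Omega> x r e h"
    using smooth_bounded_domain_local_graph[OF sbd x] .
  let ?F = "graph_defect e h"
  note r = local_graph_pos[OF lg] and e = local_graph_unit[OF lg]
  \<comment> \<open>points within \<open>2 s\<close> of \<open>x\<close> stay within \<open>3 s < r\<close> during a shift of length \<open>s\<close>\<close>
  define s where "s = r / 4"
  have s: "s > 0" using r by (simp add: s_def)
  define K where "K = cball x (3 * s) \<inter> {y. ?F y \<le> -s}"
  have K: "compact K" unfolding K_def
    by (intro compact_Int_closed closed_Collect_le continuous_on_graph_defect local_graph_smooth[OF lg]) auto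
  have K\<Omega>: "K \<subseteq> \<Omega>" using mem_local_graph[OF lg] s by (force simp: K_def s_def)
  have "\<exists>r>0. oscillation_controlled \<Omega> (ball y r) B" if "y \<in> K" for y using loc K\<Omega> that by blast
  from compact_finite_ball_cover[where Q = "\<lambda>y r. oscillation_controlled \<Omega> (ball y r) B", OF K this]
  obtain C \<rho> where C: "finite C" "K \<subseteq> (\<Union>y\<in>C. ball y (\<rho> y))"
    and \<rho>: "\<forall>y\<in>C. \<rho> y > 0 \<and> oscillation_controlled \<Omega> (ball y (\<rho> y)) B" by blast
  define V where "V = (\<Union>y\<in>C. ball y (\<rho> y))"
  have V: "oscillation_controlled \<Omega> V B" unfolding V_def
    by (rule controlled_UN) (use C \<rho> B in auto)
  have shift: "y + t *\<^sub>R (- (s *\<^sub>R e)) \<in> cball x (3 * s) \<and> ?F (y + t *\<^sub>R (- (s *\<^sub>R e))) = ?F y - t * s"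
    if y: "y \<in> ball x (2 * s)" and t: "0 \<le> t" "t \<le> 1" for y t
  proof -
    have "dist y (y + t *\<^sub>R (- (s *\<^sub>R e))) = t * s" using t s e by (simp add: dist_norm)
    also have "\<dots> \<le> s" using t s by (simp add: mult_left_le_one_le)
    finally have "dist x (y + t *\<^sub>R (- (s *\<^sub>R e))) \<le> 3 * s"
      using y dist_triangle[of x "y + t *\<^sub>R (- (s *\<^sub>R e))" y] by simp
    then show ?thesis using graph_defect_shift[OF e, of h y "- (t * s)"] by simp
  qed
  have "oscillation_controlled \<Omega> (\<Omega> \<inter> ball x (2 * s)) B"
  proof (rule controlled_translate[OF op _ _ B _ _ V])
    show "V \<in> sets borel" unfolding V_def by (intro borel_open open_UN) auto
    show "\<Omega> \<inter> ball x (2 * s) \<in> sets borel" using op by auto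
    show "y + t *\<^sub>R (- (s *\<^sub>R e)) \<in> \<Omega>" if y: "y \<in> \<Omega> \<inter> ball x (2 * s)" and t: "0 \<le> t" "t \<le> 1" for y t
    proof -
      have "y \<in> ball x r" using y s by (auto simp: s_def)
      then have "?F y < 0" using mem_local_graph[OF lg] y by blast
      moreover have "t * s \<ge> 0" using t s by simp
      ultimately have "?F (y + t *\<^sub>R (- (s *\<^sub>R e))) < 0" using shift[of y t] y t by auto
      moreover have "y + t *\<^sub>R (- (s *\<^sub>R e)) \<in> ball x r" using shift[of y t] y t s by (auto simp: s_def)
      ultimately show ?thesis using mem_local_graph[OF lg] by blast
    qed
    show "y + - (s *\<^sub>R e) \<in> V" if y: "y \<in> \<Omega> \<inter> ball x (2 * s)" for y
    proof -
      have "y \<in> ball x r" using y s by (auto simp: s_def)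
      then have "?F y < 0" using mem_local_graph[OF lg] y by blast
      then have "y + - (s *\<^sub>R e) \<in> K" using shift[of y 1] y by (simp add: K_def)
      then show ?thesis using C(2) unfolding V_def by blast
    qed
  qed
  then show ?thesis using s by (intro exI[of _ "2 * s"]) auto
qed

lemma controlled_smooth_bounded_domain:
  assumes sbd: "smooth_bounded_domain \<Omega>"
  shows "oscillation_controlled \<Omega> \<Omega> \<Omega>"
proof -
  have op: "open \<Omega>" and bd: "bounded \<Omega>" and conn: "connected \<Omega>" and ne: "\<Omega> \<noteq> {}"
    using sbd by (auto simp: smooth_bounded_domain_def)
  have comp: "compact (closure \<Omega>)" using bd by simp
  obtain x0 where x0: "x0 \<in> \<Omega>" using ne by blast
  then obtain r0 where r0: "r0 > 0" "ball x0 r0 \<subseteq> \<Omega>" using op openE by blast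
  define B where "B = ball x0 r0"
  have B: "B \<in> sets borel" "bounded B" by (auto simp: B_def)
  have BB: "oscillation_controlled \<Omega> B B"
    by (rule controlled_convex[OF op]) (use r0 in \<open>auto simp: B_def\<close>)
  have pos: "emeasure lborel (ball y r) \<noteq> 0" if "r > 0" for y :: 'a and r
    using that by (intro emeasure_lborel_open_nonzero) auto
  have loc: "\<exists>r>0. oscillation_controlled \<Omega> (ball y r) B" if y: "y \<in> \<Omega>" for y
  proof -
    obtain r where r: "r > 0" "oscillation_controlled \<Omega> (ball y r) (ball x0 r)"
      using controlled_balls_of_connected[OF op conn y x0] by metis
    define m where "m = min r r0"
    have m: "m > 0" "ball x0 m \<subseteq> ball x0 r" "ball x0 m \<subseteq> B" using r r0 by (auto simp: m_def B_def)
    have "oscillation_controlled \<Omega> (ball y r) (ball x0 m)" by (rule controlled_mono[OF r(2) _ m(2)]) simp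
    moreover have "oscillation_controlled \<Omega> B (ball x0 m)" by (rule controlled_mono[OF BB _ m(3)]) simp
    ultimately have "oscillation_controlled \<Omega> (ball y r) B"
      using controlled_trans[of "ball y r" "ball x0 m" B \<Omega>] B pos[OF m(1)] by auto
    then show ?thesis using r(1) by blast
  qed
  have "\<exists>r>0. oscillation_controlled \<Omega> (\<Omega> \<inter> ball y r) B" if y: "y \<in> closure \<Omega>" for y
  proof (cases "y \<in> \<Omega>")
    case True
    then obtain r where "r > 0" "oscillation_controlled \<Omega> (ball y r) B" using loc by blast
    then show ?thesis using controlled_mono[of \<Omega> "ball y r" B "\<Omega> \<inter> ball y r" B] by blast
  next
    case False
    then have "y \<in> frontier \<Omega>" using y op by (simp add: frontier_def interior_open)
    then show ?thesis using controlled_near_frontier[OF sbd _ B loc] by blast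
  qed
  from compact_finite_ball_cover[where Q = "\<lambda>y r. oscillation_controlled \<Omega> (\<Omega> \<inter> ball y r) B", OF comp this]
  obtain C \<rho> where C: "finite C" "closure \<Omega> \<subseteq> (\<Union>y\<in>C. ball y (\<rho> y))"
    and \<rho>: "\<forall>y\<in>C. \<rho> y > 0 \<and> oscillation_controlled \<Omega> (\<Omega> \<inter> ball y (\<rho> y)) B" by blast
  have "oscillation_controlled \<Omega> (\<Union>y\<in>C. \<Omega> \<inter> ball y (\<rho> y)) B"
    by (rule controlled_UN) (use C \<rho> B op in auto)
  then have \<Omega>B: "oscillation_controlled \<Omega> \<Omega> B"
    by (rule controlled_mono) (use C(2) closure_subset[of \<Omega>] in auto)
  have posB: "emeasure lborel B \<noteq> 0" unfolding B_def by (rule pos[OF r0(1)])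
  show ?thesis
    by (rule controlled_trans[OF _ B(1) _ bd B(2) bd posB \<Omega>B \<Omega>B]) (use op in auto)
qed

text \<open>The control of \<open>\<Omega>\<close> by itself, rewritten with the variance identity
  \<open>\<integral>\<integral> (w x - w y)\<^sup>2 = 2 m \<integral> (w - c)\<^sup>2\<close>, where \<open>m\<close> is the volume and \<open>c\<close> the mean.\<close>

theorem Poincare_inequality:
  fixes \<Omega> :: "'a::euclidean_space set"
  assumes sbd: "smooth_bounded_domain \<Omega>"
  obtains C where "C \<ge> 0"
    "\<And>w P. continuous_on (closure \<Omega>) w \<Longrightarrow> continuous_on (closure \<Omega>) P \<Longrightarrow>
      (\<And>x. x \<in> \<Omega> \<Longrightarrow> GDERIV w x :> P x) \<Longrightarrow>
      (LINT x:\<Omega>|lborel. (w x - (LINT y:\<Omega>|lborel. w y) / measure lborel \<Omega>)\<^sup>2)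
        \<le> C * (LINT x:\<Omega>|lborel. P x \<bullet> P x)"
proof -
  have op: "open \<Omega>" and bd: "bounded \<Omega>" and ne: "\<Omega> \<noteq> {}"
    using sbd by (auto simp: smooth_bounded_domain_def)
  have [measurable]: "\<Omega> \<in> sets borel" using op by auto
  obtain C where C: "C \<ge> 0"
    "\<And>w P. C1_with_gradient \<Omega> w P \<Longrightarrow> sq_oscillation w \<Omega> \<Omega> \<le> ennreal C * dirichlet_energy \<Omega> P"
    using controlledE[OF controlled_smooth_bounded_domain[OF sbd]] by blast
  define m where "m = measure lborel \<Omega>"
  have em: "emeasure lborel \<Omega> = ennreal m"
    unfolding m_def using emeasure_bounded_finite[OF bd] by (auto intro!: emeasure_eq_ennreal_measure)
  have "emeasure lborel \<Omega> \<noteq> 0"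
    by (rule emeasure_lborel_open_nonzero[OF op ne])
  then have m: "m > 0" using em by (auto simp: m_def zero_less_measure_iff)
  have main: "(LINT x:\<Omega>|lborel. (w x - (LINT y:\<Omega>|lborel. w y) / m)\<^sup>2)
        \<le> (C / (2 * m)) * (LINT x:\<Omega>|lborel. P x \<bullet> P x)"
    if wc: "continuous_on (closure \<Omega>) w" and Pc: "continuous_on (closure \<Omega>) P"
      and wP: "\<And>x. x \<in> \<Omega> \<Longrightarrow> GDERIV w x :> P x" for w P
  proof -
    \<comment> \<open>extension by zero, to meet the measurability normalization\<close>
    define w0 where "w0 = (\<lambda>x. indicator \<Omega> x *\<^sub>R w x)"
    define P0 where "P0 = (\<lambda>x. indicator \<Omega> x *\<^sub>R P x)"
    have cl: "continuous_on \<Omega> f" if "continuous_on (closure \<Omega>) f" for f :: "'a \<Rightarrow> 'b::topological_space"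
      using that closure_subset by (rule continuous_on_subset)
    note si = set_integrable_continuous_closure[OF op bd]
    have 0: "C1_with_gradient \<Omega> w0 P0"
      unfolding C1_with_gradient_def
    proof (intro conjI ballI)
      show "w0 \<in> borel_measurable borel" unfolding w0_def
        by (rule borel_measurable_continuous_on_indicator[OF _ cl[OF wc]]) simp
      show "P0 \<in> borel_measurable borel" unfolding P0_def
        by (rule borel_measurable_continuous_on_indicator[OF _ cl[OF Pc]]) simp
      show "continuous_on \<Omega> P0" by (rule continuous_on_eq[OF cl[OF Pc]]) (simp add: P0_def)
      fix x assume x: "x \<in> \<Omega>"
      show "GDERIV w0 x :> P0 x" unfolding gderiv_def
        by (rule has_derivative_transform_within_open[OF wP[OF x, unfolded gderiv_def] op x, THEN has_derivative_eq_rhs])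
          (auto simp: w0_def P0_def x)
    qed
    then have [measurable]: "w0 \<in> borel_measurable borel" by (simp add: C1_with_gradient_def)
    define I1 where "I1 = (LINT x:\<Omega>|lborel. w x)"
    define I2 where "I2 = (LINT x:\<Omega>|lborel. (w x)\<^sup>2)"
    have i1: "set_integrable lborel \<Omega> w" "set_integrable lborel \<Omega> (\<lambda>x. (w x)\<^sup>2)"
      "set_integrable lborel \<Omega> (\<lambda>x. c::real)" for c
      by (intro si wc continuous_intros)+
    have quad: "(LINT y:\<Omega>|lborel. (w y - c)\<^sup>2) = I2 - 2 * c * I1 + c\<^sup>2 * m" for c
    proof -
      have "(LINT y:\<Omega>|lborel. (w y - c)\<^sup>2) = (LINT y:\<Omega>|lborel. ((w y)\<^sup>2 - 2 * c * w y) + c\<^sup>2)"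
        by (simp add: power2_diff algebra_simps)
      also have "\<dots> = (LINT y:\<Omega>|lborel. (w y)\<^sup>2 - 2 * c * w y) + (LINT y:\<Omega>|lborel. c\<^sup>2)"
        by (intro set_integral_add set_integral_diff set_integrable_mult_right i1)
      also have "(LINT y:\<Omega>|lborel. (w y)\<^sup>2 - 2 * c * w y) = I2 - 2 * c * I1"
        using set_integral_diff(2)[OF i1(2) set_integrable_mult_right[OF i1(1), of "2 * c"]]
        by (simp add: I1_def I2_def)
      also have "(LINT y:\<Omega>|lborel. c\<^sup>2) = c\<^sup>2 * m"
        by (simp add: set_lebesgue_integral_def m_def mult.commute)
      finally show ?thesis .
    qed
    have iq: "set_integrable lborel \<Omega> (\<lambda>y. (w y - c)\<^sup>2)" for c by (intro si wc continuous_intros)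
    have inner: "(\<integral>\<^sup>+y. indicator \<Omega> x * indicator \<Omega> y * ennreal ((w0 x - w0 y)\<^sup>2) \<partial>lborel)
        = ennreal (indicator \<Omega> x * (I2 - 2 * w x * I1 + (w x)\<^sup>2 * m))" for x
    proof (cases "x \<in> \<Omega>")
      case True
      have "(\<integral>\<^sup>+y. indicator \<Omega> x * indicator \<Omega> y * ennreal ((w0 x - w0 y)\<^sup>2) \<partial>lborel)
          = (\<integral>\<^sup>+y. ennreal (indicator \<Omega> y *\<^sub>R (w y - w x)\<^sup>2) \<partial>lborel)"
        using True by (intro nn_integral_cong) (auto simp: indicator_def w0_def power2_commute)
      also have "\<dots> = ennreal (LINT y:\<Omega>|lborel. (w y - w x)\<^sup>2)"
        unfolding set_lebesgue_integral_def using iq[of "w x"] unfolding set_integrable_def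
        by (intro nn_integral_eq_integral) auto
      finally show ?thesis using True quad[of "w x"] by simp
    qed simp
    have q0: "I2 - 2 * w x * I1 + (w x)\<^sup>2 * m \<ge> 0" for x
      unfolding quad[symmetric] set_lebesgue_integral_def by (intro integral_nonneg_AE AE_I2) auto
    have "sq_oscillation w0 \<Omega> \<Omega> = (\<integral>\<^sup>+x. ennreal (indicator \<Omega> x *\<^sub>R (I2 - 2 * w x * I1 + (w x)\<^sup>2 * m)) \<partial>lborel)"
      unfolding sq_oscillation_def inner by simp
    also have "\<dots> = ennreal (LINT x:\<Omega>|lborel. I2 - 2 * w x * I1 + (w x)\<^sup>2 * m)"
    proof -
      have "set_integrable lborel \<Omega> (\<lambda>x. I2 - 2 * w x * I1 + (w x)\<^sup>2 * m)"
        by (intro si wc continuous_intros)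
      then show ?thesis unfolding set_lebesgue_integral_def set_integrable_def
        using q0 by (intro nn_integral_eq_integral) auto
    qed
    also have "(LINT x:\<Omega>|lborel. I2 - 2 * w x * I1 + (w x)\<^sup>2 * m) = I2 * m - 2 * I1 * I1 + I2 * m"
    proof -
      have "(LINT x:\<Omega>|lborel. I2 - 2 * w x * I1 + (w x)\<^sup>2 * m)
          = (LINT x:\<Omega>|lborel. I2 - (2 * I1) * w x) + (LINT x:\<Omega>|lborel. m * (w x)\<^sup>2)"
        using set_integral_add(2)[OF set_integral_diff(1)[OF i1(3) set_integrable_mult_right[OF i1(1)]]
            set_integrable_mult_right[OF i1(2)], of I2 "2 * I1" m]
        by (simp add: mult_ac)
      also have "(LINT x:\<Omega>|lborel. I2 - (2 * I1) * w x) = (LINT x:\<Omega>|lborel. I2) - 2 * I1 * I1"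
        using set_integral_diff(2)[OF i1(3) set_integrable_mult_right[OF i1(1)], of I2 "2 * I1"]
        by (simp add: I1_def)
      also have "(LINT x:\<Omega>|lborel. I2) = I2 * m" by (simp add: set_lebesgue_integral_def m_def mult.commute)
      finally show ?thesis by (simp add: I2_def mult.commute)
    qed
    finally have so: "sq_oscillation w0 \<Omega> \<Omega> = ennreal (2 * (I2 * m - I1 * I1))" by (simp add: algebra_simps)
    have de: "dirichlet_energy \<Omega> P0 = ennreal (LINT x:\<Omega>|lborel. P x \<bullet> P x)"
    proof -
      have i: "set_integrable lborel \<Omega> (\<lambda>x. P x \<bullet> P x)" by (intro si Pc continuous_intros)
      have "dirichlet_energy \<Omega> P0 = (\<integral>\<^sup>+x. ennreal (indicator \<Omega> x *\<^sub>R (P x \<bullet> P x)) \<partial>lborel)"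
        unfolding dirichlet_energy_def
        by (intro nn_integral_cong) (auto simp: indicator_def P0_def power2_norm_eq_inner)
      also have "\<dots> = ennreal (LINT x:\<Omega>|lborel. P x \<bullet> P x)"
        unfolding set_lebesgue_integral_def using i unfolding set_integrable_def
        by (intro nn_integral_eq_integral) auto
      finally show ?thesis .
    qed
    have d0: "(LINT x:\<Omega>|lborel. P x \<bullet> P x) \<ge> 0"
      unfolding set_lebesgue_integral_def by (intro integral_nonneg_AE AE_I2) auto
    have "ennreal (2 * (I2 * m - I1 * I1)) \<le> ennreal (C * (LINT x:\<Omega>|lborel. P x \<bullet> P x))"
      using C(2)[OF 0] C(1) unfolding so de by (simp add: ennreal_mult')
    then have "2 * (I2 * m - I1 * I1) \<le> C * (LINT x:\<Omega>|lborel. P x \<bullet> P x)"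
      using C(1) d0 by (simp add: ennreal_le_iff)
    then have "2 * (I2 * m - I1 * I1) / (2 * m) \<le> C * (LINT x:\<Omega>|lborel. P x \<bullet> P x) / (2 * m)"
      using m by (intro divide_right_mono) auto
    then have "(I2 * m - I1 * I1) / m \<le> C / (2 * m) * (LINT x:\<Omega>|lborel. P x \<bullet> P x)"
      by (subst (asm) mult_divide_mult_cancel_left) auto
    moreover have "(LINT x:\<Omega>|lborel. (w x - I1 / m)\<^sup>2) = (I2 * m - I1 * I1) / m"
      unfolding quad using m by (simp add: field_simps power2_eq_square)
    ultimately show ?thesis by (simp add: I1_def)
  qed
  show ?thesis
  proof (rule that[of "C / (2 * m)"])
    show "C / (2 * m) \<ge> 0" using C(1) m by simp
  qed (unfold m_def[symmetric], rule main)
qed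

section \<open>The reaction terms\<close>

text \<open>These relations characterize \<open>u\<close> and \<open>v\<close>, and all estimates on them are drawn from here instead of from
  the square roots.\<close>

lemma u_of_v_of:
  assumes "\<gamma> > 0" "\<delta> > 0" "\<tau> > 0"
  shows "u_of \<gamma> \<delta> w \<tau> > 0" "v_of \<gamma> \<delta> w \<tau> > 0" "u_of \<gamma> \<delta> w \<tau> * v_of \<gamma> \<delta> w \<tau> = \<tau>"
    "\<delta> * u_of \<gamma> \<delta> w \<tau> - \<gamma> * v_of \<gamma> \<delta> w \<tau> = w"
proof -
  have "\<bar>w\<bar> < sqrt (w\<^sup>2 + 4 * \<gamma> * \<delta> * \<tau>)"
    by (rule real_less_rsqrt) (use assms in simp)
  then show u: "u_of \<gamma> \<delta> w \<tau> > 0" unfolding u_of_def using assms(2) by (intro divide_pos_pos) auto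
  then show "v_of \<gamma> \<delta> w \<tau> > 0" unfolding v_of_def using assms(3) by (rule divide_pos_pos[rotated])
  show "u_of \<gamma> \<delta> w \<tau> * v_of \<gamma> \<delta> w \<tau> = \<tau>" unfolding v_of_def using u by simp
  show "\<delta> * u_of \<gamma> \<delta> w \<tau> - \<gamma> * v_of \<gamma> \<delta> w \<tau> = w"
    unfolding v_of_alt[OF assms] u_of_def using assms(1,2) by (simp add: field_simps)
qed

lemma continuous_on_u_of_v_of:
  assumes "\<gamma> > 0" "\<delta> > 0" "\<tau> > 0" "continuous_on S w"
  shows "continuous_on S (\<lambda>x. u_of \<gamma> \<delta> (w x) \<tau>)" "continuous_on S (\<lambda>x. v_of \<gamma> \<delta> (w x) \<tau>)"
  unfolding v_of_alt[OF assms(1-3)] unfolding u_of_def using assms by (intro continuous_intros; simp)+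

text \<open>As \<open>u v\<close> is fixed, \<open>u\<close> and \<open>v\<close> move in opposite directions.  Hence \<open>\<delta> u\<close> and \<open>- \<gamma> v\<close> move in the same one,
  and each of them changes by no more than their sum \<open>w\<close>.\<close>

lemma u_of_v_of_Lipschitz:
  assumes "\<gamma> > 0" "\<delta> > 0" "\<tau> > 0"
  shows "\<delta> * \<bar>u_of \<gamma> \<delta> w \<tau> - u_of \<gamma> \<delta> w' \<tau>\<bar> \<le> \<bar>w - w'\<bar>"
    "\<gamma> * \<bar>v_of \<gamma> \<delta> w \<tau> - v_of \<gamma> \<delta> w' \<tau>\<bar> \<le> \<bar>w - w'\<bar>"
proof -
  have *: "\<delta> * (u - u') \<le> x - x' \<and> \<gamma> * (v' - v) \<le> x - x' \<and> u' \<le> u \<and> v \<le> v'"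
    if "u > 0" "u' > 0" "v > 0" "v' > 0" "u * v = \<tau>" "u' * v' = \<tau>" "\<delta> * u - \<gamma> * v = x" "\<delta> * u' - \<gamma> * v' = x'" "u \<ge> u'"
    for u u' v v' x x'
  proof -
    have "v \<le> v'"
    proof (rule ccontr)
      assume "\<not> v \<le> v'"
      then have "u' * v' < u * v" using that by (intro mult_le_less_imp_less) auto
      then show False using that by simp
    qed
    moreover have "\<delta> * (u - u') \<ge> 0" using that assms by simp
    moreover have "\<gamma> * (v' - v) \<ge> 0" using calculation(1) assms by simp
    moreover have "x - x' = \<delta> * (u - u') + \<gamma> * (v' - v)" using that by (simp add: algebra_simps)
    ultimately show ?thesis using that by linarith
  qed
  note f = u_of_v_of[OF assms]
  show "\<delta> * \<bar>u_of \<gamma> \<delta> w \<tau> - u_of \<gamma> \<delta> w' \<tau>\<bar> \<le> \<bar>w - w'\<bar>"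
    using *[OF f(1) f(1) f(2) f(2) f(3) f(3) f(4) f(4), of w w']
      *[OF f(1) f(1) f(2) f(2) f(3) f(3) f(4) f(4), of w' w]
    by (cases "u_of \<gamma> \<delta> w \<tau> \<ge> u_of \<gamma> \<delta> w' \<tau>") (auto simp: abs_if not_le)
  show "\<gamma> * \<bar>v_of \<gamma> \<delta> w \<tau> - v_of \<gamma> \<delta> w' \<tau>\<bar> \<le> \<bar>w - w'\<bar>"
    using *[OF f(1) f(1) f(2) f(2) f(3) f(3) f(4) f(4), of w w']
      *[OF f(1) f(1) f(2) f(2) f(3) f(3) f(4) f(4), of w' w]
    by (cases "u_of \<gamma> \<delta> w \<tau> \<ge> u_of \<gamma> \<delta> w' \<tau>") (auto simp: abs_if not_le)
qed

text \<open>If \<open>p \<ge> 1\<close> then \<open>q \<le> p q \<le> T\<close>, and \<open>\<alpha> p \<le> M + \<beta> q\<close> bounds \<open>p\<close>.\<close>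

lemma factor_bounded:
  fixes p q \<alpha> \<beta> T M :: real
  assumes "p > 0" "q > 0" "\<alpha> > 0" "\<beta> > 0" "p * q \<le> T" "\<bar>\<alpha> * p - \<beta> * q\<bar> \<le> M"
  shows "p \<le> 1 + (M + \<beta> * T) / \<alpha>"
proof (cases "p \<le> 1")
  case True
  have "T > 0" using mult_pos_pos[OF assms(1,2)] assms(5) by linarith
  then have "0 \<le> (M + \<beta> * T) / \<alpha>" using assms by (intro divide_nonneg_pos add_nonneg_nonneg) auto
  then show ?thesis using True by linarith
next
  case False
  have "q \<le> p * q" using False assms(2) by simp
  also note assms(5)
  finally have "\<beta> * q \<le> \<beta> * T" using assms by (intro mult_left_mono) auto
  then have "\<alpha> * p \<le> M + \<beta> * T" using assms(6) by linarith
  then have "p \<le> (M + \<beta> * T) / \<alpha>" using assms(3) by (simp add: field_simps)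
  then show ?thesis by linarith
qed

text \<open>When \<open>\<alpha> p\<close> exceeds \<open>\<beta> q\<close> by a lot, \<open>p\<close> is large while \<open>q\<^sup>2 \<le> \<alpha> T / \<beta>\<close> stays bounded, so the logistic term
  absorbs the other two.  The cases \<open>w > M\<close> and \<open>w < - M\<close> are this lemma with the roles of \<open>u\<close> and \<open>v\<close>
  exchanged.\<close>

lemma dominant_factor_negative:
  fixes p q :: real
  assumes pos: "p > 0" "q > 0" "\<alpha> > 0" "\<beta> > 0" "b > 0" and nn: "a \<ge> 0" "B \<ge> 0" "D \<ge> 0"
    and pq: "p * q \<le> T"
    and far: "\<alpha> * p - \<beta> * q \<ge> \<alpha> * (1 + (a + (B * (\<alpha> * T / \<beta>) + D * T)) / b)"
  shows "p * (a - b * p) + B * q\<^sup>2 + D * (p * q) \<le> 0"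
proof -
  define K where "K = B * (\<alpha> * T / \<beta>) + D * T"
  have T: "T > 0" using mult_pos_pos[OF pos(1,2)] pq by linarith
  have K: "K \<ge> 0" unfolding K_def using pos nn T by (intro add_nonneg_nonneg mult_nonneg_nonneg divide_nonneg_pos) auto
  have "\<alpha> * (1 + (a + K) / b) \<le> \<alpha> * p"
    using far mult_pos_pos[OF pos(4,2)] unfolding K_def by linarith
  then have p: "1 + (a + K) / b \<le> p" using pos by simp
  have aKb: "0 \<le> (a + K) / b" using K nn pos by simp
  have p1: "p \<ge> 1" using p aKb by linarith
  have "(a + K) / b \<le> p" using p by linarith
  then have "a - b * p \<le> - K" using pos by (simp add: field_simps)
  then have "p * (a - b * p) \<le> p * (- K)" using pos by (intro mult_left_mono) auto
  also have "\<dots> \<le> - K" using mult_right_mono[OF p1 K] by simp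
  finally have 1: "p * (a - b * p) \<le> - K" .
  have "0 \<le> \<alpha> * (1 + (a + K) / b)" using pos aKb by simp
  then have "\<beta> * q \<le> \<alpha> * p" using far unfolding K_def by linarith
  then have "\<beta> * q * q \<le> \<alpha> * p * q" using pos by (intro mult_right_mono) auto
  also have "\<dots> \<le> \<alpha> * T" using mult_left_mono[OF pq, of \<alpha>] pos by (simp add: mult.assoc)
  finally have "q\<^sup>2 \<le> \<alpha> * T / \<beta>" using pos by (simp add: field_simps power2_eq_square)
  then have "B * q\<^sup>2 \<le> B * (\<alpha> * T / \<beta>)" using nn by (intro mult_left_mono)
  moreover have "D * (p * q) \<le> D * T" using pq nn by (intro mult_left_mono)
  ultimately show ?thesis using 1 unfolding K_def by linarith
qed

text \<open>The arithmetic-geometric mean inequality \<open>b p + c q \<ge> 2 sqrt (b c p q) > a\<close>, here by completing the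
  square in \<open>p\<close>.\<close>

lemma growth_negative_of_large_product:
  fixes p q :: real
  assumes "p > 0" "b > 0" "c > 0" "a\<^sup>2 / (4 * b * c) < p * q"
  shows "p * (a - b * p - c * q) < 0"
proof -
  have "a\<^sup>2 < 4 * b * c * (p * q)" using assms by (simp add: field_simps)
  moreover have "4 * b * (p * (a - b * p - c * q)) = a\<^sup>2 - 4 * b * c * (p * q) - (2 * b * p - a)\<^sup>2"
    by (simp add: power2_eq_square algebra_simps)
  ultimately have "4 * b * (p * (a - b * p - c * q)) < 0"
    using zero_le_power2[of "2 * b * p - a"] by linarith
  then show ?thesis using assms(2) by (simp add: mult_less_0_iff)
qed

definition net_reaction ::
  "real \<Rightarrow> real \<Rightarrow> real \<Rightarrow> real \<Rightarrow> real \<Rightarrow> real \<Rightarrow> real \<Rightarrow> real \<Rightarrow> real \<Rightarrow> real \<Rightarrow> real"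
  where "net_reaction a1 b1 c1 a2 b2 c2 \<gamma> \<delta> \<tau> s =
    f_reaction a1 b1 c1 (u_of \<gamma> \<delta> s \<tau>) (v_of \<gamma> \<delta> s \<tau>) - \<gamma> * g_reaction a2 b2 c2 (u_of \<gamma> \<delta> s \<tau>) (v_of \<gamma> \<delta> s \<tau>)"

context
  fixes a1 b1 c1 a2 b2 c2 \<gamma> \<delta> :: real
  assumes pos: "a1 > 0" "b1 > 0" "c1 > 0" "a2 > 0" "b2 > 0" "c2 > 0" "\<gamma> > 0" "\<delta> > 0"
begin

lemma net_reaction_eq:
  assumes "\<tau> > 0"
  shows "net_reaction a1 b1 c1 a2 b2 c2 \<gamma> \<delta> \<tau> s =
    a1 * u_of \<gamma> \<delta> s \<tau> - b1 * (u_of \<gamma> \<delta> s \<tau>)\<^sup>2 - c1 * \<tau>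
    - \<gamma> * (a2 * v_of \<gamma> \<delta> s \<tau> - b2 * \<tau> - c2 * (v_of \<gamma> \<delta> s \<tau>)\<^sup>2)"
proof -
  have "u_of \<gamma> \<delta> s \<tau> * v_of \<gamma> \<delta> s \<tau> = \<tau>" using u_of_v_of(3) pos assms by blast
  moreover have "f_reaction a1 b1 c1 u v - \<gamma> * g_reaction a2 b2 c2 u v =
      a1 * u - b1 * u\<^sup>2 - c1 * (u * v) - \<gamma> * (a2 * v - b2 * (u * v) - c2 * v\<^sup>2)" for u v
    unfolding f_reaction_def g_reaction_def by (simp add: power2_eq_square algebra_simps)
  ultimately show ?thesis unfolding net_reaction_def by simp
qed

text \<open>The thresholds are those of \<open>dominant_factor_negative\<close>, with \<open>u\<close> dominant on the right and \<open>v\<close> on the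
  left.  They depend on \<open>\<tau>\<close> only through its upper bound \<open>T\<close>.\<close>

lemma net_reaction_signs:
  assumes T: "T > 0"
  obtains M where "M > 0"
    "\<And>\<tau> s. 0 < \<tau> \<Longrightarrow> \<tau> \<le> T \<Longrightarrow> s > M \<Longrightarrow> net_reaction a1 b1 c1 a2 b2 c2 \<gamma> \<delta> \<tau> s < 0"
    "\<And>\<tau> s. 0 < \<tau> \<Longrightarrow> \<tau> \<le> T \<Longrightarrow> s < - M \<Longrightarrow> net_reaction a1 b1 c1 a2 b2 c2 \<gamma> \<delta> \<tau> s > 0"
proof -
  define M1 where "M1 = \<delta> * (1 + (a1 + ((\<gamma> * c2) * (\<delta> * T / \<gamma>) + (\<gamma> * b2) * T)) / b1)"
  define M2 where "M2 = \<gamma> * (1 + (\<gamma> * a2 + (b1 * (\<gamma> * T / \<delta>) + c1 * T)) / (\<gamma> * c2))"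
  have M1: "M1 > 0" unfolding M1_def using pos T
    by (intro mult_pos_pos add_pos_pos divide_pos_pos) auto
  have "net_reaction a1 b1 c1 a2 b2 c2 \<gamma> \<delta> \<tau> s < 0" if \<tau>: "0 < \<tau>" "\<tau> \<le> T" and s: "s > M1" for \<tau> s
  proof -
    note f = u_of_v_of[OF pos(7,8) \<tau>(1), of s]
    define u where "u = u_of \<gamma> \<delta> s \<tau>"
    define v where "v = v_of \<gamma> \<delta> s \<tau>"
    note f' = f[folded u_def v_def]
    have "u * (a1 - b1 * u) + (\<gamma> * c2) * v\<^sup>2 + (\<gamma> * b2) * (u * v) \<le> 0"
      by (rule dominant_factor_negative[where T = T and \<alpha> = \<delta> and \<beta> = \<gamma>])
        (use f' pos \<tau> s M1_def in auto)
    then have "a1 * u - b1 * u\<^sup>2 + \<gamma> * (c2 * v\<^sup>2) + \<gamma> * (b2 * \<tau>) \<le> 0"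
      unfolding f'(3) by (simp add: power2_eq_square algebra_simps)
    moreover have "\<gamma> * (a2 * v) > 0" "c1 * \<tau> > 0" using f' pos \<tau> by auto
    ultimately show ?thesis
      unfolding net_reaction_eq[OF \<tau>(1)] u_def[symmetric] v_def[symmetric]
      by (simp add: right_diff_distrib)
  qed
  moreover have "net_reaction a1 b1 c1 a2 b2 c2 \<gamma> \<delta> \<tau> s > 0" if \<tau>: "0 < \<tau>" "\<tau> \<le> T" and s: "s < - M2" for \<tau> s
  proof -
    note f = u_of_v_of[OF pos(7,8) \<tau>(1), of s]
    define u where "u = u_of \<gamma> \<delta> s \<tau>"
    define v where "v = v_of \<gamma> \<delta> s \<tau>"
    note f' = f[folded u_def v_def]
    have "v * (\<gamma> * a2 - \<gamma> * c2 * v) + b1 * u\<^sup>2 + c1 * (v * u) \<le> 0"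
      by (rule dominant_factor_negative[where T = T and \<alpha> = \<gamma> and \<beta> = \<delta>])
        (use f' pos \<tau> s M2_def in \<open>auto simp: mult.commute[of v u]\<close>)
    then have "\<gamma> * (a2 * v) - \<gamma> * (c2 * v\<^sup>2) + b1 * u\<^sup>2 + c1 * \<tau> \<le> 0"
      unfolding mult.commute[of v u] f'(3) by (simp add: power2_eq_square algebra_simps)
    moreover have "\<gamma> * (b2 * \<tau>) > 0" "a1 * u > 0" using f' pos \<tau> by auto
    ultimately show ?thesis
      unfolding net_reaction_eq[OF \<tau>(1)] u_def[symmetric] v_def[symmetric]
      by (simp add: right_diff_distrib)
  qed
  ultimately show ?thesis using M1 by (intro that[of "max M1 M2"]) auto
qed

text \<open>After \<open>u v = \<tau>\<close> is used, the reaction is a quadratic in \<open>u\<close> minus a quadratic in \<open>v\<close>; both arguments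
  are bounded and Lipschitz in \<open>w\<close>, with constants that depend on \<open>\<tau>\<close> only through \<open>T\<close>.\<close>

lemma net_reaction_Lipschitz:
  assumes T: "T > 0" and M: "M > 0"
  obtains L where "L > 0"
    "\<And>\<tau> s s'. 0 < \<tau> \<Longrightarrow> \<tau> \<le> T \<Longrightarrow> \<bar>s\<bar> \<le> M \<Longrightarrow> \<bar>s'\<bar> \<le> M \<Longrightarrow>
      \<bar>net_reaction a1 b1 c1 a2 b2 c2 \<gamma> \<delta> \<tau> s - net_reaction a1 b1 c1 a2 b2 c2 \<gamma> \<delta> \<tau> s'\<bar> \<le> L * \<bar>s - s'\<bar>"
proof -
  define U where "U = 1 + (M + \<gamma> * T) / \<delta>"
  define V where "V = 1 + (M + \<delta> * T) / \<gamma>"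
  define L where "L = (a1 + b1 * (2 * U)) / \<delta> + (a2 + c2 * (2 * V))"
  have UV: "U > 0" "V > 0" unfolding U_def V_def using pos T M
    by (auto intro!: add_pos_pos divide_pos_pos)
  have "\<bar>net_reaction a1 b1 c1 a2 b2 c2 \<gamma> \<delta> \<tau> s - net_reaction a1 b1 c1 a2 b2 c2 \<gamma> \<delta> \<tau> s'\<bar> \<le> L * \<bar>s - s'\<bar>"
    if \<tau>: "0 < \<tau>" "\<tau> \<le> T" and s: "\<bar>s\<bar> \<le> M" "\<bar>s'\<bar> \<le> M" for \<tau> s s'
  proof -
    define u v where "u = (\<lambda>s. u_of \<gamma> \<delta> s \<tau>)" and "v = (\<lambda>s. v_of \<gamma> \<delta> s \<tau>)"
    have f: "u r > 0" "v r > 0" "u r * v r = \<tau>" "\<delta> * u r - \<gamma> * v r = r" for r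
      unfolding u_def v_def using u_of_v_of[OF pos(7,8) \<tau>(1)] by auto
    have b: "u r \<le> U" "v r \<le> V" if "\<bar>r\<bar> \<le> M" for r
      unfolding U_def V_def
      using factor_bounded[of "u r" "v r" \<delta> \<gamma> T M] factor_bounded[of "v r" "u r" \<gamma> \<delta> T M]
        f[of r] that pos \<tau> by (auto simp: mult.commute[of "v r"] abs_minus_commute)
    note lip = u_of_v_of_Lipschitz[OF pos(7,8) \<tau>(1), of s s']
    have du: "\<bar>u s - u s'\<bar> \<le> \<bar>s - s'\<bar> / \<delta>" unfolding u_def using lip pos by (simp add: field_simps)
    have dv: "\<gamma> * \<bar>v s - v s'\<bar> \<le> \<bar>s - s'\<bar>" unfolding v_def using lip by simp
    have "net_reaction a1 b1 c1 a2 b2 c2 \<gamma> \<delta> \<tau> s - net_reaction a1 b1 c1 a2 b2 c2 \<gamma> \<delta> \<tau> s'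
        = (u s - u s') * (a1 - b1 * (u s + u s')) - (\<gamma> * (v s - v s')) * (a2 - c2 * (v s + v s'))"
      unfolding net_reaction_eq[OF \<tau>(1)] u_def v_def by (simp add: power2_eq_square algebra_simps)
    also have "\<bar>\<dots>\<bar> \<le> \<bar>u s - u s'\<bar> * \<bar>a1 - b1 * (u s + u s')\<bar> + (\<gamma> * \<bar>v s - v s'\<bar>) * \<bar>a2 - c2 * (v s + v s')\<bar>"
      using pos by (intro order_trans[OF abs_triangle_ineq4]) (simp add: abs_mult)
    also have "\<dots> \<le> (\<bar>s - s'\<bar> / \<delta>) * (a1 + b1 * (2 * U)) + \<bar>s - s'\<bar> * (a2 + c2 * (2 * V))"
    proof (intro add_mono mult_mono du dv)
      have "0 \<le> b1 * (u s + u s')" "b1 * (u s + u s') \<le> b1 * (2 * U)"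
        using pos f[of s] f[of s'] b[OF s(1)] b[OF s(2)] by (auto intro!: mult_left_mono)
      then show "\<bar>a1 - b1 * (u s + u s')\<bar> \<le> a1 + b1 * (2 * U)" using pos by linarith
      have "0 \<le> c2 * (v s + v s')" "c2 * (v s + v s') \<le> c2 * (2 * V)"
        using pos f[of s] f[of s'] b[OF s(1)] b[OF s(2)] by (auto intro!: mult_left_mono)
      then show "\<bar>a2 - c2 * (v s + v s')\<bar> \<le> a2 + c2 * (2 * V)" using pos by linarith
    qed (use pos in auto)
    also have "\<dots> = L * \<bar>s - s'\<bar>" by (simp add: L_def algebra_simps add_divide_distrib)
    finally show ?thesis .
  qed
  moreover have "L > 0" unfolding L_def using pos UV by (auto intro!: add_pos_pos divide_pos_pos)
  ultimately show ?thesis using that by blast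
qed

end

section \<open>Estimates for solutions\<close>

context
  fixes \<Omega> :: "'a::euclidean_space set" and a1 b1 c1 a2 b2 c2 \<gamma> \<delta> :: real
  assumes sbd: "smooth_bounded_domain \<Omega>"
    and pos: "a1 > 0" "b1 > 0" "c1 > 0" "a2 > 0" "b2 > 0" "c2 > 0" "\<gamma> > 0" "\<delta> > 0"
begin

private abbreviation "R \<equiv> net_reaction a1 b1 c1 a2 b2 c2 \<gamma> \<delta>"

private lemma domain: "open \<Omega>" "bounded \<Omega>" "connected \<Omega>" "\<Omega> \<noteq> {}"
  using sbd by (auto simp: smooth_bounded_domain_def)

lemma continuous_on_reactions:
  assumes "\<tau> > 0" "continuous_on S w"
  shows "continuous_on S (\<lambda>x. f_reaction a b c (u_of \<gamma> \<delta> (w x) \<tau>) (v_of \<gamma> \<delta> (w x) \<tau>))"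
    "continuous_on S (\<lambda>x. g_reaction a b c (u_of \<gamma> \<delta> (w x) \<tau>) (v_of \<gamma> \<delta> (w x) \<tau>))"
    "continuous_on S (\<lambda>x. R \<tau> (w x))"
  unfolding net_reaction_def f_reaction_def g_reaction_def
  by (intro continuous_intros continuous_on_u_of_v_of[OF pos(7,8) assms])+

text \<open>Green's identity with the Laplacian replaced by means of the equation.\<close>

lemma solution_energy_identity:
  assumes sol: "is_solution \<Omega> a1 b1 c1 a2 b2 c2 \<gamma> \<delta> d w \<tau>" and d: "d > 0"
  obtains P where "continuous_on (closure \<Omega>) P" "\<And>x. x \<in> \<Omega> \<Longrightarrow> GDERIV w x :> P x"
    "\<And>\<Phi> \<Phi>'. (\<And>s. (\<Phi> has_real_derivative \<Phi>' s) (at s)) \<Longrightarrow> continuous_on UNIV \<Phi>' \<Longrightarrow>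
      (LINT x:\<Omega>|lborel. \<Phi>' (w x) * (P x \<bullet> P x) - \<Phi> (w x) * R \<tau> (w x) / d) = 0"
proof -
  have w: "Ck_closure 2 \<Omega> w" and nd: "\<And>x. x \<in> frontier \<Omega> \<Longrightarrow> normal_deriv \<Omega> w x = 0"
    and eq: "\<And>x. x \<in> \<Omega> \<Longrightarrow> laplacian w x = - R \<tau> (w x) / d"
    using sol d unfolding is_solution_def net_reaction_def by (auto simp: field_simps)
  obtain P where P: "continuous_on (closure \<Omega>) P" "\<And>x. x \<in> \<Omega> \<Longrightarrow> GDERIV w x :> P x"
    and G: "\<And>\<Phi> \<Phi>'. (\<And>s. (\<Phi> has_real_derivative \<Phi>' s) (at s)) \<Longrightarrow> continuous_on UNIV \<Phi>' \<Longrightarrow>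
      (LINT x:\<Omega>|lborel. \<Phi>' (w x) * (P x \<bullet> P x) + \<Phi> (w x) * laplacian w x) = 0"
    using Neumann_Green_identity[OF sbd w nd] by blast
  show ?thesis
  proof (rule that[OF P])
    fix \<Phi> \<Phi>' :: "real \<Rightarrow> real"
    assume "\<And>s. (\<Phi> has_real_derivative \<Phi>' s) (at s)" "continuous_on UNIV \<Phi>'"
    from G[OF this]
    have "(LINT x:\<Omega>|lborel. \<Phi>' (w x) * (P x \<bullet> P x) + \<Phi> (w x) * laplacian w x) = 0" .
    also have "(LINT x:\<Omega>|lborel. \<Phi>' (w x) * (P x \<bullet> P x) + \<Phi> (w x) * laplacian w x)
        = (LINT x:\<Omega>|lborel. \<Phi>' (w x) * (P x \<bullet> P x) - \<Phi> (w x) * R \<tau> (w x) / d)"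
      by (rule set_lebesgue_integral_cong) (use domain eq in auto)
    finally show "(LINT x:\<Omega>|lborel. \<Phi>' (w x) * (P x \<bullet> P x) - \<Phi> (w x) * R \<tau> (w x) / d) = 0" .
  qed
qed

lemma integral_negative_continuous:
  assumes c: "continuous_on (closure \<Omega>) h" and neg: "\<And>x. x \<in> \<Omega> \<Longrightarrow> h x < (0::real)"
  shows "(LINT x:\<Omega>|lborel. h x) \<noteq> 0"
proof
  assume z: "(LINT x:\<Omega>|lborel. h x) = 0"
  obtain x where x: "x \<in> \<Omega>" using domain by blast
  have "- h x = 0"
  proof (rule continuous_nonneg_integral_0[OF domain(1) _ _ _ _ x])
    show "continuous_on \<Omega> (\<lambda>x. - h x)"
      by (intro continuous_intros continuous_on_subset[OF c closure_subset])
    show "set_integrable lborel \<Omega> (\<lambda>x. - h x)"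
      by (intro set_integrable_continuous_closure domain continuous_intros c)
    show "(LINT x:\<Omega>|lborel. - h x) = 0" using z by (simp add: set_lebesgue_integral_def)
  qed (use neg in \<open>auto intro: less_imp_le\<close>)
  then show False using neg[OF x] by simp
qed

text \<open>The equation and the Neumann condition make \<open>f - \<gamma> g\<close> integrate to zero, and \<open>f\<close> does so by
  assumption.\<close>

lemma solution_reaction_integrals:
  assumes sol: "is_solution \<Omega> a1 b1 c1 a2 b2 c2 \<gamma> \<delta> d w \<tau>" and d: "d > 0"
  shows "(LINT x:\<Omega>|lborel. f_reaction a1 b1 c1 (u_of \<gamma> \<delta> (w x) \<tau>) (v_of \<gamma> \<delta> (w x) \<tau>)) = 0" (is "?f")
    "(LINT x:\<Omega>|lborel. g_reaction a2 b2 c2 (u_of \<gamma> \<delta> (w x) \<tau>) (v_of \<gamma> \<delta> (w x) \<tau>)) = 0" (is "?g")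
proof -
  have \<tau>: "\<tau> > 0" and wc: "continuous_on (closure \<Omega>) w"
    and hi: "((\<lambda>x. f_reaction a1 b1 c1 (u_of \<gamma> \<delta> (w x) \<tau>) (v_of \<gamma> \<delta> (w x) \<tau>)) has_integral 0) \<Omega>"
    using sol by (auto simp: is_solution_def Ck_closure_def)
  note cont = continuous_on_reactions[OF \<tau> wc]
  note int = set_integrable_continuous_closure[OF domain(1,2) cont(1), of a1 b1 c1]
    set_integrable_continuous_closure[OF domain(1,2) cont(2), of a2 b2 c2]
  show f: ?f using set_borel_integral_eq_integral(2)[OF int(1)] integral_unique[OF hi] by simp
  obtain P where P: "continuous_on (closure \<Omega>) P" "\<And>x. x \<in> \<Omega> \<Longrightarrow> GDERIV w x :> P x"
    and G: "\<And>\<Phi> \<Phi>'. (\<And>s. (\<Phi> has_real_derivative \<Phi>' s) (at s)) \<Longrightarrow> continuous_on UNIV \<Phi>' \<Longrightarrow>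
      (LINT x:\<Omega>|lborel. \<Phi>' (w x) * (P x \<bullet> P x) - \<Phi> (w x) * R \<tau> (w x) / d) = 0"
    using solution_energy_identity[OF sol d] by blast
  from G[of "\<lambda>s. - d" "\<lambda>s. 0"] d have "(LINT x:\<Omega>|lborel. R \<tau> (w x)) = 0" by simp
  then show ?g
    unfolding net_reaction_def
    using set_integral_diff(2)[OF int(1) set_integrable_mult_right[OF int(2)], of \<gamma>] f pos by simp
qed

lemma solution_tau_bounds:
  assumes sol: "is_solution \<Omega> a1 b1 c1 a2 b2 c2 \<gamma> \<delta> d w \<tau>" and d: "d > 0"
  shows "\<tau> \<le> a1\<^sup>2 / (4 * b1 * c1)" "\<tau> \<le> a2\<^sup>2 / (4 * b2 * c2)"
proof -
  have \<tau>: "\<tau> > 0" and wc: "continuous_on (closure \<Omega>) w"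
    using sol by (auto simp: is_solution_def Ck_closure_def)
  note uv = u_of_v_of[OF pos(7,8) \<tau>]
  note cont = continuous_on_reactions[OF \<tau> wc]
  show "\<tau> \<le> a1\<^sup>2 / (4 * b1 * c1)"
  proof (rule ccontr)
    assume "\<not> ?thesis"
    then have "f_reaction a1 b1 c1 (u_of \<gamma> \<delta> s \<tau>) (v_of \<gamma> \<delta> s \<tau>) < 0" for s
      unfolding f_reaction_def using uv pos by (intro growth_negative_of_large_product) auto
    from integral_negative_continuous[OF cont(1) this] solution_reaction_integrals(1)[OF sol d]
    show False by blast
  qed
  show "\<tau> \<le> a2\<^sup>2 / (4 * b2 * c2)"
  proof (rule ccontr)
    assume n: "\<not> ?thesis"
    have "g_reaction a2 b2 c2 (u_of \<gamma> \<delta> s \<tau>) (v_of \<gamma> \<delta> s \<tau>) < 0" for s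
      using growth_negative_of_large_product[of "v_of \<gamma> \<delta> s \<tau>" c2 b2 a2 "u_of \<gamma> \<delta> s \<tau>"] n uv[of s] pos
      unfolding g_reaction_def by (simp add: mult_ac diff_diff_eq add.commute)
    from integral_negative_continuous[OF cont(2) this] solution_reaction_integrals(2)[OF sol d]
    show False by blast
  qed
qed

text \<open>Both terms of the energy identity have the same sign, so each vanishes identically.\<close>

lemma solution_truncation:
  assumes sol: "is_solution \<Omega> a1 b1 c1 a2 b2 c2 \<gamma> \<delta> d w \<tau>" and d: "d > 0"
    and \<Phi>: "\<And>s. (\<Phi> has_real_derivative \<Phi>' s) (at s)" "continuous_on UNIV \<Phi>'" "\<And>s. \<Phi>' s \<ge> 0"
    and R: "\<And>s. \<Phi> s * R \<tau> s \<le> 0" and x: "x \<in> \<Omega>"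
  shows "\<Phi> (w x) * R \<tau> (w x) = 0"
proof -
  have \<tau>: "\<tau> > 0" and wc: "continuous_on (closure \<Omega>) w"
    using sol by (auto simp: is_solution_def Ck_closure_def)
  obtain P where P: "continuous_on (closure \<Omega>) P" "\<And>x. x \<in> \<Omega> \<Longrightarrow> GDERIV w x :> P x"
    and G: "\<And>\<Phi> \<Phi>'. (\<And>s. (\<Phi> has_real_derivative \<Phi>' s) (at s)) \<Longrightarrow> continuous_on UNIV \<Phi>' \<Longrightarrow>
      (LINT x:\<Omega>|lborel. \<Phi>' (w x) * (P x \<bullet> P x) - \<Phi> (w x) * R \<tau> (w x) / d) = 0"
    using solution_energy_identity[OF sol d] by blast
  note G = G[OF \<Phi>(1,2)]
  have \<Phi>c: "continuous_on UNIV \<Phi>"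
    using \<Phi>(1) DERIV_isCont by (blast intro: continuous_at_imp_continuous_on)
  have hc: "continuous_on (closure \<Omega>) (\<lambda>x. \<Phi>' (w x) * (P x \<bullet> P x) - \<Phi> (w x) * R \<tau> (w x) / d)"
    by (intro continuous_intros P(1) continuous_on_reactions \<tau> wc continuous_on_compose2[OF \<Phi>c wc]
        continuous_on_compose2[OF \<Phi>(2) wc]) (use d in auto)
  have nn: "\<Phi>' (w y) * (P y \<bullet> P y) \<ge> 0" "\<Phi> (w y) * R \<tau> (w y) / d \<le> 0" for y
    using \<Phi>(3) R d by (auto simp: divide_le_0_iff)
  have "\<Phi>' (w x) * (P x \<bullet> P x) - \<Phi> (w x) * R \<tau> (w x) / d = 0"
    using nn by (intro continuous_nonneg_integral_0[OF domain(1) continuous_on_subset[OF hc closure_subset]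
        set_integrable_continuous_closure[OF domain(1,2) hc] _ G x]) (smt (verit))
  then have "\<Phi> (w x) * R \<tau> (w x) / d = 0" using nn[of x] by linarith
  then show ?thesis using d by simp
qed

text \<open>Stampacchia's truncation: the test functions \<open>((w - M)\<^sup>+)\<^sup>2\<close> and \<open>- ((- w - M)\<^sup>+)\<^sup>2\<close> are nonzero only where
  the reaction has a strict sign.\<close>

lemma solution_bounded:
  assumes sol: "is_solution \<Omega> a1 b1 c1 a2 b2 c2 \<gamma> \<delta> d w \<tau>" and d: "d > 0"
    and M1: "\<And>s. s > M \<Longrightarrow> R \<tau> s < 0" and M2: "\<And>s. s < - M \<Longrightarrow> R \<tau> s > 0"
    and x: "x \<in> closure \<Omega>"
  shows "\<bar>w x\<bar> \<le> M"
proof -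
  have wc: "continuous_on (closure \<Omega>) w"
    using sol by (auto simp: is_solution_def Ck_closure_def)
  have lin: "((\<lambda>s. s - M) has_real_derivative 1) (at s)"
    "((\<lambda>s. - s - M) has_real_derivative - 1) (at s)" for s
    by (auto intro!: derivative_eq_intros)
  have shift: "((\<lambda>s. (max 0 (s - M))\<^sup>2) has_real_derivative 2 * max 0 (s - M)) (at s)"
    "((\<lambda>s. - (max 0 (- s - M))\<^sup>2) has_real_derivative 2 * max 0 (- s - M)) (at s)" for s
    using has_derivative_pos_part_square_comp[OF lin(1)]
      DERIV_minus[OF has_derivative_pos_part_square_comp[OF lin(2)]] by simp_all
  have "\<bar>w y\<bar> \<le> M" if y: "y \<in> \<Omega>" for y
  proof -
    have "(max 0 (w y - M))\<^sup>2 * R \<tau> (w y) = 0"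
    proof (rule solution_truncation[OF sol d shift(1) _ _ _ y])
      show "continuous_on UNIV (\<lambda>s. 2 * max 0 (s - M))" by (intro continuous_intros)
      show "(max 0 (s - M))\<^sup>2 * R \<tau> s \<le> 0" for s
        using M1[of s] by (cases "s > M") (auto simp: mult_le_0_iff)
    qed simp
    then have "w y \<le> M" using M1[of "w y"] by (cases "w y > M") auto
    have "- (max 0 (- w y - M))\<^sup>2 * R \<tau> (w y) = 0"
    proof (rule solution_truncation[OF sol d shift(2) _ _ _ y])
      show "continuous_on UNIV (\<lambda>s. 2 * max 0 (- s - M))" by (intro continuous_intros)
      show "- (max 0 (- s - M))\<^sup>2 * R \<tau> s \<le> 0" for s
        using M2[of s] by (cases "s < - M") auto
    qed simp
    then have "w y \<ge> - M" using M2[of "w y"] by (cases "w y < - M") auto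
    then show ?thesis using \<open>w y \<le> M\<close> by linarith
  qed
  then show ?thesis
    using continuous_on_closure_norm_le[OF wc _ x, of M] by simp
qed

text \<open>Testing with \<open>w - c\<close> for the mean \<open>c\<close> allows \<open>R \<tau> (w x)\<close> to be replaced by \<open>R \<tau> (w x) - R \<tau> c\<close>, which
  is Lipschitz in \<open>w x - c\<close>; Poincare's inequality then bounds \<open>d\<close> times the energy by \<open>L C\<close> times the energy.\<close>

lemma solution_constant:
  assumes sol: "is_solution \<Omega> a1 b1 c1 a2 b2 c2 \<gamma> \<delta> d w \<tau>" and d: "d > L * C"
    and L: "L > 0" and C: "C \<ge> 0"
    and M: "\<And>x. x \<in> closure \<Omega> \<Longrightarrow> \<bar>w x\<bar> \<le> M"
    and lip: "\<And>s s'. \<bar>s\<bar> \<le> M \<Longrightarrow> \<bar>s'\<bar> \<le> M \<Longrightarrow> \<bar>R \<tau> s - R \<tau> s'\<bar> \<le> L * \<bar>s - s'\<bar>"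
    and poincare: "\<And>P. continuous_on (closure \<Omega>) P \<Longrightarrow> (\<And>x. x \<in> \<Omega> \<Longrightarrow> GDERIV w x :> P x) \<Longrightarrow>
      (LINT x:\<Omega>|lborel. (w x - (LINT y:\<Omega>|lborel. w y) / measure lborel \<Omega>)\<^sup>2)
        \<le> C * (LINT x:\<Omega>|lborel. P x \<bullet> P x)"
  shows "w constant_on closure \<Omega>"
proof -
  have d0: "d > 0" using d L C by (meson le_less_trans mult_nonneg_nonneg less_imp_le)
  have \<tau>: "\<tau> > 0" and wc: "continuous_on (closure \<Omega>) w"
    using sol by (auto simp: is_solution_def Ck_closure_def)
  note Rc = continuous_on_reactions(3)[OF \<tau> wc]
  note si = set_integrable_continuous_closure[OF domain(1,2)]
  define m where "m = measure lborel \<Omega>"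
  have em: "emeasure lborel \<Omega> = ennreal m"
    unfolding m_def using emeasure_bounded_finite[OF domain(2)] by (auto intro!: emeasure_eq_ennreal_measure)
  have "emeasure lborel \<Omega> \<noteq> 0"
    by (rule emeasure_lborel_open_nonzero[OF domain(1,4)])
  then have m: "m > 0" using em by (auto simp: m_def zero_less_measure_iff)
  define c where "c = (LINT y:\<Omega>|lborel. w y) / m"
  have \<Omega>m: "integrable lborel (\<lambda>x. K * indicator \<Omega> x)" for K :: real
    using domain emeasure_bounded_finite[OF domain(2)]
    by (intro integrable_mult_right integrable_real_indicator) auto
  have cM: "\<bar>c\<bar> \<le> M"
  proof -
    have M0: "0 \<le> M" using M domain closure_subset by (metis abs_ge_zero all_not_in_conv order_trans subsetD)
    have "\<bar>LINT y:\<Omega>|lborel. w y\<bar> \<le> (\<integral>x. M * indicator \<Omega> x \<partial>lborel)"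
      by (rule set_integral_abs_bound[OF si[OF wc] \<Omega>m]) (use M M0 closure_subset in \<open>auto simp: indicator_def\<close>)
    also have "\<dots> = M * m" by (simp add: m_def)
    finally show ?thesis unfolding c_def using m by (simp add: field_simps abs_divide)
  qed
  obtain P where P: "continuous_on (closure \<Omega>) P" "\<And>x. x \<in> \<Omega> \<Longrightarrow> GDERIV w x :> P x"
    and G: "\<And>\<Phi> \<Phi>'. (\<And>s. (\<Phi> has_real_derivative \<Phi>' s) (at s)) \<Longrightarrow> continuous_on UNIV \<Phi>' \<Longrightarrow>
      (LINT x:\<Omega>|lborel. \<Phi>' (w x) * (P x \<bullet> P x) - \<Phi> (w x) * R \<tau> (w x) / d) = 0"
    using solution_energy_identity[OF sol d0] by blast
  define D where "D = (LINT x:\<Omega>|lborel. P x \<bullet> P x)"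
  have Di: "set_integrable lborel \<Omega> (\<lambda>x. P x \<bullet> P x)" by (intro si continuous_intros P(1))
  have D0: "D \<ge> 0" unfolding D_def set_lebesgue_integral_def by (intro integral_nonneg_AE AE_I2) auto
  have i1: "set_integrable lborel \<Omega> (\<lambda>x. (w x - c) * R \<tau> (w x))"
    "set_integrable lborel \<Omega> (\<lambda>x. R \<tau> c * (w x - c))"
    "set_integrable lborel \<Omega> (\<lambda>x. (w x - c) * (R \<tau> (w x) - R \<tau> c))"
    "set_integrable lborel \<Omega> (\<lambda>x. (w x - c)\<^sup>2)"
    by (intro si continuous_intros wc Rc)+
  have "(LINT x:\<Omega>|lborel. 1 * (P x \<bullet> P x) - (w x - c) * R \<tau> (w x) / d) = 0"
    by (rule G) (auto intro!: derivative_eq_intros)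
  then have "d * D = (LINT x:\<Omega>|lborel. (w x - c) * R \<tau> (w x))"
    using set_integral_diff(2)[OF Di set_integrable_divide[OF i1(1), of d]] d0
    by (simp add: D_def field_simps)
  also have "\<dots> = (LINT x:\<Omega>|lborel. (w x - c) * (R \<tau> (w x) - R \<tau> c) + R \<tau> c * (w x - c))"
    by (simp add: algebra_simps)
  also have "\<dots> = (LINT x:\<Omega>|lborel. (w x - c) * (R \<tau> (w x) - R \<tau> c)) + (LINT x:\<Omega>|lborel. R \<tau> c * (w x - c))"
    by (rule set_integral_add(2)[OF i1(3,2)])
  finally have dD: "d * D = (LINT x:\<Omega>|lborel. (w x - c) * (R \<tau> (w x) - R \<tau> c))
      + (LINT x:\<Omega>|lborel. R \<tau> c * (w x - c))" .
  have mean0: "(LINT x:\<Omega>|lborel. R \<tau> c * (w x - c)) = 0"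
  proof -
    have "(LINT x:\<Omega>|lborel. w x - c) = (LINT x:\<Omega>|lborel. w x) - (LINT x:\<Omega>|lborel. c)"
      by (intro set_integral_diff(2) si wc continuous_intros)
    also have "(LINT x:\<Omega>|lborel. c) = c * m" by (simp add: set_lebesgue_integral_def m_def mult.commute)
    also have "(LINT x:\<Omega>|lborel. w x) - c * m = 0" using m by (simp add: c_def)
    finally show ?thesis by simp
  qed
  have "d * D = (LINT x:\<Omega>|lborel. (w x - c) * (R \<tau> (w x) - R \<tau> c))"
    unfolding dD mean0 by simp
  also have "\<dots> \<le> (LINT x:\<Omega>|lborel. L * (w x - c)\<^sup>2)"
  proof (rule set_integral_mono[OF i1(3) set_integrable_mult_right[OF i1(4)]])
    fix x assume x: "x \<in> \<Omega>"
    have "\<bar>R \<tau> (w x) - R \<tau> c\<bar> \<le> L * \<bar>w x - c\<bar>"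
      by (rule lip[OF _ cM]) (use M x closure_subset in blast)
    then have "\<bar>w x - c\<bar> * \<bar>R \<tau> (w x) - R \<tau> c\<bar> \<le> \<bar>w x - c\<bar> * (L * \<bar>w x - c\<bar>)"
      by (intro mult_left_mono) auto
    also have "\<dots> = L * (w x - c)\<^sup>2" by (simp add: power2_eq_square mult_ac flip: abs_mult)
    finally show "(w x - c) * (R \<tau> (w x) - R \<tau> c) \<le> L * (w x - c)\<^sup>2"
      by (simp flip: abs_mult) 
  qed
  also have "\<dots> \<le> L * (C * D)"
  proof -
    have "(LINT x:\<Omega>|lborel. (w x - c)\<^sup>2) \<le> C * D"
      unfolding c_def m_def D_def by (rule poincare[OF P])
    then show ?thesis using L by (simp only: set_integral_mult_right mult_left_mono less_imp_le)
  qed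
  finally have "(d - L * C) * D \<le> 0" by (simp add: algebra_simps)
  then have "D = 0" using d D0 by (simp add: mult_le_0_iff)
  have P0: "P x = 0" if x: "x \<in> \<Omega>" for x
  proof -
    have "P x \<bullet> P x = 0"
    proof (rule continuous_nonneg_integral_0[OF domain(1) _ Di _ _ x])
      show "continuous_on \<Omega> (\<lambda>x. P x \<bullet> P x)"
        by (intro continuous_intros continuous_on_subset[OF P(1) closure_subset])
      show "(LINT x:\<Omega>|lborel. P x \<bullet> P x) = 0" using \<open>D = 0\<close> by (simp add: D_def)
    qed simp
    then show ?thesis by simp
  qed
  obtain x0 where x0: "x0 \<in> \<Omega>" using domain by blast
  have "w x = w x0" if "x \<in> \<Omega>" for x
    by (rule has_derivative_zero_unique_connected[OF domain(1,3) _ that x0])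
      (use P(2) P0 in \<open>simp add: gderiv_def\<close>)
  then have "w x = w x0" if "x \<in> closure \<Omega>" for x
    using continuous_constant_on_closure[OF wc _ that] by blast
  then show ?thesis unfolding constant_on_def by blast
qed

end

theorem theorem3p1:
  fixes \<Omega> :: "'a::euclidean_space set"
    and a1 b1 c1 a2 b2 c2 \<gamma> \<delta> :: real
  assumes "smooth_bounded_domain \<Omega>"
    and "a1 > 0" "b1 > 0" "c1 > 0" "a2 > 0" "b2 > 0" "c2 > 0" "\<gamma> > 0" "\<delta> > 0"
  shows "(\<exists>C>0. \<forall>d>0. \<forall>w \<tau>. is_solution \<Omega> a1 b1 c1 a2 b2 c2 \<gamma> \<delta> d w \<tau> \<longrightarrow>
            sup_norm \<Omega> w \<le> C \<and>
            \<tau> \<le> min (a1\<^sup>2 / (4 * b1 * c1)) (a2\<^sup>2 / (4 * b2 * c2)))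
       \<and> (\<exists>dbar>0. \<forall>d>dbar. \<not> (\<exists>w \<tau>. is_solution \<Omega> a1 b1 c1 a2 b2 c2 \<gamma> \<delta> d w \<tau> \<and>
            \<not> w constant_on closure \<Omega>))"
proof -
  note pos = assms(2-9)
  let ?R = "net_reaction a1 b1 c1 a2 b2 c2 \<gamma> \<delta>"
  define T where "T = a1\<^sup>2 / (4 * b1 * c1)"
  have T: "T > 0" unfolding T_def using pos by simp
  obtain M where M: "M > 0" and neg: "\<And>\<tau> s. 0 < \<tau> \<Longrightarrow> \<tau> \<le> T \<Longrightarrow> s > M \<Longrightarrow> ?R \<tau> s < 0"
    and ps: "\<And>\<tau> s. 0 < \<tau> \<Longrightarrow> \<tau> \<le> T \<Longrightarrow> s < - M \<Longrightarrow> ?R \<tau> s > 0"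
    using net_reaction_signs[OF pos T] by blast
  obtain L where L: "L > 0"
    and lip: "\<And>\<tau> s s'. 0 < \<tau> \<Longrightarrow> \<tau> \<le> T \<Longrightarrow> \<bar>s\<bar> \<le> M \<Longrightarrow> \<bar>s'\<bar> \<le> M \<Longrightarrow> \<bar>?R \<tau> s - ?R \<tau> s'\<bar> \<le> L * \<bar>s - s'\<bar>"
    using net_reaction_Lipschitz[OF pos T M] by blast
  obtain C where C: "C \<ge> 0"
    and poincare: "\<And>w P. continuous_on (closure \<Omega>) w \<Longrightarrow> continuous_on (closure \<Omega>) P \<Longrightarrow>
      (\<And>x. x \<in> \<Omega> \<Longrightarrow> GDERIV w x :> P x) \<Longrightarrow>
      (LINT x:\<Omega>|lborel. (w x - (LINT y:\<Omega>|lborel. w y) / measure lborel \<Omega>)\<^sup>2)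
        \<le> C * (LINT x:\<Omega>|lborel. P x \<bullet> P x)"
    using Poincare_inequality[OF assms(1)] by blast
  have tau: "0 < \<tau>" "\<tau> \<le> T" "\<tau> \<le> a2\<^sup>2 / (4 * b2 * c2)"
    and bound: "\<And>x. x \<in> closure \<Omega> \<Longrightarrow> \<bar>w x\<bar> \<le> M"
    if sol: "is_solution \<Omega> a1 b1 c1 a2 b2 c2 \<gamma> \<delta> d w \<tau>" and d: "d > 0" for d w \<tau>
  proof -
    show t: "0 < \<tau>" "\<tau> \<le> T" "\<tau> \<le> a2\<^sup>2 / (4 * b2 * c2)"
      using sol solution_tau_bounds[OF assms sol d] by (auto simp: is_solution_def T_def)
    show "\<bar>w x\<bar> \<le> M" if "x \<in> closure \<Omega>" for x
      using solution_bounded[OF assms sol d neg[OF t(1,2)] ps[OF t(1,2)] that] .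
  qed
  have ne: "closure \<Omega> \<noteq> {}" using assms(1) by (auto simp: smooth_bounded_domain_def)
  show ?thesis
  proof (rule conjI[OF exI[of _ M] exI[of _ "L * C + 1"]]; intro conjI allI impI notI)
    fix d w \<tau> assume d: "d > 0" and sol: "is_solution \<Omega> a1 b1 c1 a2 b2 c2 \<gamma> \<delta> d w \<tau>"
    show "sup_norm \<Omega> w \<le> M"
      unfolding sup_norm_def using bound[OF sol d] by (intro cSUP_least ne)
    show "\<tau> \<le> min (a1\<^sup>2 / (4 * b1 * c1)) (a2\<^sup>2 / (4 * b2 * c2))"
      using tau[OF sol d] by (simp add: T_def)
  next
    show "L * C + 1 > 0" using mult_nonneg_nonneg[of L C] L C by linarith
  next
    fix d assume d: "d > L * C + 1"
      and "\<exists>w \<tau>. is_solution \<Omega> a1 b1 c1 a2 b2 c2 \<gamma> \<delta> d w \<tau> \<and> \<not> w constant_on closure \<Omega>"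
    then obtain w \<tau> where sol: "is_solution \<Omega> a1 b1 c1 a2 b2 c2 \<gamma> \<delta> d w \<tau>"
      and nc: "\<not> w constant_on closure \<Omega>" by blast
    have d0: "d > 0" using d mult_nonneg_nonneg[of L C] L C by linarith
    have dLC: "d > L * C" using d by simp
    have wc: "continuous_on (closure \<Omega>) w" using sol by (auto simp: is_solution_def Ck_closure_def)
    have "w constant_on closure \<Omega>"
      by (rule solution_constant[OF assms sol dLC L C bound[OF sol d0]
            lip[OF tau(1,2)[OF sol d0]] poincare[OF wc]])
    then show False using nc by contradiction
  qed (rule M)
qed

end
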